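(* Let $M$ be a nonzero $\mathfrak{g}$-module in $\mathcal{O}$. Then $H_D^{\mathfrak{g},\mathfrak{h}}(M)\neq 0$.
   Context: Let $\mathfrak{g}$ be a finite-dimensional complex semisimple Lie algebra with Killing form $\langle\cdot,\cdot\rangle$, $\theta$ a Cartan involution of $\mathfrak{g}$, and $\mathfrak{h}\subseteq\mathfrak{g}$ a Lie subalgebra which is reductive, $\theta$-stable, such that $\langle\cdot,\cdot\rangle|_{\mathfrak{h}\times\mathfrak{h}}$ is nondegenerate, and which contains a Cartan subalgebra $\mathfrak{t}$ of $\mathfrak{g}$. Put $\mathfrak{q}=\mathfrak{h}^\perp$, so $\mathfrak{g}=\mathfrak{h}\oplus\mathfrak{q}$. The root system $\Delta=\Delta(\mathfrak{g},\mathfrak{t})$ is the disjoint union of $\Delta_\mathfrak{h}=\Delta(\mathfrak{h},\mathfrak{t})$ and $\Delta_\mathfrak{q}$ (the roots whose root spaces lie in $\mathfrak{q}$). Fix a positive system $\Delta^+$, and put $\Delta_\mathfrak{q}^+=\Delta^+\cap\Delta_\mathfrak{q}$, $\mathfrak{n}=\bigoplus_{\alpha\in\Delta^+}\mathfrak{g}_\alpha$, $\mathfrak{n}_\mathfrak{q}^\pm=\bigoplus_{\beta\in\Delta_\mathfrak{q}^+}\mathfrak{g}_{\pm\beta}$. Category $\mathcal{O}$: finitely generated $U(\mathfrak{g})$-modules which are weight modules for $\mathfrak{t}$ and locally $\mathfrak{n}$-finite. Clifford algebra and spin module: $\mathbf{C}(\mathfrak{q})$ is the quotient of the tensor algebra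 $T(\mathfrak{q})$ by the relations $X\otimes Y+Y\otimes X=\langle X,Y\rangle$. The spin module is $S=\bigwedge\mathfrak{n}_\mathfrak{q}^-$, with Clifford action $\gamma$ in which $\mathfrak{n}_\mathfrak{q}^-$ acts by exterior multiplication and $\mathfrak{n}_\mathfrak{q}^+$ by contraction via $\langle\cdot,\cdot\rangle$. For $a,b\in\mathfrak{q}$ let $R_{a,b}\in\mathfrak{so}(\mathfrak{q})$, $R_{a,b}(v)=\langle b,v\rangle a-\langle a,v\rangle b$; these span $\mathfrak{so}(\mathfrak{q})$ and $\varphi(R_{a,b})=\frac12[\gamma(a),\gamma(b)]$ defines an injective Lie algebra map $\varphi:\mathfrak{so}(\mathfrak{q})\to\mathbf{C}(\mathfrak{q})$. $\mathfrak{h}$ acts on $S$ via $\mathfrak{h}\xrightarrow{\mathrm{ad}}\mathfrak{so}(\mathfrak{q})\xrightarrow{\varphi}\mathbf{C}(\mathfrak{q})\to\mathrm{End}(S)$, and on $M\otimes S$ diagonally. Dirac operator: for a $\mathfrak{g}$-module $(M,\pi)$ and an orthonormal basis $\{Z_j\}$ of $\mathfrak{q}$, $D_{\mathfrak{g},\mathfrak{h}}(M)=\sum_j\pi(Z_j)\otimes\gamma(Z_j)-1\otimes\gamma(c)$ acting on $M\otimes S$, where $\gamma(c)=\frac16\sum_{i,j,k}\langle Z_i,[Z_j,Z_k]\rangle\gamma(Z_i)\gamma(Z_j)\gamma(Z_k)$. It is independent of the basis and $\mathfrak{h}$-equivariant. The Dirac cohomology is the $\mathfrak{h}$-module $H_D^{\mathfrak{g},\mathfrak{h}}(M)=\ker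 D_{\mathfrak{g},\mathfrak{h}}(M)/(\mathrm{im}\,D_{\mathfrak{g},\mathfrak{h}}(M)\cap\ker D_{\mathfrak{g},\mathfrak{h}}(M))$. *)

theory Defs
  imports Complex_Main "HOL-Library.Poly_Mapping"
begin

section \<open>Complex vector spaces\<close>

class scaleC =
  fixes scaleC :: "complex \<Rightarrow> 'a \<Rightarrow> 'a" (infixr "*\<^sub>C" 75)

class complex_vector = scaleC + ab_group_add +
  assumes scaleC_add_right: "a *\<^sub>C (x + y) = a *\<^sub>C x + a *\<^sub>C y"
    and scaleC_add_left: "(a + b) *\<^sub>C x = a *\<^sub>C x + b *\<^sub>C x"
    and scaleC_scaleC: "a *\<^sub>C b *\<^sub>C x = (a * b) *\<^sub>C x"
    and scaleC_one: "1 *\<^sub>C x = x"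

global_interpretation cvec: vector_space "scaleC :: complex \<Rightarrow> 'a \<Rightarrow> 'a::complex_vector"
  by unfold_locales (simp_all add: scaleC_add_right scaleC_add_left scaleC_scaleC scaleC_one)

abbreviation clinear :: "('a::complex_vector \<Rightarrow> 'b::complex_vector) \<Rightarrow> bool"
  where "clinear \<equiv> Vector_Spaces.linear scaleC scaleC"

lemma clinearI:
  assumes "\<And>x y. f (x + y) = f x + f y" "\<And>c x. f (c *\<^sub>C x) = c *\<^sub>C f x"
  shows "clinear f"
  by (simp add: Vector_Spaces.linear_def module_hom_def module_hom_axioms_def assms
      cvec.vector_space_axioms cvec.module_axioms)

lemma clinear_add: "clinear f \<Longrightarrow> f (x + y) = f x + f y"
  by (simp add: Vector_Spaces.linear_def module_hom_def module_hom_axioms_def)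

lemma clinear_scale: "clinear f \<Longrightarrow> f (c *\<^sub>C x) = c *\<^sub>C f x"
  by (simp add: Vector_Spaces.linear_def module_hom_def module_hom_axioms_def)

lemma clinear_diff: "clinear f \<Longrightarrow> f (x - y) = f x - f y"
  by (metis clinear_add diff_add_cancel add_diff_cancel)

lemma clinear_span_zero:
  assumes f: "clinear f" and z: "\<And>r. r \<in> R \<Longrightarrow> f r = 0" and x: "x \<in> cvec.span R"
  shows "f x = 0"
  using x
proof (induction rule: cvec.span_induct_alt)
  case base
  show ?case using clinear_scale[OF f, of 0 0] by simp
next
  case (step c x y)
  then show ?case using f z by (simp add: clinear_add clinear_scale)
qed

instantiation complex :: complex_vector
begin
definition "c *\<^sub>C (z::complex) = c * z"
instance by standard (simp_all add: scaleC_complex_def algebra_simps)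
end

definition finite_dim :: "'a::complex_vector set \<Rightarrow> bool"
  where "finite_dim V \<longleftrightarrow> (\<exists>B. finite B \<and> cvec.span B = V)"

definition trace :: "('a::complex_vector \<Rightarrow> 'a) \<Rightarrow> complex"
  where "trace A = (\<Sum>b\<in>cvec.extend_basis {}. cvec.representation (cvec.extend_basis {}) (A b) b)"
  \<comment> \<open>\<open>extend_basis {}\<close> is a basis of the whole space; meaningful in finite dimension.\<close>

definition coset :: "'a::ab_group_add set \<Rightarrow> 'a \<Rightarrow> 'a set"
  where "coset W x = (\<lambda>w. x + w) ` W"

definition quotient_space :: "'a::ab_group_add set \<Rightarrow> 'a set \<Rightarrow> 'a set set"
  where "quotient_space U W = coset W ` U"


section \<open>Free vector spaces, tensor products and exterior algebras\<close>

instantiation poly_mapping :: (type, complex_vector) complex_vector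
begin
lift_definition scaleC_poly_mapping :: "complex \<Rightarrow> ('a \<Rightarrow>\<^sub>0 'b) \<Rightarrow> 'a \<Rightarrow>\<^sub>0 'b"
  is "\<lambda>c p k. c *\<^sub>C p k"
proof -
  fix c :: complex and p :: "'a \<Rightarrow> 'b"
  assume "finite {k. p k \<noteq> 0}"
  then show "finite {k. c *\<^sub>C p k \<noteq> 0}"
    by (rule finite_subset[rotated]) auto
qed
instance
  by (standard; transfer) (simp_all add: fun_eq_iff scaleC_add_right scaleC_add_left scaleC_scaleC scaleC_one)
end

abbreviation free_gen :: "'x \<Rightarrow> 'x \<Rightarrow>\<^sub>0 complex"
  where "free_gen k \<equiv> Poly_Mapping.single k 1"

definition lin_ext :: "('x \<Rightarrow> 'v::complex_vector) \<Rightarrow> ('x \<Rightarrow>\<^sub>0 complex) \<Rightarrow> 'v"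
  where "lin_ext f p = (\<Sum>k\<in>Poly_Mapping.keys p. Poly_Mapping.lookup p k *\<^sub>C f k)"

lemma lin_ext_superset:
  assumes "finite K" "Poly_Mapping.keys p \<subseteq> K"
  shows "lin_ext f p = (\<Sum>k\<in>K. Poly_Mapping.lookup p k *\<^sub>C f k)"
  unfolding lin_ext_def using assms
  by (intro sum.mono_neutral_left) (auto simp: in_keys_iff)

lemma clinear_lin_ext: "clinear (lin_ext f)"
proof (rule clinearI)
  fix p q :: "'a \<Rightarrow>\<^sub>0 complex"
  let ?K = "Poly_Mapping.keys p \<union> Poly_Mapping.keys q"
  have "Poly_Mapping.keys (p + q) \<subseteq> ?K" by (rule Poly_Mapping.keys_add)
  then show "lin_ext f (p + q) = lin_ext f p + lin_ext f q"
    by (simp add: lin_ext_superset[of ?K] lookup_add scaleC_add_left sum.distrib)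
next
  fix c and p :: "'a \<Rightarrow>\<^sub>0 complex"
  have "Poly_Mapping.keys (c *\<^sub>C p) \<subseteq> Poly_Mapping.keys p"
    by (auto simp: in_keys_iff scaleC_poly_mapping.rep_eq)
  then show "lin_ext f (c *\<^sub>C p) = c *\<^sub>C lin_ext f p"
    by (simp add: lin_ext_superset[of "Poly_Mapping.keys p"] scaleC_poly_mapping.rep_eq
        cvec.scale_sum_right scaleC_complex_def scaleC_scaleC)
qed

lemma lin_ext_gen [simp]: "lin_ext f (free_gen k) = f k"
  by (simp add: lin_ext_def scaleC_one)

definition tensor_relations :: "('a::complex_vector \<times> 'b::complex_vector \<Rightarrow>\<^sub>0 complex) set" where
  "tensor_relations =
      {free_gen (x + x', y) - free_gen (x, y) - free_gen (x', y) | x x' y. True}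
    \<union> {free_gen (x, y + y') - free_gen (x, y) - free_gen (x, y') | x y y'. True}
    \<union> {free_gen (c *\<^sub>C x, y) - c *\<^sub>C free_gen (x, y) | c x y. True}
    \<union> {free_gen (x, c *\<^sub>C y) - c *\<^sub>C free_gen (x, y) | c x y. True}"

definition tensor_rel ::
  "('a::complex_vector \<times> 'b::complex_vector \<Rightarrow>\<^sub>0 complex) \<Rightarrow> ('a \<times> 'b \<Rightarrow>\<^sub>0 complex) \<Rightarrow> bool"
  where "tensor_rel p q \<longleftrightarrow> p - q \<in> cvec.span tensor_relations"

text \<open>Words \<open>[x\<^sub>1, \<dots>, x\<^sub>k]\<close> in the vectors of \<open>V\<close> span the free associative algebra on the set
  \<open>V\<close>. The exterior algebra is its quotient by the two-sided ideal that makes words multilinear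
  (which gives the tensor algebra) and kills \<open>x \<otimes> x\<close>.\<close>

definition exterior_relations :: "('a::complex_vector list \<Rightarrow>\<^sub>0 complex) set" where
  "exterior_relations =
      {free_gen (u @ (x + y) # v) - free_gen (u @ x # v) - free_gen (u @ y # v) | u x y v. True}
    \<union> {free_gen (u @ (c *\<^sub>C x) # v) - c *\<^sub>C free_gen (u @ x # v) | u c x v. True}
    \<union> {free_gen (u @ x # x # v) | u x v. True}"

definition exterior_rel ::
  "('a::complex_vector list \<Rightarrow>\<^sub>0 complex) \<Rightarrow> ('a list \<Rightarrow>\<^sub>0 complex) \<Rightarrow> bool"
  where "exterior_rel p q \<longleftrightarrow> p - q \<in> cvec.span exterior_relations"

lemma equivp_span_diff: "equivp (\<lambda>p q. p - q \<in> cvec.span R)"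
proof (rule equivpI)
  show "reflp (\<lambda>p q. p - q \<in> cvec.span R)" by (simp add: reflp_def cvec.span_zero)
  show "symp (\<lambda>p q. p - q \<in> cvec.span R)"
    by (metis (mono_tags, lifting) sympI cvec.span_neg minus_diff_eq)
  show "transp (\<lambda>p q. p - q \<in> cvec.span R)"
  proof (rule transpI)
    fix x y z assume "x - y \<in> cvec.span R" "y - z \<in> cvec.span R"
    then have "(x - y) + (y - z) \<in> cvec.span R" by (rule cvec.span_add)
    then show "x - z \<in> cvec.span R" by simp
  qed
qed

quotient_type (overloaded) ('a, 'b) tensor =
  "'a::complex_vector \<times> 'b::complex_vector \<Rightarrow>\<^sub>0 complex" / tensor_rel
  unfolding tensor_rel_def by (rule equivp_span_diff)

quotient_type (overloaded) 'a exterior = "'a::complex_vector list \<Rightarrow>\<^sub>0 complex" / exterior_rel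
  unfolding exterior_rel_def by (rule equivp_span_diff)

lemma span_diff_cong:
  assumes "p - p' \<in> cvec.span R" "q - q' \<in> cvec.span R"
  shows "(p + q) - (p' + q') \<in> cvec.span R" "(p - q) - (p' - q') \<in> cvec.span R"
    "- p - (- p') \<in> cvec.span R" "c *\<^sub>C p - c *\<^sub>C p' \<in> cvec.span R"
proof -
  show "(p + q) - (p' + q') \<in> cvec.span R"
    using cvec.span_add[OF assms] by (simp add: algebra_simps)
  show "(p - q) - (p' - q') \<in> cvec.span R"
    using cvec.span_diff[OF assms] by (simp add: algebra_simps)
  show "- p - (- p') \<in> cvec.span R"
    using cvec.span_neg[OF assms(1)] by simp
  show "c *\<^sub>C p - c *\<^sub>C p' \<in> cvec.span R"
    using cvec.span_scale[OF assms(1), of c] by (simp add: cvec.scale_right_diff_distrib)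
qed

instantiation tensor :: (complex_vector, complex_vector) complex_vector
begin
lift_definition zero_tensor :: "('a, 'b) tensor" is 0 .
lift_definition plus_tensor :: "('a, 'b) tensor \<Rightarrow> ('a, 'b) tensor \<Rightarrow> ('a, 'b) tensor" is "(+)"
  unfolding tensor_rel_def by (rule span_diff_cong)
lift_definition minus_tensor :: "('a, 'b) tensor \<Rightarrow> ('a, 'b) tensor \<Rightarrow> ('a, 'b) tensor" is "(-)"
  unfolding tensor_rel_def by (rule span_diff_cong)
lift_definition uminus_tensor :: "('a, 'b) tensor \<Rightarrow> ('a, 'b) tensor" is uminus
  unfolding tensor_rel_def by (rule span_diff_cong)
lift_definition scaleC_tensor :: "complex \<Rightarrow> ('a, 'b) tensor \<Rightarrow> ('a, 'b) tensor" is scaleC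
  unfolding tensor_rel_def by (rule span_diff_cong)
instance
  by (standard; transfer)
    (simp_all add: tensor_rel_def cvec.span_zero algebra_simps
      scaleC_add_right scaleC_add_left scaleC_scaleC scaleC_one)
end

instantiation exterior :: (complex_vector) complex_vector
begin
lift_definition zero_exterior :: "'a exterior" is 0 .
lift_definition plus_exterior :: "'a exterior \<Rightarrow> 'a exterior \<Rightarrow> 'a exterior" is "(+)"
  unfolding exterior_rel_def by (rule span_diff_cong)
lift_definition minus_exterior :: "'a exterior \<Rightarrow> 'a exterior \<Rightarrow> 'a exterior" is "(-)"
  unfolding exterior_rel_def by (rule span_diff_cong)
lift_definition uminus_exterior :: "'a exterior \<Rightarrow> 'a exterior" is uminus
  unfolding exterior_rel_def by (rule span_diff_cong)
lift_definition scaleC_exterior :: "complex \<Rightarrow> 'a exterior \<Rightarrow> 'a exterior" is scaleC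
  unfolding exterior_rel_def by (rule span_diff_cong)
instance
  by (standard; transfer)
    (simp_all add: exterior_rel_def cvec.span_zero algebra_simps
      scaleC_add_right scaleC_add_left scaleC_scaleC scaleC_one)
end

definition tensor_of :: "'a::complex_vector \<Rightarrow> 'b::complex_vector \<Rightarrow> ('a, 'b) tensor"  (infixr "\<otimes>" 70)
  where "x \<otimes> y = abs_tensor (free_gen (x, y))"

definition wedges :: "'a::complex_vector list \<Rightarrow> 'a exterior"
  where "wedges ys = abs_exterior (free_gen ys)"
  \<comment> \<open>\<open>y\<^sub>1 \<and> \<dots> \<and> y\<^sub>k\<close>; the empty word is the unit \<open>1\<close>.\<close>

text \<open>The two lifts below are independent of the representative as soon as the given map on
  generators respects the relations; see \<open>tensor_lift_abs\<close> and \<open>exterior_lift_abs\<close>.\<close>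

definition tensor_lift ::
  "('a::complex_vector \<times> 'b::complex_vector \<Rightarrow> 'v::complex_vector) \<Rightarrow> ('a, 'b) tensor \<Rightarrow> 'v"
  where "tensor_lift f t = lin_ext f (rep_tensor t)"

definition exterior_lift :: "('a::complex_vector list \<Rightarrow> 'v::complex_vector) \<Rightarrow> 'a exterior \<Rightarrow> 'v"
  where "exterior_lift f s = lin_ext f (rep_exterior s)"

definition tensor_map ::
  "('a::complex_vector \<Rightarrow> 'c::complex_vector) \<Rightarrow> ('b::complex_vector \<Rightarrow> 'd::complex_vector) \<Rightarrow>
    ('a, 'b) tensor \<Rightarrow> ('c, 'd) tensor"
  where "tensor_map A B = tensor_lift (\<lambda>(x, y). A x \<otimes> B y)"

definition wedge :: "'a::complex_vector \<Rightarrow> 'a exterior \<Rightarrow> 'a exterior"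
  where "wedge y = exterior_lift (\<lambda>ys. wedges (y # ys))"

fun contract_word :: "('a::complex_vector \<Rightarrow> complex) \<Rightarrow> 'a list \<Rightarrow> 'a exterior" where
  "contract_word f [] = 0"
| "contract_word f (y # ys) = f y *\<^sub>C wedges ys - wedge y (contract_word f ys)"

definition contract :: "('a::complex_vector \<Rightarrow> complex) \<Rightarrow> 'a exterior \<Rightarrow> 'a exterior"
  where "contract f = exterior_lift (contract_word f)"


subsection \<open>Well-definedness of the induced maps\<close>

lemma abs_tensor_eq_iff: "abs_tensor p = abs_tensor q \<longleftrightarrow> p - q \<in> cvec.span tensor_relations"
  by (simp add: tensor.abs_eq_iff tensor_rel_def)

lemma abs_exterior_eq_iff: "abs_exterior p = abs_exterior q \<longleftrightarrow> p - q \<in> cvec.span exterior_relations"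
  by (simp add: exterior.abs_eq_iff exterior_rel_def)

lemma abs_rep_tensor [simp]: "abs_tensor (rep_tensor t) = t"
  by (rule Quotient3_abs_rep[OF Quotient3_tensor])

lemma abs_rep_exterior [simp]: "abs_exterior (rep_exterior s) = s"
  by (rule Quotient3_abs_rep[OF Quotient3_exterior])

lemma tensor_lift_abs:
  assumes "\<And>r. r \<in> tensor_relations \<Longrightarrow> lin_ext f r = 0"
  shows "tensor_lift f (abs_tensor p) = lin_ext f p"
proof -
  have "rep_tensor (abs_tensor p) - p \<in> cvec.span tensor_relations"
    by (simp flip: abs_tensor_eq_iff)
  from clinear_span_zero[OF clinear_lin_ext assms this]
  show ?thesis by (simp add: tensor_lift_def clinear_diff[OF clinear_lin_ext])
qed

lemma exterior_lift_abs:
  assumes "\<And>r. r \<in> exterior_relations \<Longrightarrow> lin_ext f r = 0"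
  shows "exterior_lift f (abs_exterior p) = lin_ext f p"
proof -
  have "rep_exterior (abs_exterior p) - p \<in> cvec.span exterior_relations"
    by (simp flip: abs_exterior_eq_iff)
  from clinear_span_zero[OF clinear_lin_ext assms this]
  show ?thesis by (simp add: exterior_lift_def clinear_diff[OF clinear_lin_ext])
qed

lemma clinear_tensor_lift:
  assumes "\<And>r. r \<in> tensor_relations \<Longrightarrow> lin_ext f r = 0"
  shows "clinear (tensor_lift f)"
proof (rule clinearI)
  fix s t c
  show "tensor_lift f (s + t) = tensor_lift f s + tensor_lift f t"
    using tensor_lift_abs[OF assms] clinear_add[OF clinear_lin_ext]
    by (metis abs_rep_tensor plus_tensor.abs_eq)
  show "tensor_lift f (c *\<^sub>C s) = c *\<^sub>C tensor_lift f s"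
    using tensor_lift_abs[OF assms] clinear_scale[OF clinear_lin_ext]
    by (metis abs_rep_tensor scaleC_tensor.abs_eq)
qed

lemma clinear_exterior_lift:
  assumes "\<And>r. r \<in> exterior_relations \<Longrightarrow> lin_ext f r = 0"
  shows "clinear (exterior_lift f)"
proof (rule clinearI)
  fix s t c
  show "exterior_lift f (s + t) = exterior_lift f s + exterior_lift f t"
    using exterior_lift_abs[OF assms] clinear_add[OF clinear_lin_ext]
    by (metis abs_rep_exterior plus_exterior.abs_eq)
  show "exterior_lift f (c *\<^sub>C s) = c *\<^sub>C exterior_lift f s"
    using exterior_lift_abs[OF assms] clinear_scale[OF clinear_lin_ext]
    by (metis abs_rep_exterior scaleC_exterior.abs_eq)
qed

lemma tensor_of_bilinear:
  "(x + x') \<otimes> y = x \<otimes> y + x' \<otimes> y" "x \<otimes> (y + y') = x \<otimes> y + x \<otimes> y'"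
  "(c *\<^sub>C x) \<otimes> y = c *\<^sub>C (x \<otimes> y)" "x \<otimes> (c *\<^sub>C y) = c *\<^sub>C (x \<otimes> y)"
  unfolding tensor_of_def plus_tensor.abs_eq scaleC_tensor.abs_eq abs_tensor_eq_iff diff_diff_eq[symmetric]
  by (rule cvec.span_base, force simp: tensor_relations_def)+

lemma wedges_relations:
  "wedges (u @ (x + y) # v) = wedges (u @ x # v) + wedges (u @ y # v)"
  "wedges (u @ (c *\<^sub>C x) # v) = c *\<^sub>C wedges (u @ x # v)"
  "wedges (u @ x # x # v) = 0"
proof -
  have "free_gen (u @ (x + y) # v) - free_gen (u @ x # v) - free_gen (u @ y # v) \<in> exterior_relations"
    unfolding exterior_relations_def by blast
  from cvec.span_base[OF this]
  show "wedges (u @ (x + y) # v) = wedges (u @ x # v) + wedges (u @ y # v)"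
    unfolding wedges_def plus_exterior.abs_eq abs_exterior_eq_iff diff_diff_eq[symmetric] .
  have "free_gen (u @ (c *\<^sub>C x) # v) - c *\<^sub>C free_gen (u @ x # v) \<in> exterior_relations"
    unfolding exterior_relations_def by blast
  from cvec.span_base[OF this]
  show "wedges (u @ (c *\<^sub>C x) # v) = c *\<^sub>C wedges (u @ x # v)"
    unfolding wedges_def scaleC_exterior.abs_eq abs_exterior_eq_iff .
  have "free_gen (u @ x # x # v) \<in> exterior_relations"
    unfolding exterior_relations_def by blast
  from cvec.span_base[OF this]
  show "wedges (u @ x # x # v) = 0"
    unfolding wedges_def zero_exterior_def abs_exterior_eq_iff by simp
qed

lemma lin_ext_exterior_relations:
  assumes "\<And>u x y v. f (u @ (x + y) # v) = f (u @ x # v) + f (u @ y # v)"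
    and "\<And>u c x v. f (u @ (c *\<^sub>C x) # v) = c *\<^sub>C f (u @ x # v)"
    and "\<And>u x v. f (u @ x # x # v) = 0"
    and "r \<in> exterior_relations"
  shows "lin_ext f r = 0"
  using assms(4) unfolding exterior_relations_def
  by (auto simp: clinear_diff[OF clinear_lin_ext] clinear_scale[OF clinear_lin_ext] assms(1-3))

lemma tensor_map_relations:
  assumes "clinear A" "clinear B" "r \<in> tensor_relations"
  shows "lin_ext (\<lambda>(x, y). A x \<otimes> B y) r = 0"
  using assms(3) unfolding tensor_relations_def
  by (auto simp: clinear_diff[OF clinear_lin_ext] clinear_scale[OF clinear_lin_ext]
      clinear_add[OF assms(1)] clinear_add[OF assms(2)]
      clinear_scale[OF assms(1)] clinear_scale[OF assms(2)] tensor_of_bilinear)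

lemma tensor_map:
  assumes "clinear A" "clinear B"
  shows tensor_map_of: "tensor_map A B (x \<otimes> y) = A x \<otimes> B y"
    and clinear_tensor_map: "clinear (tensor_map A B)"
proof -
  note rel = tensor_map_relations[OF assms]
  show "tensor_map A B (x \<otimes> y) = A x \<otimes> B y"
    unfolding tensor_map_def tensor_of_def[of x y] by (simp add: tensor_lift_abs[OF rel])
  show "clinear (tensor_map A B)"
    unfolding tensor_map_def by (rule clinear_tensor_lift[OF rel])
qed

lemma wedge_relations:
  assumes "r \<in> exterior_relations"
  shows "lin_ext (\<lambda>ys. wedges (y # ys)) r = 0"
  by (rule lin_ext_exterior_relations[OF _ _ _ assms])
    (metis append_Cons wedges_relations(1), metis append_Cons wedges_relations(2),
      metis append_Cons wedges_relations(3))

lemma wedge_wedges: "wedge y (wedges ys) = wedges (y # ys)"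
  unfolding wedge_def wedges_def[of ys] by (simp add: exterior_lift_abs[OF wedge_relations])

lemma clinear_wedge: "clinear (wedge y)"
  unfolding wedge_def by (rule clinear_exterior_lift[OF wedge_relations])

lemma exterior_induct [case_names zero step]:
  assumes "P 0" "\<And>c ys s. P s \<Longrightarrow> P (c *\<^sub>C wedges ys + s)"
  shows "P s"
proof -
  have gen: "P (abs_exterior p)" for p :: "'a list \<Rightarrow>\<^sub>0 complex"
  proof -
    have "p \<in> cvec.span (range free_gen)"
    proof -
      have "p = (\<Sum>k\<in>Poly_Mapping.keys p. Poly_Mapping.lookup p k *\<^sub>C free_gen k)"
        by (rule poly_mapping_eqI)
          (auto simp: lookup_sum scaleC_poly_mapping.rep_eq lookup_single when_def
            scaleC_complex_def if_distrib in_keys_iff cong: if_cong)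
      then show ?thesis
        by (metis (no_types, lifting) cvec.span_base cvec.span_scale cvec.span_sum rangeI)
    qed
    then show ?thesis
    proof (induction rule: cvec.span_induct_alt)
      case base
      then show ?case using assms(1) by (simp add: zero_exterior_def)
    next
      case (step c x y)
      then obtain k where "x = free_gen k" by blast
      with step assms(2)[of "abs_exterior y" c k] show ?case
        by (simp add: wedges_def scaleC_exterior.abs_eq plus_exterior.abs_eq)
    qed
  qed
  show ?thesis using gen[of "rep_exterior s"] by simp
qed

lemma wedge_linear_arg:
  "wedge (x + y) s = wedge x s + wedge y s" "wedge (c *\<^sub>C x) s = c *\<^sub>C wedge x s"
  "wedge x (wedge x s) = 0"
proof -
  note lin = clinear_add[OF clinear_wedge] clinear_scale[OF clinear_wedge]
  have z: "wedge x 0 = 0" for x :: 'a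
    using clinear_scale[OF clinear_wedge, of x 0 0] by simp
  show "wedge (x + y) s = wedge x s + wedge y s"
    by (induction s rule: exterior_induct)
      (simp_all add: z lin wedge_wedges wedges_relations(1)[of "[]", simplified] scaleC_add_right algebra_simps)
  show "wedge (c *\<^sub>C x) s = c *\<^sub>C wedge x s"
    by (induction s rule: exterior_induct)
      (simp_all add: z lin wedge_wedges wedges_relations(2)[of "[]", simplified] scaleC_add_right
        scaleC_scaleC mult.commute)
  show "wedge x (wedge x s) = 0"
    by (induction s rule: exterior_induct)
      (simp_all add: z lin wedge_wedges wedges_relations(3)[of "[]", simplified])
qed

lemma contract_relations:
  assumes "clinear f" "r \<in> exterior_relations"
  shows "lin_ext (contract_word f) r = 0"
proof (rule lin_ext_exterior_relations[OF _ _ _ assms(2)])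
  note lin = clinear_add[OF clinear_wedge] clinear_scale[OF clinear_wedge] clinear_diff[OF clinear_wedge]
  note fl = clinear_add[OF assms(1)] clinear_scale[OF assms(1)]
  have z: "wedge x 0 = 0" for x :: 'a
    using clinear_scale[OF clinear_wedge, of x 0 0] by simp
  show "contract_word f (u @ (x + y) # v) = contract_word f (u @ x # v) + contract_word f (u @ y # v)"
    for u x y v
    by (induction u)
      (simp_all add: fl lin wedge_linear_arg scaleC_add_left scaleC_add_right wedges_relations algebra_simps)
  show "contract_word f (u @ (c *\<^sub>C x) # v) = c *\<^sub>C contract_word f (u @ x # v)" for u c x v
    by (induction u)
      (simp_all add: fl lin wedge_linear_arg scaleC_complex_def scaleC_scaleC wedges_relations
        cvec.scale_right_diff_distrib mult.commute)
  show "contract_word f (u @ x # x # v) = 0" for u x v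
    by (induction u)
      (simp_all add: lin wedge_linear_arg wedge_wedges wedges_relations z)
qed

lemma contract:
  assumes "clinear f"
  shows contract_one: "contract f (wedges []) = 0"
    and contract_wedge: "contract f (wedge y s) = f y *\<^sub>C s - wedge y (contract f s)"
    and clinear_contract: "clinear (contract f)"
proof -
  note rel = contract_relations[OF assms]
  have w: "contract f (wedges ys) = contract_word f ys" for ys
    unfolding contract_def wedges_def by (simp add: exterior_lift_abs[OF rel])
  show "contract f (wedges []) = 0" by (simp add: w)
  show c: "clinear (contract f)"
    unfolding contract_def by (rule clinear_exterior_lift[OF rel])
  note lin = clinear_add[OF clinear_wedge] clinear_scale[OF clinear_wedge]
    clinear_add[OF c] clinear_scale[OF c]
  have z: "wedge x 0 = 0" "contract f 0 = 0" for x :: 'a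
    using clinear_scale[OF clinear_wedge, of x 0 0] clinear_scale[OF c, of 0 0] by simp_all
  show "contract f (wedge y s) = f y *\<^sub>C s - wedge y (contract f s)"
    by (induction s rule: exterior_induct)
      (simp_all add: z lin w wedge_wedges scaleC_add_right scaleC_scaleC mult.commute
        cvec.scale_right_diff_distrib)
qed


section \<open>Lie algebras\<close>

class complex_lie_algebra = complex_vector +
  fixes bracket :: "'a \<Rightarrow> 'a \<Rightarrow> 'a"
  assumes bracket_add_left: "bracket (x + y) z = bracket x z + bracket y z"
    and bracket_add_right: "bracket x (y + z) = bracket x y + bracket x z"
    and bracket_scale_left: "bracket (c *\<^sub>C x) y = c *\<^sub>C bracket x y"
    and bracket_scale_right: "bracket x (c *\<^sub>C y) = c *\<^sub>C bracket x y"
    and bracket_self: "bracket x x = 0"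
    and jacobi: "bracket x (bracket y z) + bracket y (bracket z x) + bracket z (bracket x y) = 0"

definition killing :: "'g::complex_lie_algebra \<Rightarrow> 'g \<Rightarrow> complex"
  where "killing x y = trace (\<lambda>z. bracket x (bracket y z))"

definition lie_subalgebra :: "'g::complex_lie_algebra set \<Rightarrow> bool"
  where "lie_subalgebra L \<longleftrightarrow> cvec.subspace L \<and> (\<forall>x\<in>L. \<forall>y\<in>L. bracket x y \<in> L)"

definition lie_ideal :: "'g::complex_lie_algebra set \<Rightarrow> 'g set \<Rightarrow> bool"
  where "lie_ideal L I \<longleftrightarrow> cvec.subspace I \<and> I \<subseteq> L \<and> (\<forall>x\<in>L. \<forall>y\<in>I. bracket x y \<in> I)"

fun derived_series :: "'g::complex_lie_algebra set \<Rightarrow> nat \<Rightarrow> 'g set" where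
  "derived_series L 0 = L"
| "derived_series L (Suc n) =
    cvec.span {bracket x y | x y. x \<in> derived_series L n \<and> y \<in> derived_series L n}"

definition solvable :: "'g::complex_lie_algebra set \<Rightarrow> bool"
  where "solvable L \<longleftrightarrow> (\<exists>n. derived_series L n = {0})"

text \<open>The sum of all solvable ideals; in finite dimension, the largest one.\<close>

definition lie_radical :: "'g::complex_lie_algebra set \<Rightarrow> 'g set"
  where "lie_radical L = cvec.span (\<Union>{I. lie_ideal L I \<and> solvable I})"

definition lie_center :: "'g::complex_lie_algebra set \<Rightarrow> 'g set"
  where "lie_center L = {x \<in> L. \<forall>y\<in>L. bracket x y = 0}"

definition semisimple :: "'g::complex_lie_algebra set \<Rightarrow> bool"
  where "semisimple L \<longleftrightarrow> lie_radical L = {0}"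

definition reductive :: "'g::complex_lie_algebra set \<Rightarrow> bool"
  where "reductive L \<longleftrightarrow> lie_radical L = lie_center L"

text \<open>A Cartan involution of \<open>\<gg>\<close> regarded as a real Lie algebra: an involutive real-linear
  automorphism \<open>\<theta>\<close> such that \<open>- B (x, \<theta> y)\<close> is positive definite, where \<open>B = 2 Re killing\<close> is the
  Killing form of the underlying real Lie algebra. (For semisimple \<open>\<gg>\<close> these are the conjugations
  with respect to the compact real forms, so \<open>\<theta>\<close> is conjugate linear.)\<close>

definition cartan_involution :: "('g::complex_lie_algebra \<Rightarrow> 'g) \<Rightarrow> bool"
  where "cartan_involution \<theta> \<longleftrightarrow>
    (\<forall>x y. \<theta> (x + y) = \<theta> x + \<theta> y) \<and>
    (\<forall>r x. \<theta> (complex_of_real r *\<^sub>C x) = complex_of_real r *\<^sub>C \<theta> x) \<and>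
    (\<forall>x y. \<theta> (bracket x y) = bracket (\<theta> x) (\<theta> y)) \<and>
    (\<forall>x. \<theta> (\<theta> x) = x) \<and>
    (\<forall>x. x \<noteq> 0 \<longrightarrow> - (2 * Re (killing x (\<theta> x))) > 0)"

definition nondegenerate_on :: "('g::complex_vector \<Rightarrow> 'g \<Rightarrow> complex) \<Rightarrow> 'g set \<Rightarrow> bool"
  where "nondegenerate_on b V \<longleftrightarrow> (\<forall>x\<in>V. (\<forall>y\<in>V. b x y = 0) \<longrightarrow> x = 0)"

text \<open>Cartan subalgebra of a complex semisimple Lie algebra: a maximal abelian subalgebra all of
  whose elements are ad-diagonalisable.\<close>

definition abelian_subalgebra :: "'g::complex_lie_algebra set \<Rightarrow> bool"
  where "abelian_subalgebra A \<longleftrightarrow> lie_subalgebra A \<and> (\<forall>x\<in>A. \<forall>y\<in>A. bracket x y = 0)"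

definition ad_semisimple :: "'g::complex_lie_algebra \<Rightarrow> bool"
  where "ad_semisimple x \<longleftrightarrow> cvec.span {y. \<exists>c. bracket x y = c *\<^sub>C y} = UNIV"

definition cartan_subalgebra :: "'g::complex_lie_algebra set \<Rightarrow> bool"
  where "cartan_subalgebra \<tt> \<longleftrightarrow> abelian_subalgebra \<tt> \<and>
    (\<forall>A. abelian_subalgebra A \<and> \<tt> \<subseteq> A \<longrightarrow> A = \<tt>) \<and> (\<forall>x\<in>\<tt>. ad_semisimple x)"

text \<open>Linear functionals on a subspace are represented by functions vanishing off it.\<close>

definition dual_space :: "'g::complex_vector set \<Rightarrow> ('g \<Rightarrow> complex) set"
  where "dual_space V = {\<mu>. (\<forall>x\<in>V. \<forall>y\<in>V. \<mu> (x + y) = \<mu> x + \<mu> y) \<and>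
    (\<forall>c. \<forall>x\<in>V. \<mu> (c *\<^sub>C x) = c * \<mu> x) \<and> (\<forall>x. x \<notin> V \<longrightarrow> \<mu> x = 0)}"

definition weight_space :: "('g \<Rightarrow> 'm::complex_vector \<Rightarrow> 'm) \<Rightarrow> 'g set \<Rightarrow> ('g \<Rightarrow> complex) \<Rightarrow> 'm set"
  where "weight_space \<rho> \<tt> \<mu> = {v. \<forall>x\<in>\<tt>. \<rho> x v = \<mu> x *\<^sub>C v}"

abbreviation root_space :: "'g::complex_lie_algebra set \<Rightarrow> ('g \<Rightarrow> complex) \<Rightarrow> 'g set"
  where "root_space \<equiv> weight_space bracket"

definition roots :: "'g::complex_lie_algebra set \<Rightarrow> ('g \<Rightarrow> complex) set"
  where "roots \<tt> = {\<alpha> \<in> dual_space \<tt>. (\<exists>x. \<alpha> x \<noteq> 0) \<and> root_space \<tt> \<alpha> \<noteq> {0}}"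

text \<open>A positive system consists of the roots that are positive on a Weyl chamber, that is, at a
  regular element \<open>x\<close> of the real form of \<open>\<tt>\<close> on which all roots are real.\<close>

definition positive_system :: "'g::complex_lie_algebra set \<Rightarrow> ('g \<Rightarrow> complex) set \<Rightarrow> bool"
  where "positive_system \<tt> P \<longleftrightarrow>
    (\<exists>x\<in>\<tt>. (\<forall>\<alpha>\<in>roots \<tt>. \<alpha> x \<in> \<real> \<and> \<alpha> x \<noteq> 0) \<and> P = {\<alpha> \<in> roots \<tt>. Re (\<alpha> x) > 0})"

definition orth :: "'g::complex_lie_algebra set \<Rightarrow> 'g set"
  where "orth L = {x. \<forall>y\<in>L. killing x y = 0}"

definition roots_q_pos ::
  "'g::complex_lie_algebra set \<Rightarrow> 'g set \<Rightarrow> ('g \<Rightarrow> complex) set \<Rightarrow> ('g \<Rightarrow> complex) set"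
  where "roots_q_pos \<hh> \<tt> P = {\<beta> \<in> P. root_space \<tt> \<beta> \<subseteq> orth \<hh>}"

definition nilp :: "'g::complex_lie_algebra set \<Rightarrow> ('g \<Rightarrow> complex) set \<Rightarrow> 'g set"
  where "nilp \<tt> P = cvec.span (\<Union>\<alpha>\<in>P. root_space \<tt> \<alpha>)"

definition nq_plus ::
  "'g::complex_lie_algebra set \<Rightarrow> 'g set \<Rightarrow> ('g \<Rightarrow> complex) set \<Rightarrow> 'g set"
  where "nq_plus \<hh> \<tt> P = cvec.span (\<Union>\<beta>\<in>roots_q_pos \<hh> \<tt> P. root_space \<tt> \<beta>)"

definition nq_minus ::
  "'g::complex_lie_algebra set \<Rightarrow> 'g set \<Rightarrow> ('g \<Rightarrow> complex) set \<Rightarrow> 'g set"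
  where "nq_minus \<hh> \<tt> P = cvec.span (\<Union>\<beta>\<in>roots_q_pos \<hh> \<tt> P. root_space \<tt> (\<lambda>x. - \<beta> x))"


section \<open>Modules and category O\<close>

definition lie_module :: "('g::complex_lie_algebra \<Rightarrow> 'm::complex_vector \<Rightarrow> 'm) \<Rightarrow> bool"
  where "lie_module \<rho> \<longleftrightarrow> (\<forall>x. clinear (\<rho> x)) \<and> (\<forall>v. clinear (\<lambda>x. \<rho> x v)) \<and>
    (\<forall>x y v. \<rho> (bracket x y) v = \<rho> x (\<rho> y v) - \<rho> y (\<rho> x v))"

text \<open>For a Lie subalgebra \<open>L\<close> this is \<open>U(L) \<cdot> F\<close>: the \<open>U(L)\<close>-submodules are the \<open>L\<close>-stable
  subspaces.\<close>

definition generated_submodule ::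
  "('g \<Rightarrow> 'm::complex_vector \<Rightarrow> 'm) \<Rightarrow> 'g set \<Rightarrow> 'm set \<Rightarrow> 'm set"
  where "generated_submodule \<rho> L F =
    \<Inter>{N. cvec.subspace N \<and> (\<forall>x\<in>L. \<forall>v\<in>N. \<rho> x v \<in> N) \<and> F \<subseteq> N}"

definition category_O ::
  "'g::complex_lie_algebra set \<Rightarrow> ('g \<Rightarrow> complex) set \<Rightarrow> ('g \<Rightarrow> 'm::complex_vector \<Rightarrow> 'm) \<Rightarrow> bool"
  where "category_O \<tt> P \<rho> \<longleftrightarrow> lie_module \<rho> \<and>
    (\<exists>F. finite F \<and> generated_submodule \<rho> UNIV F = UNIV) \<and>
    cvec.span (\<Union>\<mu>\<in>dual_space \<tt>. weight_space \<rho> \<tt> \<mu>) = UNIV \<and>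
    (\<forall>v. finite_dim (generated_submodule \<rho> (nilp \<tt> P) {v}))"


section \<open>Spin module, Dirac operator and Dirac cohomology\<close>

text \<open>The spin module \<open>S = \<And> \<nn>\<^sub>\<qq>\<^sup>-\<close> is taken inside \<open>\<And> \<gg>\<close>, as the subalgebra generated by
  \<open>\<nn>\<^sub>\<qq>\<^sup>-\<close>, and \<open>M \<otimes> S\<close> inside \<open>M \<otimes> \<And> \<gg>\<close>; both natural maps are injective over a field. The
  Clifford action below is written on \<open>\<And> \<gg>\<close> and preserves \<open>S\<close>.\<close>

definition spin_module ::
  "'g::complex_lie_algebra set \<Rightarrow> 'g set \<Rightarrow> ('g \<Rightarrow> complex) set \<Rightarrow> 'g exterior set"
  where "spin_module \<hh> \<tt> P = cvec.span {wedges ys | ys. set ys \<subseteq> nq_minus \<hh> \<tt> P}"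

text \<open>For \<open>z = x + y\<close> in \<open>\<qq> = \<nn>\<^sub>\<qq>\<^sup>+ \<oplus> \<nn>\<^sub>\<qq>\<^sup>-\<close>, \<open>\<gamma>(z)\<close> is contraction by \<open>\<langle>x, \<cdot>\<rangle>\<close> plus exterior
  multiplication by \<open>y\<close>, so that \<open>\<gamma>(a) \<gamma>(b) + \<gamma>(b) \<gamma>(a) = \<langle>a, b\<rangle>\<close>.\<close>

definition clifford_action ::
  "'g::complex_lie_algebra set \<Rightarrow> 'g set \<Rightarrow> ('g \<Rightarrow> complex) set \<Rightarrow> 'g \<Rightarrow> 'g exterior \<Rightarrow> 'g exterior"
  where "clifford_action \<hh> \<tt> P z s =
    contract (killing (THE x. x \<in> nq_plus \<hh> \<tt> P \<and> z - x \<in> nq_minus \<hh> \<tt> P)) s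
    + wedge (THE y. y \<in> nq_minus \<hh> \<tt> P \<and> z - y \<in> nq_plus \<hh> \<tt> P) s"

definition orthonormal_basis :: "'g::complex_lie_algebra set \<Rightarrow> 'g set \<Rightarrow> bool"
  where "orthonormal_basis V Z \<longleftrightarrow> cvec.independent Z \<and> cvec.span Z = V \<and>
    (\<forall>x\<in>Z. \<forall>y\<in>Z. killing x y = (if x = y then 1 else 0))"

definition cubic_term ::
  "('g::complex_lie_algebra \<Rightarrow> 's::complex_vector \<Rightarrow> 's) \<Rightarrow> 'g set \<Rightarrow> 's \<Rightarrow> 's"
  where "cubic_term \<gamma> Z s = (1 / 6) *\<^sub>C
    (\<Sum>x\<in>Z. \<Sum>y\<in>Z. \<Sum>z\<in>Z. killing x (bracket y z) *\<^sub>C \<gamma> x (\<gamma> y (\<gamma> z s)))"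

definition dirac_operator ::
  "'g::complex_lie_algebra set \<Rightarrow> 'g set \<Rightarrow> ('g \<Rightarrow> complex) set \<Rightarrow> 'g set \<Rightarrow>
    ('g \<Rightarrow> 'm::complex_vector \<Rightarrow> 'm) \<Rightarrow> ('m, 'g exterior) tensor \<Rightarrow> ('m, 'g exterior) tensor"
  where "dirac_operator \<hh> \<tt> P Z \<rho> u =
    (\<Sum>z\<in>Z. tensor_map (\<rho> z) (clifford_action \<hh> \<tt> P z) u)
    - tensor_map (\<lambda>v. v) (cubic_term (clifford_action \<hh> \<tt> P) Z) u"

definition spin_tensor ::
  "'g::complex_lie_algebra set \<Rightarrow> 'g set \<Rightarrow> ('g \<Rightarrow> complex) set \<Rightarrow>
    ('m::complex_vector, 'g exterior) tensor set"
  where "spin_tensor \<hh> \<tt> P = cvec.span {v \<otimes> s | v s. s \<in> spin_module \<hh> \<tt> P}"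

definition dirac_kernel ::
  "'g::complex_lie_algebra set \<Rightarrow> 'g set \<Rightarrow> ('g \<Rightarrow> complex) set \<Rightarrow> 'g set \<Rightarrow>
    ('g \<Rightarrow> 'm::complex_vector \<Rightarrow> 'm) \<Rightarrow> ('m, 'g exterior) tensor set"
  where "dirac_kernel \<hh> \<tt> P Z \<rho> = {u \<in> spin_tensor \<hh> \<tt> P. dirac_operator \<hh> \<tt> P Z \<rho> u = 0}"

definition dirac_boundaries ::
  "'g::complex_lie_algebra set \<Rightarrow> 'g set \<Rightarrow> ('g \<Rightarrow> complex) set \<Rightarrow> 'g set \<Rightarrow>
    ('g \<Rightarrow> 'm::complex_vector \<Rightarrow> 'm) \<Rightarrow> ('m, 'g exterior) tensor set"
  where "dirac_boundaries \<hh> \<tt> P Z \<rho> =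
    dirac_operator \<hh> \<tt> P Z \<rho> ` spin_tensor \<hh> \<tt> P \<inter> dirac_kernel \<hh> \<tt> P Z \<rho>"

definition dirac_cohomology ::
  "'g::complex_lie_algebra set \<Rightarrow> 'g set \<Rightarrow> ('g \<Rightarrow> complex) set \<Rightarrow> 'g set \<Rightarrow>
    ('g \<Rightarrow> 'm::complex_vector \<Rightarrow> 'm) \<Rightarrow> ('m, 'g exterior) tensor set set"
  where "dirac_cohomology \<hh> \<tt> P Z \<rho> =
    quotient_space (dirac_kernel \<hh> \<tt> P Z \<rho>) (dirac_boundaries \<hh> \<tt> P Z \<rho>)"

end

theory Submission
  imports Defs
begin

text \<open>Let \<open>x \<in> \<tt>\<close> be a regular element defining the positive system and grade everything by
  the eigenvalues of \<open>x\<close>. The real parts of the \<open>x\<close>-eigenvalues on \<open>M\<close> are bounded above, so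
  some eigenspace \<open>M\<^sub>c \<noteq> 0\<close> has no eigenvalue \<open>a\<close> with \<open>Re a \<ge> Re c + r\<close> above it, where
  \<open>r > 0\<close> is the least value of a positive root at \<open>x\<close>. Since \<open>x\<close> acts on \<open>\<nn>\<^sub>\<qq>\<^sup>-\<close> with
  eigenvalues at most \<open>- r\<close>, the \<open>c\<close>-eigenspace of the total grading operator
  \<open>H = x \<otimes> 1 + 1 \<otimes> x\<close> on \<open>M \<otimes> S\<close> is \<open>M\<^sub>c \<otimes> 1\<close>. The Dirac operator commutes with \<open>H\<close> and
  anticommutes with the parity of \<open>S\<close>, so it vanishes on \<open>M\<^sub>c \<otimes> 1\<close>, and none of these
  vectors except \<open>0\<close> is in its image. That the Clifford action is well defined on all of \<open>\<qq>\<close> uses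
  that a root space meeting \<open>\<qq>\<close> nontrivially lies in \<open>\<qq>\<close>; an \<open>\<ss>\<ll>\<^sub>2\<close> argument shows this
  without the one-dimensionality of root spaces.\<close>

section \<open>Eigenspaces and traces\<close>

text \<open>Roots are real at \<open>x\<close>, but the eigenvalues of \<open>x\<close> on
  \<open>M\<close> may be arbitrary complex numbers, so only real parts are compared. Their supremum
  is not shown to be attained; an eigenvalue closer to it than \<open>r\<close> serves as a
  substitute for a highest weight. \<open>D\<close> commutes with \<open>H\<close> because
  \<open>ad x\<close> is skew for the Killing form on \<open>orth \<hh>\<close>, so that the tensor
  \<Sum> z \<otimes> z over an orthonormal basis is invariant; for the cubic term the invariance of
  the form \<open>killing a [b, c]\<close> enters as well. \<open>D\<close> maps a vector m
  \<otimes> 1 with m in the chosen eigenspace to some m' \<otimes> 1, which is again even, while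
  \<open>D\<close> is odd: this forces the value 0. Nonzero vectors of this kind are not in the
  image because \<open>D\<close> preserves the span of the remaining \<open>H\<close>-eigenspaces.
  The obstacle lies in the definite descriptions in \<open>clifford_action\<close>: they have the
  intended values only where a vector splits uniquely along \<open>nq_plus\<close> and
  \<open>nq_minus\<close>. A root space with a nonzero part in \<open>orth \<hh>\<close> but not
  contained in it would be missing from both, and no splitting would exist there.\<close>

lemma clinear_zero: "clinear f \<Longrightarrow> f 0 = 0"
  using clinear_scale[of f 0 0] by simp

lemma clinear_neg: "clinear f \<Longrightarrow> f (- x) = - f x"
  using clinear_diff[of f 0 x] by (simp add: clinear_zero)

lemma clinear_sum: "clinear f \<Longrightarrow> f (sum g A) = (\<Sum>a\<in>A. f (g a))"
  by (induction A rule: infinite_finite_induct) (simp_all add: clinear_zero clinear_add)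

lemma span_Union_decomp:
  fixes E :: "'i \<Rightarrow> 'v::complex_vector set"
  assumes E: "\<And>i. i \<in> I \<Longrightarrow> cvec.subspace (E i)" and v: "v \<in> cvec.span (\<Union>i\<in>I. E i)"
  obtains A w where "finite A" "A \<subseteq> I" "\<And>i. i \<in> A \<Longrightarrow> w i \<in> E i" "v = (\<Sum>i\<in>A. w i)"
proof -
  from v have "\<exists>A w. finite A \<and> A \<subseteq> I \<and> (\<forall>i\<in>A. w i \<in> E i) \<and> v = (\<Sum>i\<in>A. w i)"
  proof (induction rule: cvec.span_induct_alt)
    case base
    show ?case by (rule exI[of _ "{}"]) simp
  next
    case (step c x y)
    then obtain j where j: "j \<in> I" "x \<in> E j" by blast
    from step obtain A w where A: "finite A" "A \<subseteq> I" "\<forall>i\<in>A. w i \<in> E i" "y = (\<Sum>i\<in>A. w i)"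
      by blast
    \<comment> \<open>The generator may lie in a space \<open>E j\<close> that is already used, so
      it is merged into that summand; outside \<open>A\<close> the value of \<open>w\<close> is
      arbitrary and is replaced by \<open>0\<close>.\<close>
    define w' where "w' = w(j := (if j \<in> A then w j else 0) + c *\<^sub>C x)"
    have "(\<Sum>i\<in>insert j A. w' i) = w' j + (\<Sum>i\<in>A - {j}. w' i)"
      using A(1) by (simp add: sum.insert_remove)
    also have "(\<Sum>i\<in>A - {j}. w' i) = (\<Sum>i\<in>A - {j}. w i)"
      by (rule sum.cong) (auto simp: w'_def)
    also have "w' j + \<dots> = c *\<^sub>C x + y"
      using A(1) by (cases "j \<in> A") (simp_all add: w'_def A(4) sum.remove[of A j] algebra_simps)
    finally have "c *\<^sub>C x + y = (\<Sum>i\<in>insert j A. w' i)" ..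
    moreover have "\<forall>i\<in>insert j A. w' i \<in> E i"
      using A(3) j E[OF j(1)] cvec.subspace_scale[OF E[OF j(1)], of x c]
      by (auto simp: w'_def cvec.subspace_add)
    ultimately show ?case using A(1,2) j(1) by (intro exI[of _ "insert j A"] exI[of _ w']) auto
  qed
  with that show ?thesis by blast
qed

text \<open>Applying \<open>op i - val \<nu> i\<close> kills the \<open>\<nu>\<close>-summand and
  multiplies the \<open>\<kappa>\<close>-summand by a nonzero scalar, so the number of summands
  drops. With \<open>W = {0}\<close> this gives independence of distinct weight spaces; for a
  general stable \<open>W\<close> it shows that \<open>W\<close> is graded.\<close>

lemma weight_component:
  fixes op :: "'i \<Rightarrow> 'v::complex_vector \<Rightarrow> 'v" and val :: "'k \<Rightarrow> 'i \<Rightarrow> complex"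
  assumes "finite A" and lin: "\<And>i. i \<in> I \<Longrightarrow> clinear (op i)" and W: "cvec.subspace W"
    and stable: "\<And>i v. i \<in> I \<Longrightarrow> v \<in> W \<Longrightarrow> op i v \<in> W"
    and "\<And>\<mu> \<nu>. \<mu> \<in> A \<Longrightarrow> \<nu> \<in> A \<Longrightarrow> \<mu> \<noteq> \<nu> \<Longrightarrow> \<exists>i\<in>I. val \<mu> i \<noteq> val \<nu> i"
    and "\<And>\<mu>. \<mu> \<in> A \<Longrightarrow> w \<mu> \<in> weight_space op I (val \<mu>)"
    and "(\<Sum>\<mu>\<in>A. w \<mu>) \<in> W" and "\<kappa> \<in> A"
  shows "w \<kappa> \<in> W"
  using assms(1,5-)
proof (induction "card A" arbitrary: A w)
  case 0
  then show ?case by simp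
next
  case (Suc n)
  show ?case
  proof (cases "A = {\<kappa>}")
    case True
    with Suc.prems show ?thesis by simp
  next
    case False
    with Suc.prems obtain \<nu> where \<nu>: "\<nu> \<in> A" "\<nu> \<noteq> \<kappa>" by blast
    from Suc.prems(2)[OF \<open>\<kappa> \<in> A\<close> \<nu>(1)] \<nu>(2) obtain i where i: "i \<in> I" "val \<kappa> i \<noteq> val \<nu> i" by metis
    define w' where "w' \<mu> = (val \<mu> i - val \<nu> i) *\<^sub>C w \<mu>" for \<mu>
    have wi: "op i (w \<mu>) = val \<mu> i *\<^sub>C w \<mu>" if "\<mu> \<in> A" for \<mu>
      using Suc.prems(3)[OF that] i by (simp add: weight_space_def)
    have "op i (\<Sum>\<mu>\<in>A. w \<mu>) - val \<nu> i *\<^sub>C (\<Sum>\<mu>\<in>A. w \<mu>) = (\<Sum>\<mu>\<in>A. w' \<mu>)"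
      by (simp add: clinear_sum[OF lin[OF i(1)]] cvec.scale_sum_right wi w'_def
          cvec.scale_left_diff_distrib sum_subtractf)
    also have "\<dots> = (\<Sum>\<mu>\<in>A - {\<nu>}. w' \<mu>)"
      using Suc.prems(1) \<nu>(1) by (simp add: sum.remove[of A \<nu>] w'_def)
    finally have sum: "(\<Sum>\<mu>\<in>A - {\<nu>}. w' \<mu>) \<in> W"
      using Suc.prems(4) i(1) W stable by (metis cvec.subspace_diff cvec.subspace_scale)
    have "w' \<kappa> \<in> W"
    proof (rule Suc.hyps(1)[of "A - {\<nu>}"])
      show "n = card (A - {\<nu>})" using Suc.hyps(2) Suc.prems(1) \<nu>(1) by simp
      show "w' \<mu> \<in> weight_space op I (val \<mu>)" if "\<mu> \<in> A - {\<nu>}" for \<mu>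
        using Suc.prems(3)[of \<mu>] that lin
        by (auto simp: weight_space_def w'_def clinear_scale scaleC_scaleC mult.commute)
    qed (use Suc.prems \<nu> sum in auto)
    then have "inverse (val \<kappa> i - val \<nu> i) *\<^sub>C w' \<kappa> \<in> W" by (rule cvec.subspace_scale[OF W])
    then show ?thesis using i(2) by (simp add: w'_def scaleC_scaleC scaleC_one)
  qed
qed

lemma subspace_weight_space:
  assumes "\<And>i. i \<in> I \<Longrightarrow> clinear (op i)"
  shows "cvec.subspace (weight_space op I \<mu>)"
  by (rule cvec.subspaceI)
    (auto simp: weight_space_def clinear_zero clinear_add clinear_scale assms scaleC_add_right
      scaleC_scaleC mult.commute)

definition eigenspace :: "('v::complex_vector \<Rightarrow> 'v) \<Rightarrow> complex \<Rightarrow> 'v set"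
  where "eigenspace T c = {v. T v = c *\<^sub>C v}"

lemma eigenspace_weight_space: "eigenspace T c = weight_space (\<lambda>_::unit. T) UNIV (\<lambda>_. c)"
  by (simp add: eigenspace_def weight_space_def)

lemma subspace_eigenspace: "clinear T \<Longrightarrow> cvec.subspace (eigenspace T c)"
  unfolding eigenspace_weight_space by (rule subspace_weight_space)

lemma eigen_component:
  assumes "finite A" "clinear T" "cvec.subspace W" "\<And>v. v \<in> W \<Longrightarrow> T v \<in> W"
    and "\<And>a. a \<in> A \<Longrightarrow> w a \<in> eigenspace T a" and "(\<Sum>a\<in>A. w a) \<in> W" and "c \<in> A"
  shows "w c \<in> W"
  by (rule weight_component[of A "UNIV :: unit set" "\<lambda>_. T" W "\<lambda>a _. a"])
    (use assms in \<open>auto simp: eigenspace_weight_space\<close>)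

lemma eigenspace_Int_span:
  assumes T: "clinear T" and v: "v \<in> eigenspace T c" and c: "c \<notin> A"
    and "v \<in> cvec.span (\<Union>a\<in>A. eigenspace T a)"
  shows "v = 0"
proof -
  from assms(4) obtain B w where B: "finite B" "B \<subseteq> A"
    "\<And>a. a \<in> B \<Longrightarrow> w a \<in> eigenspace T a" "v = (\<Sum>a\<in>B. w a)"
    by (rule span_Union_decomp[rotated]) (auto intro: subspace_eigenspace T)
  \<comment> \<open>Adjoining \<open>- v\<close> as the \<open>c\<close>-component turns the
    decomposition into a sum equal to \<open>0\<close>, so that \<open>eigen_component\<close>
    applies with \<open>W = {0}\<close>.\<close>
  define w' where "w' = w(c := - v)"
  have "c \<notin> B" using B(2) c by blast
  then have "(\<Sum>a\<in>insert c B. w' a) = - v + (\<Sum>a\<in>B. w a)"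
    using B(1) by (auto simp: w'_def intro!: sum.cong)
  then have sum: "(\<Sum>a\<in>insert c B. w' a) \<in> {0}" using B(4) by simp
  have "w' c \<in> {0}"
    by (rule eigen_component[OF _ T _ _ _ sum])
      (use B(1,3) v T in \<open>auto simp: w'_def clinear_zero subspace_eigenspace cvec.subspace_neg\<close>)
  then show ?thesis by (simp add: w'_def)
qed

text \<open>Eigenvectors chosen for distinct eigenvalues are independent, hence no more numerous
  than a finite spanning set. This makes root strings terminate and leaves a gap between
  \<open>0\<close> and the positive roots at \<open>x\<close>.\<close>

lemma finite_eigenvalues:
  fixes T :: "'v::complex_vector \<Rightarrow> 'v"
  assumes fd: "finite_dim (UNIV :: 'v set)" and T: "clinear T"
  shows "finite {a. \<exists>v. v \<noteq> 0 \<and> v \<in> eigenspace T a}" (is "finite ?L")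
proof -
  define w where "w a = (SOME v. v \<noteq> 0 \<and> v \<in> eigenspace T a)" for a
  have w: "w a \<noteq> 0" "w a \<in> eigenspace T a" if "a \<in> ?L" for a
    using someI_ex[of "\<lambda>v. v \<noteq> 0 \<and> v \<in> eigenspace T a"] that by (simp_all add: w_def)
  have inj: "inj_on w ?L"
  proof (rule inj_onI)
    fix a b assume "a \<in> ?L" "b \<in> ?L" and ab: "w a = w b"
    then have "w a \<in> eigenspace T a" "w b \<in> eigenspace T b" "w b \<noteq> 0" using w by blast+
    then have "a *\<^sub>C w b = b *\<^sub>C w b" unfolding ab by (simp add: eigenspace_def)
    then show "a = b" using \<open>w b \<noteq> 0\<close> by simp
  qed
  have "cvec.independent (w ` ?L)"
    unfolding cvec.independent_explicit_module
  proof (intro allI impI)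
    fix S u v assume S: "finite S" "S \<subseteq> w ` ?L" "(\<Sum>v\<in>S. u v *\<^sub>C v) = 0" "v \<in> S"
    from finite_subset_image[OF S(1,2)] obtain B where B: "B \<subseteq> ?L" "finite B" "S = w ` B"
      by (elim exE conjE)
    have injB: "inj_on w B" using inj B(1) by (rule inj_on_subset)
    have wB: "w a \<noteq> 0" "w a \<in> eigenspace T a" if "a \<in> B" for a
      using w[of a] B(1) that by blast+
    have sum: "(\<Sum>a\<in>B. u (w a) *\<^sub>C w a) \<in> {0}"
      using S(3) by (simp add: B(3) sum.reindex[OF injB])
    from S(4) B(3) obtain a where a: "a \<in> B" "v = w a" by blast
    have "u (w a) *\<^sub>C w a \<in> {0}"
      by (rule eigen_component[OF B(2) T _ _ _ sum a(1)])
        (simp_all add: wB T clinear_zero cvec.subspace_scale subspace_eigenspace)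
    then show "u v = 0" using wB(1)[OF a(1)] a(2) by simp
  qed
  moreover obtain B where "finite B" "cvec.span B = (UNIV :: 'v set)"
    using fd unfolding finite_dim_def by blast
  ultimately have "finite (w ` ?L)" by (metis cvec.independent_span_bound subset_UNIV)
  then show ?thesis using inj by (rule finite_imageD)
qed

text \<open>Simultaneous diagonalisation by induction on the family: commutation makes a joint
  weight space of \<open>I\<close> stable under the new operator, so the eigencomponents of its
  vectors stay inside it.\<close>

lemma joint_weight_decomposition:
  fixes op :: "'i \<Rightarrow> 'v::complex_vector \<Rightarrow> 'v"
  assumes "finite I" "\<And>i. i \<in> I \<Longrightarrow> clinear (op i)"
    and "\<And>i j v. i \<in> I \<Longrightarrow> j \<in> I \<Longrightarrow> op i (op j v) = op j (op i v)"
    and "\<And>i. i \<in> I \<Longrightarrow> cvec.span (\<Union>c. eigenspace (op i) c) = UNIV"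
  shows "cvec.span (\<Union>\<mu>. weight_space op I \<mu>) = UNIV"
  using assms
proof (induction I)
  case empty
  have "(\<Union>\<mu>. weight_space op {} \<mu>) = UNIV" by (auto simp: weight_space_def)
  then show ?case by simp
next
  case (insert i I)
  let ?N = "cvec.span (\<Union>\<mu>. weight_space op (insert i I) \<mu>)"
  have "weight_space op I \<mu> \<subseteq> ?N" for \<mu>
  proof
    fix v assume v: "v \<in> weight_space op I \<mu>"
    have i: "clinear (op i)" using insert.prems(1) by simp
    have "v \<in> cvec.span (\<Union>c. eigenspace (op i) c)" using insert.prems(3)[of i] by simp
    then obtain C w where C: "finite C" "\<And>c. c \<in> C \<Longrightarrow> w c \<in> eigenspace (op i) c" "v = (\<Sum>c\<in>C. w c)"
      by (rule span_Union_decomp[rotated]) (auto intro: subspace_eigenspace i)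
    have "w c \<in> ?N" if c: "c \<in> C" for c
    proof -
      have "w c \<in> weight_space op I \<mu>"
      proof (rule eigen_component[OF C(1) i _ _ C(2) _ c])
        show "cvec.subspace (weight_space op I \<mu>)"
          by (rule subspace_weight_space) (use insert.prems(1) in blast)
        show "op i v \<in> weight_space op I \<mu>" if "v \<in> weight_space op I \<mu>" for v
          using that i insert.prems(2)[of _ i] by (auto simp: weight_space_def clinear_scale)
      qed (use C(3) v in auto)
      then have "w c \<in> weight_space op (insert i I) (\<mu>(i := c))"
        using C(2)[OF c] insert.hyps(2) by (auto simp: weight_space_def eigenspace_def)
      then show ?thesis by (blast intro: cvec.span_base)
    qed
    then show "v \<in> ?N" unfolding C(3) by (rule cvec.span_sum)
  qed
  then have "cvec.span (\<Union>\<mu>. weight_space op I \<mu>) \<subseteq> ?N"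
    by (intro cvec.span_minimal) auto
  then show ?case using insert by auto
qed

section \<open>Traces in finite dimension\<close>

lemma trace_basis:
  assumes "finite_dim (UNIV :: 'v::complex_vector set)"
  shows "finite (cvec.extend_basis {} :: 'v set)" "cvec.independent (cvec.extend_basis {} :: 'v set)"
    "cvec.span (cvec.extend_basis {} :: 'v set) = UNIV"
proof -
  show i: "cvec.independent (cvec.extend_basis {} :: 'v set)"
    by (simp add: cvec.independent_extend_basis cvec.independent_empty)
  show "cvec.span (cvec.extend_basis {} :: 'v set) = UNIV"
    by (simp add: cvec.span_extend_basis cvec.independent_empty)
  from assms show "finite (cvec.extend_basis {} :: 'v set)"
    unfolding finite_dim_def by (metis i cvec.independent_span_bound subset_UNIV)
qed

lemma trace_add:
  assumes "finite_dim (UNIV :: 'v::complex_vector set)"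
  shows "trace (\<lambda>z::'v. A z + B z) = trace A + trace B"
  by (simp add: trace_def cvec.representation_add trace_basis[OF assms] sum.distrib)

lemma trace_scale:
  assumes "finite_dim (UNIV :: 'v::complex_vector set)"
  shows "trace (\<lambda>z::'v. c *\<^sub>C A z) = c * trace A"
  by (simp add: trace_def cvec.representation_scale trace_basis[OF assms] sum_distrib_left)

lemma trace_diff:
  assumes "finite_dim (UNIV :: 'v::complex_vector set)"
  shows "trace (\<lambda>z::'v. A z - B z) = trace A - trace B"
  by (simp add: trace_def cvec.representation_diff trace_basis[OF assms] sum_subtractf)

lemma trace_commute:
  fixes A B :: "'v::complex_vector \<Rightarrow> 'v"
  assumes fd: "finite_dim (UNIV :: 'v set)" and A: "clinear A" and B: "clinear B"
  shows "trace (\<lambda>z. A (B z)) = trace (\<lambda>z. B (A z))"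
proof -
  let ?B = "cvec.extend_basis {} :: 'v set"
  let ?r = "cvec.representation ?B"
  note b = trace_basis[OF fd]
  have expand: "trace (\<lambda>z. A (C z)) = (\<Sum>b\<in>?B. \<Sum>b'\<in>?B. ?r (C b) b' * ?r (A b') b)"
    if "clinear A" for A C :: "'v \<Rightarrow> 'v"
    unfolding trace_def
  proof (rule sum.cong[OF refl])
    fix b assume "b \<in> ?B"
    have "C b = (\<Sum>b'\<in>?B. ?r (C b) b' *\<^sub>C b')"
      by (rule cvec.sum_representation_eq[symmetric]) (simp_all add: b)
    then have "A (C b) = (\<Sum>b'\<in>?B. ?r (C b) b' *\<^sub>C A b')"
      by (metis (no_types, lifting) clinear_scale[OF that] clinear_sum[OF that] sum.cong)
    then show "?r (A (C b)) b = (\<Sum>b'\<in>?B. ?r (C b) b' * ?r (A b') b)"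
      by (simp add: cvec.representation_sum cvec.representation_scale b)
  qed
  show ?thesis
    unfolding expand[OF A, of B] expand[OF B, of A]
    by (subst sum.swap) (simp only: mult.commute)
qed

section \<open>The Killing form and root spaces\<close>

lemma clinear_bracket: "clinear (bracket (x :: 'g::complex_lie_algebra))"
  by (rule clinearI) (simp_all add: bracket_add_right bracket_scale_right)

lemma clinear_bracket_left: "clinear (\<lambda>x. bracket x (y :: 'g::complex_lie_algebra))"
  by (rule clinearI) (simp_all add: bracket_add_left bracket_scale_left)

lemmas bracket_zero_right [simp] = clinear_zero[OF clinear_bracket]
lemmas bracket_zero_left [simp] = clinear_zero[OF clinear_bracket_left]

lemma bracket_antisym: "bracket x y = - bracket y (x :: 'g::complex_lie_algebra)"
proof -
  have "bracket (x + y) (x + y) = bracket x y + bracket y x"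
    by (simp add: bracket_add_left bracket_add_right bracket_self[of x] bracket_self[of y])
  then have "bracket x y + bracket y x = 0" by (simp add: bracket_self)
  then show ?thesis by (simp add: eq_neg_iff_add_eq_0)
qed

lemma bracket_bracket:
  "bracket (bracket x y) z = bracket x (bracket y z) - bracket y (bracket x (z :: 'g::complex_lie_algebra))"
proof -
  have "bracket z (bracket x y) = - bracket (bracket x y) z" by (rule bracket_antisym)
  moreover have "bracket y (bracket z x) = - bracket y (bracket x z)"
    by (subst bracket_antisym[of z x]) (rule clinear_neg[OF clinear_bracket])
  ultimately show ?thesis using jacobi[of x y z] by (simp add: algebra_simps add_eq_0_iff)
qed

lemma weight_space_bracket:
  fixes e y :: "'g::complex_lie_algebra"
  assumes "lie_module \<rho>" "e \<in> weight_space bracket I \<alpha>" "v \<in> weight_space \<rho> I \<mu>"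
  shows "\<rho> e v \<in> weight_space \<rho> I (\<lambda>i. \<mu> i + \<alpha> i)"
proof -
  have lin: "clinear (\<rho> y)" "clinear (\<lambda>x. \<rho> x v)" for y v using assms(1) by (auto simp: lie_module_def)
  have "\<rho> i (\<rho> e v) = (\<mu> i + \<alpha> i) *\<^sub>C \<rho> e v" if "i \<in> I" for i
  proof -
    have "\<rho> i (\<rho> e v) = \<rho> (bracket i e) v + \<rho> e (\<rho> i v)"
      using assms(1) unfolding lie_module_def by (metis diff_add_cancel)
    also have "\<dots> = \<alpha> i *\<^sub>C \<rho> e v + \<mu> i *\<^sub>C \<rho> e v"
      using assms(2,3) that by (simp add: weight_space_def clinear_scale[OF lin(1)] clinear_scale[OF lin(2)])
    finally show ?thesis by (simp add: scaleC_add_left add.commute)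
  qed
  then show ?thesis by (simp add: weight_space_def)
qed

lemma lie_module_bracket: "lie_module (bracket :: 'g::complex_lie_algebra \<Rightarrow> 'g \<Rightarrow> 'g)"
  unfolding lie_module_def by (simp add: clinear_bracket clinear_bracket_left bracket_bracket)

lemma eigenspace_bracket:
  assumes "lie_module \<rho>" "e \<in> eigenspace (bracket x) a" "v \<in> eigenspace (\<rho> x) c"
  shows "\<rho> e v \<in> eigenspace (\<rho> x) (c + a)"
  using weight_space_bracket[of \<rho> e "{x}" "\<lambda>_. a" v "\<lambda>_. c"] assms
  by (simp add: weight_space_def eigenspace_def)

context
  assumes fd: "finite_dim (UNIV :: 'g::complex_lie_algebra set)"
begin

lemma clinear_killing: "clinear (killing (x::'g))"
proof (rule clinearI)
  fix y z :: 'g and c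
  show "killing x (y + z) = killing x y + killing x z"
    unfolding killing_def by (simp add: bracket_add_left bracket_add_right trace_add[OF fd])
  show "killing x (c *\<^sub>C y) = c *\<^sub>C killing x y"
    unfolding killing_def
    by (simp add: bracket_scale_left bracket_scale_right trace_scale[OF fd] scaleC_complex_def)
qed

lemma killing_commute: "killing (x::'g) y = killing y x"
  unfolding killing_def by (rule trace_commute[OF fd clinear_bracket clinear_bracket])

lemma clinear_killing_left: "clinear (\<lambda>u::'g. killing u v)"
  using clinear_killing[of v] by (simp add: killing_commute[of _ v])

text \<open>After expanding the brackets both sides contain the trace of \<open>x y z\<close>; what
  remains is the cyclic identity tr (y x z) = tr (x z y).\<close>

lemma killing_invariant: "killing (bracket (x::'g) y) z = killing x (bracket y z)"
proof -
  have xz: "clinear (\<lambda>w. bracket x (bracket z w))" for x z :: 'g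
    by (rule clinearI) (simp_all add: bracket_add_right bracket_scale_right)
  have "trace (\<lambda>w. bracket y (bracket x (bracket z w))) = trace (\<lambda>w. bracket x (bracket z (bracket y w)))"
    by (rule trace_commute[OF fd clinear_bracket xz])
  then show ?thesis
    unfolding killing_def bracket_bracket clinear_diff[OF clinear_bracket] trace_diff[OF fd] by simp
qed

lemma killing_skew: "killing (bracket z (x::'g)) y = - killing x (bracket z y)"
  by (subst bracket_antisym)
    (metis clinear_neg[OF clinear_killing] killing_commute killing_invariant)

lemma killing_weight_spaces:
  fixes u v :: 'g
  assumes "u \<in> weight_space bracket I \<alpha>" "v \<in> weight_space bracket I \<beta>" "i \<in> I" "\<alpha> i + \<beta> i \<noteq> 0"
  shows "killing u v = 0"
proof -
  have uv: "bracket i u = \<alpha> i *\<^sub>C u" "bracket i v = \<beta> i *\<^sub>C v"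
    using assms(1-3) by (auto simp: weight_space_def)
  have "\<alpha> i * killing u v = killing (bracket i u) v"
    by (simp add: uv clinear_scale[OF clinear_killing_left] scaleC_complex_def)
  also have "\<dots> = - (\<beta> i * killing u v)"
    by (simp add: killing_skew uv(2) clinear_scale[OF clinear_killing] scaleC_complex_def)
  finally have "(\<alpha> i + \<beta> i) * killing u v = 0" by (simp add: distrib_right)
  with assms(4) show ?thesis by simp
qed

lemma subspace_orth: "cvec.subspace (orth (L :: 'g set))"
  unfolding orth_def
  by (rule cvec.subspaceI)
    (simp_all add: killing_commute[of _ x for x] clinear_zero[OF clinear_killing]
      clinear_add[OF clinear_killing] clinear_scale[OF clinear_killing])

lemma finite_independent: "cvec.independent (B :: 'g set) \<Longrightarrow> finite B"
  using fd unfolding finite_dim_def by (metis cvec.independent_span_bound subset_UNIV)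

end

text \<open>The element \<open>x\<close> is the regular one that defines the positive system.
  Nondegeneracy of the Killing form is an axiom here; the final theorem obtains it from the
  definiteness in \<open>cartan_involution\<close>.\<close>

locale cartan_pair =
  fixes \<hh> \<tt> :: "'g::complex_lie_algebra set" and P :: "('g \<Rightarrow> complex) set" and x :: 'g
  assumes fd: "finite_dim (UNIV :: 'g set)"
    and killing_nondeg: "\<And>u :: 'g. (\<And>v. killing u v = 0) \<Longrightarrow> u = 0"
    and subalgebra: "lie_subalgebra \<hh>"
    and nondeg_\<hh>: "nondegenerate_on killing \<hh>"
    and cartan: "cartan_subalgebra \<tt>"
    and \<tt>\<hh>: "\<tt> \<subseteq> \<hh>"
    and x: "x \<in> \<tt>"
    and regular: "\<And>\<alpha>. \<alpha> \<in> roots \<tt> \<Longrightarrow> \<alpha> x \<in> \<real> \<and> \<alpha> x \<noteq> 0"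
    and P: "P = {\<alpha> \<in> roots \<tt>. Re (\<alpha> x) > 0}"
begin

lemma \<tt>_facts:
  shows abelian: "\<And>y z. y \<in> \<tt> \<Longrightarrow> z \<in> \<tt> \<Longrightarrow> bracket y z = 0"
    and subspace_\<tt>: "cvec.subspace \<tt>"
    and diagonalizable: "\<And>y. y \<in> \<tt> \<Longrightarrow> cvec.span (\<Union>c. eigenspace (bracket y) c) = UNIV"
proof -
  show "bracket y z = 0" if "y \<in> \<tt>" "z \<in> \<tt>" for y z
    using cartan that unfolding cartan_subalgebra_def abelian_subalgebra_def by blast
  show "cvec.subspace \<tt>"
    using cartan unfolding cartan_subalgebra_def abelian_subalgebra_def lie_subalgebra_def by blast
  show "cvec.span (\<Union>c. eigenspace (bracket y) c) = UNIV" if "y \<in> \<tt>" for y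
  proof -
    have "(\<Union>c. eigenspace (bracket y) c) = {z. \<exists>c. bracket y z = c *\<^sub>C z}"
      by (auto simp: eigenspace_def)
    then show ?thesis using cartan that unfolding cartan_subalgebra_def ad_semisimple_def by auto
  qed
qed

lemma subspace_\<hh>: "cvec.subspace \<hh>"
  and bracket_\<hh>: "y \<in> \<hh> \<Longrightarrow> z \<in> \<hh> \<Longrightarrow> bracket y z \<in> \<hh>"
  using subalgebra unfolding lie_subalgebra_def by auto

text \<open>A basis of \<open>\<tt>\<close> is a finite commuting family of diagonalisable
  operators. A joint eigenvector for the basis is one for all of \<open>\<tt>\<close>, and its
  eigenvalue depends linearly on the element.\<close>

lemma root_decomposition: "cvec.span (\<Union>\<mu>\<in>dual_space \<tt>. root_space \<tt> \<mu>) = UNIV"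
proof -
  obtain B where B: "B \<subseteq> \<tt>" "cvec.independent B" "\<tt> \<subseteq> cvec.span B"
    by (rule cvec.basis_exists)
  have spB: "cvec.span B = \<tt>"
    using B cvec.span_minimal[OF B(1) subspace_\<tt>] by blast
  have "cvec.span (\<Union>\<mu>. weight_space bracket B \<mu>) = UNIV"
  proof (rule joint_weight_decomposition)
    show "finite B" by (rule finite_independent[OF fd B(2)])
    show "bracket i (bracket j v) = bracket j (bracket i v)" if "i \<in> B" "j \<in> B" for i j v
      using bracket_bracket[of i j v] abelian that B(1) by (metis bracket_zero_left eq_iff_diff_eq_0 subsetD)
  qed (use B diagonalizable clinear_bracket in auto)
  moreover have "weight_space bracket B \<mu> \<subseteq> cvec.span (\<Union>\<mu>\<in>dual_space \<tt>. root_space \<tt> \<mu>)" for \<mu>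
  proof
    fix w assume w: "w \<in> weight_space bracket B \<mu>"
    show "w \<in> cvec.span (\<Union>\<mu>\<in>dual_space \<tt>. root_space \<tt> \<mu>)"
    proof (cases "w = 0")
      case True
      then show ?thesis by (simp add: cvec.span_zero)
    next
      case False
      have ex: "\<exists>c. bracket y w = c *\<^sub>C w" if "y \<in> \<tt>" for y
        using that unfolding spB[symmetric]
      proof (induction rule: cvec.span_induct_alt)
        case base
        show ?case by (rule exI[of _ 0]) simp
      next
        case (step c y z)
        then obtain d where d: "bracket z w = d *\<^sub>C w" by blast
        have "bracket (c *\<^sub>C y + z) w = (c * \<mu> y + d) *\<^sub>C w"
          using w step by (simp add: bracket_add_left bracket_scale_left weight_space_def d
              scaleC_add_left scaleC_scaleC)
        then show ?case by blast
      qed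
      \<comment> \<open>The given \<open>\<mu>\<close> is meaningful only on the basis
        \<open>B\<close>. The functional is rebuilt from the eigenvalues on all of
        \<open>\<tt>\<close> and set to \<open>0\<close> elsewhere, the normal form required by
        \<open>dual_space\<close>.\<close>
      define \<nu> where "\<nu> y = (if y \<in> \<tt> then SOME c. bracket y w = c *\<^sub>C w else 0)" for y
      have \<nu>: "bracket y w = \<nu> y *\<^sub>C w" if "y \<in> \<tt>" for y
        using someI_ex[OF ex[OF that]] that by (simp add: \<nu>_def)
      have uniq: "\<nu> y = c" if "y \<in> \<tt>" "bracket y w = c *\<^sub>C w" for y c
        using \<nu>[OF that(1)] that(2) False by simp
      have "\<nu> (y + z) = \<nu> y + \<nu> z" if "y \<in> \<tt>" "z \<in> \<tt>" for y z
        using that by (intro uniq cvec.subspace_add[OF subspace_\<tt>])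
          (simp_all add: bracket_add_left scaleC_add_left \<nu>)
      moreover have "\<nu> (c *\<^sub>C y) = c * \<nu> y" if "y \<in> \<tt>" for c y
        using that by (intro uniq cvec.subspace_scale[OF subspace_\<tt>])
          (simp_all add: bracket_scale_left scaleC_scaleC \<nu>)
      ultimately have "\<nu> \<in> dual_space \<tt>" by (simp add: dual_space_def) (simp add: \<nu>_def)
      moreover have "w \<in> root_space \<tt> \<nu>" by (simp add: weight_space_def \<nu>)
      ultimately show ?thesis by (blast intro: cvec.span_base)
    qed
  qed
  then have "cvec.span (\<Union>\<mu>. weight_space bracket B \<mu>)
      \<subseteq> cvec.span (\<Union>\<mu>\<in>dual_space \<tt>. root_space \<tt> \<mu>)"
    by (intro cvec.span_minimal) auto
  ultimately show ?thesis by auto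
qed

lemma dual_space_eqI:
  assumes "\<mu> \<in> dual_space \<tt>" "\<nu> \<in> dual_space \<tt>" "\<And>y. y \<in> \<tt> \<Longrightarrow> \<mu> y = \<nu> y"
  shows "\<mu> = \<nu>"
  using assms unfolding dual_space_def by (intro ext) (metis (mono_tags, lifting) mem_Collect_eq)

lemma uminus_dual_space: "\<mu> \<in> dual_space \<tt> \<Longrightarrow> (\<lambda>y. - \<mu> y) \<in> dual_space \<tt>"
  unfolding dual_space_def by auto

text \<open>Distinct elements of \<open>dual_space \<tt>\<close> already differ on
  \<open>\<tt>\<close>, so \<open>weight_component\<close> keeps all components inside the stable
  subspace. It is applied with \<open>W\<close> equal to \<open>\<hh>\<close>,
  \<open>orth \<hh>\<close> and the whole algebra.\<close>

lemma root_components: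
  assumes "cvec.subspace W" "\<And>y v. y \<in> \<tt> \<Longrightarrow> v \<in> W \<Longrightarrow> bracket y v \<in> W" "v \<in> W"
  obtains A w where "finite A" "A \<subseteq> dual_space \<tt>" "\<And>\<mu>. \<mu> \<in> A \<Longrightarrow> w \<mu> \<in> root_space \<tt> \<mu> \<inter> W"
    "v = (\<Sum>\<mu>\<in>A. w \<mu>)"
proof -
  have "v \<in> cvec.span (\<Union>\<mu>\<in>dual_space \<tt>. root_space \<tt> \<mu>)" by (simp add: root_decomposition)
  then obtain A w where A: "finite A" "A \<subseteq> dual_space \<tt>" "\<And>\<mu>. \<mu> \<in> A \<Longrightarrow> w \<mu> \<in> root_space \<tt> \<mu>"
    "v = (\<Sum>\<mu>\<in>A. w \<mu>)"
    by (rule span_Union_decomp[rotated]) (auto intro: subspace_weight_space clinear_bracket)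
  have dist: "\<exists>y\<in>\<tt>. \<mu> y \<noteq> \<nu> y" if "\<mu> \<in> A" "\<nu> \<in> A" "\<mu> \<noteq> \<nu>" for \<mu> \<nu>
    using dual_space_eqI[of \<mu> \<nu>] that A(2) by blast
  have "w \<mu> \<in> W" if "\<mu> \<in> A" for \<mu>
    by (rule weight_component[where I = \<tt> and op = bracket and val = "\<lambda>\<mu>. \<mu>", OF A(1)])
      (use A(3) assms that dist in \<open>auto simp: clinear_bracket simp flip: A(4)\<close>)
  with A that show ?thesis by blast
qed

text \<open>Maximality of \<open>\<tt>\<close>: a vector commuting with \<open>\<tt>\<close> can be
  adjoined to it without losing commutativity, hence lies in it. Brackets of opposite root vectors
  therefore land in \<open>\<tt>\<close>, and so in \<open>\<hh>\<close>.\<close>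

lemma root_space_zero:
  assumes "\<And>y. y \<in> \<tt> \<Longrightarrow> \<mu> y = 0"
  shows "root_space \<tt> \<mu> = \<tt>"
proof
  show "\<tt> \<subseteq> root_space \<tt> \<mu>" using assms by (auto simp: weight_space_def abelian)
  show "root_space \<tt> \<mu> \<subseteq> \<tt>"
  proof
    fix z assume "z \<in> root_space \<tt> \<mu>"
    then have z: "bracket y z = 0" "bracket z y = 0" if "y \<in> \<tt>" for y
      using assms that bracket_antisym[of z y] by (auto simp: weight_space_def)
    let ?A = "cvec.span (insert z \<tt>)"
    have z_right: "bracket a b = 0" if "a \<in> insert z \<tt>" "b \<in> ?A" for a b
      using that(2)
      by (rule clinear_span_zero[OF clinear_bracket, rotated])
        (use that(1) z abelian bracket_self in auto)
    have comm: "bracket a b = 0" if "a \<in> ?A" "b \<in> ?A" for a b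
      using that(1) by (rule clinear_span_zero[OF clinear_bracket_left, rotated]) (rule z_right[OF _ that(2)])
    then have "abelian_subalgebra ?A"
      by (simp add: abelian_subalgebra_def lie_subalgebra_def cvec.span_zero)
    moreover have "\<tt> \<subseteq> ?A" by (meson cvec.span_superset insert_subset)
    ultimately have "?A = \<tt>" using cartan unfolding cartan_subalgebra_def by blast
    then show "z \<in> \<tt>" using cvec.span_base[of z "insert z \<tt>"] by simp
  qed
qed

end

section \<open>The complement of the subalgebra\<close>

lemma bracket_neg_left: "bracket (- x) y = - bracket x (y :: 'g::complex_lie_algebra)"
  by (rule clinear_neg[OF clinear_bracket_left])

context cartan_pair
begin

lemma bracket_orth: "y \<in> \<hh> \<Longrightarrow> z \<in> orth \<hh> \<Longrightarrow> bracket y z \<in> orth \<hh>"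
  unfolding orth_def by (simp add: killing_skew[OF fd] bracket_\<hh>)

lemma \<hh>_Int_orth: "y \<in> \<hh> \<Longrightarrow> y \<in> orth \<hh> \<Longrightarrow> y = 0"
  using nondeg_\<hh> unfolding nondegenerate_on_def orth_def by blast

text \<open>The Killing form pairs a weight space only with the opposite one, so a component of
  \<open>v\<close> that pairs with \<open>u\<close> must have weight \<open>- \<mu>\<close>; it
  remains in \<open>W\<close> because \<open>W\<close> is stable.\<close>

lemma root_pairing:
  assumes "cvec.subspace W" "\<And>y v. y \<in> \<tt> \<Longrightarrow> v \<in> W \<Longrightarrow> bracket y v \<in> W"
    and "v \<in> W" "u \<in> root_space \<tt> \<mu>" "killing u v \<noteq> 0"
  obtains f where "f \<in> W" "f \<in> root_space \<tt> (\<lambda>y. - \<mu> y)" "killing u f \<noteq> 0"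
proof -
  obtain A w where A: "\<And>\<nu>. \<nu> \<in> A \<Longrightarrow> w \<nu> \<in> root_space \<tt> \<nu> \<inter> W" "v = (\<Sum>\<nu>\<in>A. w \<nu>)"
    using root_components[OF assms(1-3)] by metis
  have "killing u v = (\<Sum>\<nu>\<in>A. killing u (w \<nu>))"
    unfolding A(2) by (rule clinear_sum[OF clinear_killing[OF fd]])
  with assms(5) obtain \<nu> where \<nu>: "\<nu> \<in> A" "killing u (w \<nu>) \<noteq> 0" by (metis sum.not_neutral_contains_not_neutral)
  have "\<nu> y = - \<mu> y" if "y \<in> \<tt>" for y
    using killing_weight_spaces[OF fd assms(4), of "w \<nu>" \<nu> y] A(1)[OF \<nu>(1)] \<nu>(2) that
    by (metis IntD1 add_eq_0_iff)
  then have "w \<nu> \<in> root_space \<tt> (\<lambda>y. - \<mu> y)"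
    using A(1)[OF \<nu>(1)] by (simp add: weight_space_def)
  with A(1)[OF \<nu>(1)] \<nu>(2) that show thesis by blast
qed

section \<open>Root strings: sl2-triples and Heisenberg triples\<close>

lemma root_string_eigenspace:
  assumes "e \<in> root_space \<tt> \<mu>" "w \<in> eigenspace (bracket x) a"
  shows "(bracket e ^^ n) w \<in> eigenspace (bracket x) (a + of_nat n * \<mu> x)"
proof (induction n)
  case 0
  show ?case using assms by simp
next
  case (Suc n)
  have "e \<in> eigenspace (bracket x) (\<mu> x)" using assms(1) x by (simp add: weight_space_def eigenspace_def)
  from eigenspace_bracket[OF lie_module_bracket this Suc] show ?case
    by (simp add: algebra_simps)
qed

text \<open>A string without a zero member would provide eigenvectors of \<open>ad x\<close> for
  infinitely many distinct eigenvalues.\<close>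

lemma root_string_terminates:
  assumes "e \<in> root_space \<tt> \<mu>" "\<mu> x \<noteq> 0" "w \<in> eigenspace (bracket x) a"
  shows "\<exists>n. (bracket e ^^ n) w = 0"
proof (rule ccontr)
  assume "\<nexists>n. (bracket e ^^ n) w = 0"
  then have "range (\<lambda>n. a + of_nat n * \<mu> x) \<subseteq> {c. \<exists>v. v \<noteq> 0 \<and> v \<in> eigenspace (bracket x) c}"
    using root_string_eigenspace[OF assms(1,3)] by blast
  then have "finite (range (\<lambda>n. a + of_nat n * \<mu> x))"
    using finite_eigenvalues[OF fd clinear_bracket] by (rule finite_subset)
  moreover have "inj (\<lambda>n::nat. a + of_nat n * \<mu> x)" using assms(2) by (auto simp: inj_on_def)
  ultimately show False using finite_imageD[of "\<lambda>n. a + of_nat n * \<mu> x" UNIV] infinite_UNIV_nat by blast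
qed

text \<open>With \<open>f w = 0\<close>, \<open>[h, w] = m w\<close> and \<open>[h, e] = p e\<close> for \<open>h = [e, f]\<close> one has
  \<open>f e\<^sup>n\<^sup>+\<^sup>1 w = - ((n + 1) m + p n (n + 1) / 2) e\<^sup>n w\<close>, so \<open>w\<close> would generate an infinite string
  of eigenvectors of \<open>ad x\<close>. This covers both the \<open>\<ss>\<ll>\<^sub>2\<close> and the Heisenberg case (\<open>p = 0\<close>).\<close>

lemma no_infinite_root_string:
  assumes e: "e \<in> root_space \<tt> \<mu>" and \<mu>: "\<mu> x \<noteq> 0"
    and w: "w \<noteq> 0" "w \<in> eigenspace (bracket x) a" and fw: "bracket f w = 0"
    and hw: "bracket (bracket e f) w = m *\<^sub>C w" and he: "bracket (bracket e f) e = p *\<^sub>C e"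
    and nz: "\<And>n. of_nat (n + 1) * m + p * (of_nat n * of_nat (n + 1) / 2) \<noteq> 0"
  shows False
proof -
  define s where "s n = (bracket e ^^ n) w" for n
  have s_Suc: "s (Suc n) = bracket e (s n)" for n by (simp add: s_def)
  have hs: "bracket (bracket e f) (s n) = (m + of_nat n * p) *\<^sub>C s n" for n
  proof (induction n)
    case 0
    show ?case by (simp add: s_def hw)
  next
    case (Suc n)
    have "bracket (bracket e f) (s (Suc n)) =
        bracket (bracket (bracket e f) e) (s n) + bracket e (bracket (bracket e f) (s n))"
      by (simp add: s_Suc bracket_bracket[of "bracket e f" e])
    also have "\<dots> = (m + of_nat (Suc n) * p) *\<^sub>C s (Suc n)"
      by (simp add: Suc he bracket_scale_left bracket_scale_right s_Suc algebra_simps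
          flip: scaleC_add_left)
    finally show ?case .
  qed
  have fs: "bracket f (s (Suc n)) = - (of_nat (n + 1) * m + p * (of_nat n * of_nat (n + 1) / 2)) *\<^sub>C s n" for n
  proof (induction n)
    case 0
    have "bracket f (bracket e w) = bracket e (bracket f w) - bracket (bracket e f) w"
      by (simp add: bracket_bracket)
    then show ?case by (simp add: s_def fw hw)
  next
    case (Suc n)
    have "bracket f (s (Suc (Suc n))) = bracket e (bracket f (s (Suc n))) - bracket (bracket e f) (s (Suc n))"
      by (simp add: s_Suc[of "Suc n"] bracket_bracket)
    also have "\<dots> = (- (of_nat (n + 1) * m + p * (of_nat n * of_nat (n + 1) / 2))
        - (m + of_nat (Suc n) * p)) *\<^sub>C s (Suc n)"
      unfolding Suc hs by (simp only: bracket_scale_right s_Suc[of n] cvec.scale_left_diff_distrib)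
    also have "- (of_nat (n + 1) * m + p * (of_nat n * of_nat (n + 1) / 2)) - (m + of_nat (Suc n) * p) =
        - (of_nat (Suc n + 1) * m + p * (of_nat (Suc n) * of_nat (Suc n + 1) / 2))"
      by (simp add: field_simps)
    finally show ?case .
  qed
  have s_nz: "s n \<noteq> 0" for n
  proof (induction n)
    case 0
    show ?case by (simp add: s_def w)
  next
    case (Suc n)
    show ?case
    proof
      assume "s (Suc n) = 0"
      then show False using fs[of n] nz[of n] Suc by (simp add: add_eq_0_iff)
    qed
  qed
  show False using root_string_terminates[OF e \<mu> w(2)] s_nz by (simp add: s_def)
qed

text \<open>If \<open>\<mu>\<close> vanished at h = [e, f], then \<open>h\<close> would commute with
  \<open>e\<close> and \<open>f\<close>, and an element of this Heisenberg type cannot act by a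
  nonzero scalar on a root vector, since strings are finite. So \<open>ad h\<close> would be zero,
  whereas \<open>killing x h = \<mu> x * killing e f\<close> is not.\<close>

lemma coroot_nonzero:
  assumes e: "e \<in> root_space \<tt> \<mu>" and f: "f \<in> root_space \<tt> (\<lambda>y. - \<mu> y)"
    and ef: "killing e f \<noteq> 0" and \<mu>: "\<mu> x \<noteq> 0"
  shows "bracket e f \<in> \<tt>" "\<mu> (bracket e f) \<noteq> 0"
proof -
  have "bracket e f \<in> root_space \<tt> (\<lambda>y. - \<mu> y + \<mu> y)"
    by (rule weight_space_bracket[OF lie_module_bracket e f])
  then show h: "bracket e f \<in> \<tt>" using root_space_zero[of "\<lambda>y. - \<mu> y + \<mu> y"] by simp
  show "\<mu> (bracket e f) \<noteq> 0"
  proof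
    assume 0: "\<mu> (bracket e f) = 0"
    have he: "bracket (bracket e f) e = 0" and hf: "bracket (bracket e f) f = 0"
      using e f h 0 by (simp_all add: weight_space_def)
    have central: "bracket (bracket e f) v = 0" if v: "v \<in> root_space \<tt> \<nu>" for v \<nu>
    proof (rule ccontr)
      assume nz: "bracket (bracket e f) v \<noteq> 0"
      define m where "m = \<nu> (bracket e f)"
      have hv: "bracket (bracket e f) v = m *\<^sub>C v" using v h by (simp add: weight_space_def m_def)
      have m: "m \<noteq> 0" and v0: "v \<noteq> 0" using nz hv by auto
      have xv: "v \<in> eigenspace (bracket x) (\<nu> x)" using v x by (simp add: weight_space_def eigenspace_def)
      define s where "s n = (bracket e ^^ n) v" for n
      have s_Suc: "s (Suc n) = bracket e (s n)" for n by (simp add: s_def)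
      have hs: "bracket (bracket e f) (s n) = m *\<^sub>C s n" for n
      proof (induction n)
        case 0
        show ?case by (simp add: s_def hv)
      next
        case (Suc n)
        have "bracket (bracket e f) (s (Suc n)) = bracket e (bracket (bracket e f) (s n))"
          using bracket_bracket[of "bracket e f" e "s n"] by (simp add: s_Suc he)
        then show ?case by (simp add: Suc bracket_scale_right s_Suc)
      qed
      have "\<exists>n. s n = 0" unfolding s_def by (rule root_string_terminates[OF e \<mu> xv])
      \<comment> \<open>The last nonzero member of the \<open>e\<close>-string through
        \<open>v\<close> is killed by \<open>e\<close>, so it can start an \<open>f\<close>-string
        of the kind excluded by \<open>no_infinite_root_string\<close>.\<close>
      define k where "k = (LEAST n. s n = 0)"
      have "s k = 0" unfolding k_def using \<open>\<exists>n. s n = 0\<close> by (rule LeastI_ex)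
      moreover have "s 0 \<noteq> 0" using v0 by (simp add: s_def)
      ultimately obtain j where j: "k = Suc j" by (cases k) auto
      have "s j \<noteq> 0" using not_less_Least[of j "\<lambda>n. s n = 0"] j by (simp add: k_def)
      show False
      \<comment> \<open>The roles of \<open>e\<close> and \<open>f\<close> are exchanged:
        \<open>h\<close> becomes \<open>- h\<close>, with eigenvalue \<open>- m\<close> on
        \<open>s j\<close>, and \<open>p = 0\<close>.\<close>
      proof (rule no_infinite_root_string[OF f _ \<open>s j \<noteq> 0\<close> root_string_eigenspace[OF e xv, of j, folded s_def]])
        show "bracket e (s j) = 0" using \<open>s k = 0\<close> j by (simp add: s_Suc)
        show "bracket (bracket f e) (s j) = (- m) *\<^sub>C s j"
          using hs[of j] bracket_antisym[of f e] by (simp add: bracket_neg_left)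
        show "bracket (bracket f e) f = 0 *\<^sub>C f"
          using hf bracket_antisym[of f e] by (simp add: bracket_neg_left)
        show "of_nat (n + 1) * - m + 0 * (of_nat n * of_nat (n + 1) / 2) \<noteq> 0" for n :: nat
          using m of_nat_neq_0[of n, where 'a=complex] by (simp del: of_nat_Suc)
      qed (use \<mu> in simp)
    qed
    have "bracket (bracket e f) v = 0" for v
      by (rule clinear_span_zero[OF clinear_bracket, of "\<Union>\<mu>\<in>dual_space \<tt>. root_space \<tt> \<mu>"])
        (use central root_decomposition in auto)
    then have "killing x (bracket e f) = 0"
      by (simp add: killing_def trace_def cvec.representation_zero)
    moreover have "killing x (bracket e f) = \<mu> x * killing e f"
      using e x killing_invariant[OF fd, of x e f]
      by (simp add: weight_space_def clinear_scale[OF clinear_killing_left[OF fd]] scaleC_complex_def)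
    ultimately show False using ef \<mu> by simp
  qed
qed

text \<open>Otherwise the root space and its opposite contain elements \<open>e\<close>,
  \<open>f\<close> of \<open>\<hh>\<close> that form an sl2-triple up to scaling. Then
  \<open>f\<close> kills \<open>w\<close>, because [f, w] lies both in \<open>\<tt>\<close> and in
  \<open>orth \<hh>\<close>. But \<open>w\<close> has the weight of \<open>e\<close>, and a vector
  killed by \<open>f\<close> cannot have positive sl2-weight.\<close>

lemma root_space_subset_orth:
  assumes w: "w \<in> root_space \<tt> \<mu>" "w \<in> orth \<hh>" "w \<noteq> 0" and \<mu>: "\<mu> x \<noteq> 0"
  shows "root_space \<tt> \<mu> \<subseteq> orth \<hh>"
proof (rule subsetI, rule ccontr)
  fix e0 assume e0: "e0 \<in> root_space \<tt> \<mu>" "e0 \<notin> orth \<hh>"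
  have st: "bracket y v \<in> \<hh>" if "y \<in> \<tt>" "v \<in> \<hh>" for y v using bracket_\<hh> that \<tt>\<hh> by blast
  from e0(2) obtain y where y: "y \<in> \<hh>" "killing e0 y \<noteq> 0" unfolding orth_def by blast
  \<comment> \<open>The vector \<open>e0\<close> need not lie in \<open>\<hh>\<close>; it only
    serves to find \<open>f\<close> in \<open>\<hh>\<close>. Nondegeneracy on \<open>\<hh>\<close>
    then yields a partner \<open>e\<close> of \<open>f\<close> inside \<open>\<hh>\<close>.\<close>
  obtain f where f: "f \<in> \<hh>" "f \<in> root_space \<tt> (\<lambda>y. - \<mu> y)" "killing e0 f \<noteq> 0"
    by (rule root_pairing[OF subspace_\<hh> st y(1) e0(1) y(2)])
  have "f \<noteq> 0" using f(3) clinear_zero[OF clinear_killing[OF fd]] by auto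
  then obtain y' where y': "y' \<in> \<hh>" "killing f y' \<noteq> 0"
    using nondeg_\<hh> f(1) unfolding nondegenerate_on_def by blast
  obtain e where e: "e \<in> root_space \<tt> \<mu>" "e \<in> \<hh>" "killing f e \<noteq> 0"
    using root_pairing[OF subspace_\<hh> st y'(1) f(2) y'(2)] by (auto simp: minus_minus)
  have ef: "killing e f \<noteq> 0" using e(3) killing_commute[OF fd, of e f] by simp
  note h = coroot_nonzero[OF e(1) f(2) ef \<mu>]
  let ?m = "\<mu> (bracket e f)"
  have "bracket f w \<in> root_space \<tt> (\<lambda>y. \<mu> y + - \<mu> y)"
    by (rule weight_space_bracket[OF lie_module_bracket f(2) w(1)])
  then have "bracket f w \<in> \<hh>" using root_space_zero[of "\<lambda>y. \<mu> y + - \<mu> y"] \<tt>\<hh> by auto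
  moreover have "bracket f w \<in> orth \<hh>" by (rule bracket_orth[OF f(1) w(2)])
  ultimately have fw: "bracket f w = 0" by (rule \<hh>_Int_orth)
  show False
  proof (rule no_infinite_root_string[OF e(1) \<mu> w(3) _ fw])
    show "w \<in> eigenspace (bracket x) (\<mu> x)" using w x by (simp add: weight_space_def eigenspace_def)
    show "bracket (bracket e f) w = ?m *\<^sub>C w" "bracket (bracket e f) e = ?m *\<^sub>C e"
      using w e h(1) by (simp_all add: weight_space_def)
    \<comment> \<open>Since \<open>w\<close> and \<open>e\<close> have the same eigenvalue under
      [e, f], here \<open>p = m\<close> and the string coefficients become
      \<open>m (n + 1) (n + 2) / 2\<close>.\<close>
    show "of_nat (n + 1) * ?m + ?m * (of_nat n * of_nat (n + 1) / 2) \<noteq> 0" for n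
    proof -
      have "of_nat (n + 1) * ?m + ?m * (of_nat n * of_nat (n + 1) / 2) = ?m * (of_nat ((n + 1) * (n + 2)) / 2)"
        by (simp add: field_simps)
      moreover have "of_nat ((n + 1) * (n + 2)) \<noteq> (0 :: complex)"
        by (subst of_nat_eq_0_iff) simp
      ultimately show ?thesis using h(2) by (metis divide_eq_0_iff mult_eq_0_iff zero_neq_numeral)
    qed
  qed
qed

text \<open>\<open>nq_minus\<close> is indexed by positive roots whose own root spaces lie in
  \<open>orth \<hh>\<close>, so a vector of negative weight enters it only through the opposite
  root. A vector of weight \<open>- \<mu>\<close> outside \<open>orth \<hh>\<close> would have a
  partner of weight \<open>\<mu>\<close> in \<open>\<hh>\<close>, but that partner also lies in
  \<open>orth \<hh>\<close>. Nondegeneracy on the whole algebra makes the opposite space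
  nonzero.\<close>

lemma opposite_root_space_subset_orth:
  assumes w: "w \<in> root_space \<tt> \<mu>" "w \<in> orth \<hh>" "w \<noteq> 0" and \<mu>: "\<mu> x \<noteq> 0"
  shows "root_space \<tt> (\<lambda>y. - \<mu> y) \<subseteq> orth \<hh>" "root_space \<tt> (\<lambda>y. - \<mu> y) \<noteq> {0}"
proof -
  have orth: "root_space \<tt> \<mu> \<subseteq> orth \<hh>" by (rule root_space_subset_orth[OF w \<mu>])
  show "root_space \<tt> (\<lambda>y. - \<mu> y) \<subseteq> orth \<hh>"
  proof (rule subsetI, rule ccontr)
    fix f assume f: "f \<in> root_space \<tt> (\<lambda>y. - \<mu> y)" "f \<notin> orth \<hh>"
    have st: "bracket y v \<in> \<hh>" if "y \<in> \<tt>" "v \<in> \<hh>" for y v using bracket_\<hh> that \<tt>\<hh> by blast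
    from f(2) obtain y where y: "y \<in> \<hh>" "killing f y \<noteq> 0" unfolding orth_def by blast
    obtain e where e: "e \<in> \<hh>" "e \<in> root_space \<tt> \<mu>" "killing f e \<noteq> 0"
      using root_pairing[OF subspace_\<hh> st y(1) f(1) y(2)] by (auto simp: minus_minus)
    then have "e = 0" using orth \<hh>_Int_orth by blast
    then show False using e(3) clinear_zero[OF clinear_killing[OF fd]] by simp
  qed
  obtain v where "killing w v \<noteq> 0" using killing_nondeg w(3) by blast
  then obtain f where "f \<in> root_space \<tt> (\<lambda>y. - \<mu> y)" "killing w f \<noteq> 0"
    using root_pairing[of UNIV v w \<mu>] w(1) cvec.subspace_UNIV by blast
  then show "root_space \<tt> (\<lambda>y. - \<mu> y) \<noteq> {0}"
    using clinear_zero[OF clinear_killing[OF fd]] by auto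
qed

section \<open>Splitting \<open>orth \<hh>\<close> into \<open>nq_plus\<close> and
  \<open>nq_minus\<close>\<close>

lemma roots_q_pos_D:
  assumes "\<beta> \<in> roots_q_pos \<hh> \<tt> P"
  shows "\<beta> \<in> roots \<tt>" "Re (\<beta> x) > 0"
  using assms by (auto simp: roots_q_pos_def P)

lemma bracket_nq:
  shows "z \<in> nq_plus \<hh> \<tt> P \<Longrightarrow> bracket x z \<in> nq_plus \<hh> \<tt> P"
    and "z \<in> nq_minus \<hh> \<tt> P \<Longrightarrow> bracket x z \<in> nq_minus \<hh> \<tt> P"
proof -
  have *: "bracket x z \<in> cvec.span (\<Union>\<beta>\<in>R. root_space \<tt> (g \<beta>))"
    if "z \<in> cvec.span (\<Union>\<beta>\<in>R. root_space \<tt> (g \<beta>))" for z and R :: "('g \<Rightarrow> complex) set" and g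
    using that
  proof (induction rule: cvec.span_induct_alt)
    case base
    show ?case by (simp add: cvec.span_zero)
  next
    case (step c y z)
    then obtain \<beta> where "\<beta> \<in> R" "y \<in> root_space \<tt> (g \<beta>)" by blast
    then have "bracket x y = g \<beta> x *\<^sub>C y" using x by (simp add: weight_space_def)
    with step show ?case
      by (simp add: bracket_add_right bracket_scale_right cvec.span_add cvec.span_scale cvec.span_base)
  qed
  show "z \<in> nq_plus \<hh> \<tt> P \<Longrightarrow> bracket x z \<in> nq_plus \<hh> \<tt> P"
    and "z \<in> nq_minus \<hh> \<tt> P \<Longrightarrow> bracket x z \<in> nq_minus \<hh> \<tt> P"
    unfolding nq_plus_def nq_minus_def
    using *[of z "\<lambda>\<beta>. \<beta>"] *[of z "\<lambda>\<beta> y. - \<beta> y"] by blast+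
qed

lemma root_space_eigenspace: "root_space \<tt> \<mu> \<subseteq> eigenspace (bracket x) (\<mu> x)"
  using x by (auto simp: weight_space_def eigenspace_def)

text \<open>The sign of the real part of the \<open>ad x\<close>-eigenvalue separates the two
  spaces: a common element has components with negative real part, and each of them stays in
  \<open>nq_plus\<close>, which is spanned by eigenvectors with positive real part.\<close>

lemma nq_Int: "z \<in> nq_plus \<hh> \<tt> P \<Longrightarrow> z \<in> nq_minus \<hh> \<tt> P \<Longrightarrow> z = 0"
proof -
  assume plus: "z \<in> nq_plus \<hh> \<tt> P" and minus: "z \<in> nq_minus \<hh> \<tt> P"
  have "nq_minus \<hh> \<tt> P \<subseteq> cvec.span (\<Union>a\<in>{a. Re a < 0}. eigenspace (bracket x) a)"
    unfolding nq_minus_def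
  proof (intro cvec.span_mono UN_least)
    fix \<beta> assume \<beta>: "\<beta> \<in> roots_q_pos \<hh> \<tt> P"
    show "root_space \<tt> (\<lambda>y. - \<beta> y) \<subseteq> (\<Union>a\<in>{a. Re a < 0}. eigenspace (bracket x) a)"
      by (rule order_trans, rule root_space_eigenspace, rule UN_upper) (use roots_q_pos_D(2)[OF \<beta>] in simp)
  qed
  with minus have "z \<in> cvec.span (\<Union>a\<in>{a. Re a < 0}. eigenspace (bracket x) a)" by blast
  then obtain A w where A: "finite A" "A \<subseteq> {a. Re a < 0}"
    "\<And>a. a \<in> A \<Longrightarrow> w a \<in> eigenspace (bracket x) a" "z = (\<Sum>a\<in>A. w a)"
    by (rule span_Union_decomp[rotated]) (auto intro: subspace_eigenspace clinear_bracket)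
  have pos: "nq_plus \<hh> \<tt> P \<subseteq> cvec.span (\<Union>a\<in>{a. Re a > 0}. eigenspace (bracket x) a)"
    unfolding nq_plus_def
  proof (intro cvec.span_mono UN_least)
    fix \<beta> assume \<beta>: "\<beta> \<in> roots_q_pos \<hh> \<tt> P"
    show "root_space \<tt> \<beta> \<subseteq> (\<Union>a\<in>{a. Re a > 0}. eigenspace (bracket x) a)"
      by (rule order_trans, rule root_space_eigenspace, rule UN_upper) (use roots_q_pos_D(2)[OF \<beta>] in simp)
  qed
  have "w a = 0" if a: "a \<in> A" for a
  proof (rule eigenspace_Int_span[OF clinear_bracket A(3)[OF a]])
    have "w a \<in> nq_plus \<hh> \<tt> P"
      by (rule eigen_component[OF A(1) clinear_bracket _ _ A(3) _ a])
        (use plus bracket_nq A(4) in \<open>auto simp: nq_plus_def\<close>)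
    with pos show "w a \<in> cvec.span (\<Union>a\<in>{a. Re a > 0}. eigenspace (bracket x) a)" by blast
    show "a \<notin> {a. Re a > 0}" using A(2) a by auto
  qed
  then show "z = 0" by (simp add: A(4))
qed

lemma orth_decomposition:
  assumes "z \<in> orth \<hh>"
  obtains u v where "u \<in> nq_plus \<hh> \<tt> P" "v \<in> nq_minus \<hh> \<tt> P" "z = u + v"
proof -
  have "bracket y v \<in> orth \<hh>" if "y \<in> \<tt>" "v \<in> orth \<hh>" for y v
    using bracket_orth that \<tt>\<hh> by blast
  then obtain A w where A: "finite A" "A \<subseteq> dual_space \<tt>"
    "\<And>\<mu>. \<mu> \<in> A \<Longrightarrow> w \<mu> \<in> root_space \<tt> \<mu> \<inter> orth \<hh>" "z = (\<Sum>\<mu>\<in>A. w \<mu>)"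
    using root_components[OF subspace_orth[OF fd] _ assms] by metis
  let ?N = "{u + v | u v. u \<in> nq_plus \<hh> \<tt> P \<and> v \<in> nq_minus \<hh> \<tt> P}"
  have sub: "cvec.subspace (nq_plus \<hh> \<tt> P)" "cvec.subspace (nq_minus \<hh> \<tt> P)"
    by (simp_all add: nq_plus_def nq_minus_def)
  have "w \<mu> \<in> ?N" if \<mu>: "\<mu> \<in> A" for \<mu>
  proof (cases "w \<mu> = 0")
    case True
    then show ?thesis using cvec.subspace_0[OF sub(1)] cvec.subspace_0[OF sub(2)] by force
  next
    case nz: False
    have w: "w \<mu> \<in> root_space \<tt> \<mu>" "w \<mu> \<in> orth \<hh>" using A(3)[OF \<mu>] by auto
    have d: "\<mu> \<in> dual_space \<tt>" using A(2) \<mu> by blast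
    \<comment> \<open>Weight \<open>0\<close> is excluded because its weight space is
      \<open>\<tt>\<close>, which meets \<open>orth \<hh>\<close> only in \<open>0\<close>.\<close>
    have "\<exists>y. \<mu> y \<noteq> 0"
    proof (rule ccontr)
      assume "\<nexists>y. \<mu> y \<noteq> 0"
      then have "w \<mu> \<in> \<hh>" using root_space_zero[of \<mu>] w(1) \<tt>\<hh> by auto
      then show False using \<hh>_Int_orth w(2) nz by blast
    qed
    with d w(1) nz have root: "\<mu> \<in> roots \<tt>" unfolding roots_def by blast
    from regular[OF this] have \<mu>x: "\<mu> x \<noteq> 0" "Re (\<mu> x) \<noteq> 0" by (auto simp: complex_eq_iff complex_is_Real_iff)
    show ?thesis
    proof (cases "Re (\<mu> x) > 0")
      case True
      then have "\<mu> \<in> roots_q_pos \<hh> \<tt> P"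
        using root root_space_subset_orth[OF w nz \<mu>x(1)] by (simp add: roots_q_pos_def P)
      then have "w \<mu> \<in> nq_plus \<hh> \<tt> P" unfolding nq_plus_def using w(1) by (blast intro: cvec.span_base)
      then show ?thesis using cvec.subspace_0[OF sub(2)] by force
    next
      case False
      note opp = opposite_root_space_subset_orth[OF w nz \<mu>x(1)]
      have "(\<lambda>y. - \<mu> y) \<in> roots \<tt>"
        using root opp(2) uminus_dual_space[OF d] by (simp add: roots_def)
      then have "(\<lambda>y. - \<mu> y) \<in> roots_q_pos \<hh> \<tt> P"
        using opp(1) False \<mu>x(2) by (simp add: roots_q_pos_def P)
      moreover have "w \<mu> \<in> root_space \<tt> (\<lambda>y. - (\<lambda>y. - \<mu> y) y)" using w(1) by simp
      ultimately have "w \<mu> \<in> nq_minus \<hh> \<tt> P" unfolding nq_minus_def by (blast intro: cvec.span_base)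
      then show ?thesis using cvec.subspace_0[OF sub(1)] by force
    qed
  qed
  then have "z \<in> ?N"
    unfolding A(4) by (rule cvec.subspace_sum[OF cvec.subspace_sums[OF sub]])
  with that show thesis by blast
qed

end

section \<open>Weights in category O\<close>

lemma generated_submodule:
  shows subspace_generated: "cvec.subspace (generated_submodule \<rho> L F)"
    and generated_closed: "y \<in> L \<Longrightarrow> v \<in> generated_submodule \<rho> L F \<Longrightarrow> \<rho> y v \<in> generated_submodule \<rho> L F"
    and generated_superset: "F \<subseteq> generated_submodule \<rho> L F"
    and generated_least: "cvec.subspace N \<Longrightarrow> (\<And>y v. y \<in> L \<Longrightarrow> v \<in> N \<Longrightarrow> \<rho> y v \<in> N) \<Longrightarrow> F \<subseteq> N
      \<Longrightarrow> generated_submodule \<rho> L F \<subseteq> N"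
proof -
  show "cvec.subspace (generated_submodule \<rho> L F)"
    unfolding generated_submodule_def by (rule cvec.subspace_Inter) blast
qed (auto simp: generated_submodule_def)

context cartan_pair
begin

text \<open>This is the sum of \<open>\<tt>\<close> and the negative root spaces, described through
  \<open>ad x\<close> so that its action evidently does not raise the real part of an
  \<open>x\<close>-eigenvalue.\<close>

abbreviation \<bb>_minus :: "'g set"
  where "\<bb>_minus \<equiv> cvec.span (\<Union>a\<in>{a. Re a \<le> 0}. eigenspace (bracket x) a)"

lemma nilp_plus_\<bb>_minus:
  obtains e b where "e \<in> nilp \<tt> P" "b \<in> \<bb>_minus" "y = e + b"
proof -
  let ?N = "{e + b | e b. e \<in> nilp \<tt> P \<and> b \<in> \<bb>_minus}"
  have sub: "cvec.subspace (nilp \<tt> P)" "cvec.subspace \<bb>_minus" by (simp_all add: nilp_def)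
  have "root_space \<tt> \<mu> \<subseteq> ?N" if \<mu>: "\<mu> \<in> dual_space \<tt>" for \<mu>
  proof
    fix w assume w: "w \<in> root_space \<tt> \<mu>"
    show "w \<in> ?N"
    proof (cases "Re (\<mu> x) \<le> 0 \<or> w = 0")
      case True
      then have "w \<in> \<bb>_minus"
        using w root_space_eigenspace[of \<mu>] cvec.span_zero by (auto intro: cvec.span_base)
      then show ?thesis using cvec.subspace_0[OF sub(1)] by force
    next
      case False
      then have "\<mu> x \<noteq> 0" by auto
      with False \<mu> w have "\<mu> \<in> roots \<tt>" unfolding roots_def by blast
      with False have "\<mu> \<in> P" by (simp add: P)
      then have "w \<in> nilp \<tt> P" unfolding nilp_def using w by (intro cvec.span_base UN_I)
      then show ?thesis using cvec.subspace_0[OF sub(2)] by force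
    qed
  qed
  then have "cvec.span (\<Union>\<mu>\<in>dual_space \<tt>. root_space \<tt> \<mu>) \<subseteq> ?N"
    by (intro cvec.span_minimal cvec.subspace_sums[OF sub]) blast
  then have "y \<in> ?N" using root_decomposition by auto
  with that show thesis by blast
qed

lemma root_gap:
  obtains \<delta> where "\<delta> > 0" "\<And>\<alpha>. \<alpha> \<in> roots \<tt> \<Longrightarrow> Re (\<alpha> x) > 0 \<Longrightarrow> \<delta> \<le> Re (\<alpha> x)"
proof -
  define S where "S = {r \<in> Re ` {a. \<exists>v. v \<noteq> 0 \<and> v \<in> eigenspace (bracket x) a}. r > 0}"
  have fin: "finite S"
    using finite_eigenvalues[OF fd clinear_bracket, of x] by (simp add: S_def)
  show thesis
  \<comment> \<open>Inserting \<open>1\<close> keeps the set nonempty when there are no positive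
    roots.\<close>
  proof (rule that[of "Min (insert 1 S)"])
    show "Min (insert 1 S) > 0" using fin by (auto simp: S_def)
    fix \<alpha> assume \<alpha>: "\<alpha> \<in> roots \<tt>" "Re (\<alpha> x) > 0"
    have "0 \<in> root_space \<tt> \<alpha>" by (simp add: weight_space_def)
    with \<alpha>(1) obtain v where "v \<noteq> 0" "v \<in> root_space \<tt> \<alpha>" unfolding roots_def by blast
    then have "Re (\<alpha> x) \<in> S" using \<alpha>(2) root_space_eigenspace[of \<alpha>] by (auto simp: S_def)
    then show "Min (insert 1 S) \<le> Re (\<alpha> x)" using fin by simp
  qed
qed

end

locale category_O_module = cartan_pair \<hh> \<tt> P x
  for \<hh> \<tt> :: "'g::complex_lie_algebra set" and P x +
  fixes \<rho> :: "'g \<Rightarrow> 'm::complex_vector \<Rightarrow> 'm"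
  assumes category_O: "category_O \<tt> P \<rho>"
begin

lemma module: "lie_module \<rho>"
  using category_O by (simp add: category_O_def)

lemma clinear_\<rho>: "clinear (\<rho> y)" and clinear_\<rho>_left: "clinear (\<lambda>y. \<rho> y v)"
  using module by (simp_all add: lie_module_def)

lemma span_\<rho>_eigenspaces: "cvec.span (\<Union>c. eigenspace (\<rho> x) c) = UNIV"
proof -
  have "(\<Union>\<mu>\<in>dual_space \<tt>. weight_space \<rho> \<tt> \<mu>) \<subseteq> (\<Union>c. eigenspace (\<rho> x) c)"
    using x by (auto simp: weight_space_def eigenspace_def)
  then have "cvec.span (\<Union>\<mu>\<in>dual_space \<tt>. weight_space \<rho> \<tt> \<mu>) \<subseteq> cvec.span (\<Union>c. eigenspace (\<rho> x) c)"
    by (rule cvec.span_mono)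
  then show ?thesis using category_O by (auto simp: category_O_def)
qed

definition below :: "real \<Rightarrow> 'm set"
  where "below K = cvec.span (\<Union>c\<in>{c. Re c \<le> K}. eigenspace (\<rho> x) c)"

lemma below_mono: "K \<le> L \<Longrightarrow> below K \<subseteq> below L"
  unfolding below_def by (intro cvec.span_mono UN_mono) auto

lemma subspace_below: "cvec.subspace (below K)"
  by (simp add: below_def)

lemma ex_below: "\<exists>K. v \<in> below K"
proof -
  have "v \<in> cvec.span (\<Union>c. eigenspace (\<rho> x) c)" by (simp add: span_\<rho>_eigenspaces)
  then show ?thesis
  proof (induction rule: cvec.span_induct_alt)
    case base
    show ?case using cvec.subspace_0[OF subspace_below] by blast
  next
    case (step c u v)
    then obtain d K where d: "u \<in> eigenspace (\<rho> x) d" and K: "v \<in> below K" by blast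
    from d have "u \<in> below (Re d)" unfolding below_def by (blast intro: cvec.span_base)
    then have "u \<in> below (max K (Re d))" "v \<in> below (max K (Re d))"
      using K below_mono[of "Re d" "max K (Re d)"] below_mono[of K "max K (Re d)"] by auto
    then show ?case by (meson cvec.subspace_add cvec.subspace_scale subspace_below)
  qed
qed

lemma ex_below_finite: "finite B \<Longrightarrow> \<exists>K. B \<subseteq> below K"
proof (induction B rule: finite_induct)
  case (insert v B)
  then obtain K where K: "B \<subseteq> below K" by blast
  obtain L where L: "v \<in> below L" using ex_below by blast
  have "insert v B \<subseteq> below (max K L)"
    using K L below_mono[of K "max K L"] below_mono[of L "max K L"] by auto
  then show ?case ..
qed simp

lemma \<bb>_minus_below:
  assumes "b \<in> \<bb>_minus" "v \<in> below K"
  shows "\<rho> b v \<in> below K"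
proof -
  have *: "\<rho> y v \<in> below K" if y: "y \<in> eigenspace (bracket x) a" "Re a \<le> 0" for y a
    using assms(2) unfolding below_def
  proof (induction rule: cvec.span_induct_alt)
    case base
    show ?case by (simp add: clinear_zero[OF clinear_\<rho>] cvec.span_zero)
  next
    case (step c u v)
    then obtain d where "u \<in> eigenspace (\<rho> x) d" "Re d \<le> K" by blast
    then have "\<rho> y u \<in> eigenspace (\<rho> x) (d + a)" "Re (d + a) \<le> K"
      using eigenspace_bracket[OF module y(1)] y(2) by auto
    then have "\<rho> y u \<in> cvec.span (\<Union>c\<in>{c. Re c \<le> K}. eigenspace (\<rho> x) c)"
      by (blast intro: cvec.span_base)
    with step show ?case
      by (simp add: clinear_add[OF clinear_\<rho>] clinear_scale[OF clinear_\<rho>] cvec.span_add cvec.span_scale)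
  qed
  show ?thesis
    using assms(1)
  proof (induction rule: cvec.span_induct_alt)
    case base
    show ?case using cvec.subspace_0[OF subspace_below] by (simp add: clinear_zero[OF clinear_\<rho>_left])
  next
    case (step c y z)
    then have "\<rho> y v \<in> below K" using * by blast
    with step show ?case
      by (simp add: clinear_add[OF clinear_\<rho>_left] clinear_scale[OF clinear_\<rho>_left]
          cvec.subspace_add cvec.subspace_scale subspace_below)
  qed
qed

text \<open>Instead of the Poincare-Birkhoff-Witt theorem: \<open>U(\<bb>\<^sup>-) U(\<nn>) F\<close> is \<open>\<gg>\<close>-stable, because
  \<open>e b v = b e v + [e, b] v\<close> and \<open>[e, b] \<in> \<nn> + \<bb>\<^sup>-\<close>.\<close>

lemma weights_bounded: "\<exists>K. below K = UNIV"
proof -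
  obtain F where F: "finite F" "generated_submodule \<rho> UNIV F = UNIV"
    using category_O unfolding category_O_def by blast
  define N where "N v = generated_submodule \<rho> (nilp \<tt> P) {v}" for v
  have "\<forall>v. \<exists>B. finite B \<and> cvec.span B = N v"
    using category_O unfolding category_O_def finite_dim_def N_def by blast
  then obtain B where B: "\<And>v. finite (B v)" "\<And>v. cvec.span (B v) = N v" by metis
  \<comment> \<open>Local finiteness gives each \<open>N v\<close> a finite spanning set, so a
    single \<open>K\<close> bounds all of them; acting with \<open>\<bb>_minus\<close> preserves
    that bound.\<close>
  obtain K where K: "(\<Union>v\<in>F. B v) \<subseteq> below K"
    using ex_below_finite[of "\<Union>v\<in>F. B v"] F(1) B(1) by auto
  define A where "A = generated_submodule \<rho> \<bb>_minus (\<Union>v\<in>F. N v)"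
  have subA: "cvec.subspace A" by (simp add: A_def subspace_generated)
  have A\<bb>: "\<rho> b v \<in> A" if "b \<in> \<bb>_minus" "v \<in> A" for b v
    using that unfolding A_def by (rule generated_closed)
  have NA: "N v \<subseteq> A" if "v \<in> F" for v
    using that generated_superset[of "\<Union>v\<in>F. N v" \<rho> \<bb>_minus] unfolding A_def by blast
  \<comment> \<open>These are the vectors that \<open>nilp \<tt> P\<close> keeps inside
    \<open>A\<close>. They form a \<open>\<bb>_minus\<close>-stable subspace containing the
    generators of \<open>A\<close>, hence exhaust \<open>A\<close>.\<close>
  let ?A' = "{v \<in> A. \<forall>e\<in>nilp \<tt> P. \<rho> e v \<in> A}"
  have "A \<subseteq> ?A'"
  proof (subst A_def, rule generated_least)
    show "cvec.subspace ?A'"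
      using subA by (intro cvec.subspaceI) (auto simp: cvec.subspace_0 cvec.subspace_add cvec.subspace_scale
          clinear_zero[OF clinear_\<rho>] clinear_add[OF clinear_\<rho>] clinear_scale[OF clinear_\<rho>])
    show "\<rho> b v \<in> ?A'" if b: "b \<in> \<bb>_minus" and v: "v \<in> ?A'" for b v
    proof -
      have "\<rho> e (\<rho> b v) \<in> A" if e: "e \<in> nilp \<tt> P" for e
      proof -
        obtain e' b' where eb: "e' \<in> nilp \<tt> P" "b' \<in> \<bb>_minus" "bracket e b = e' + b'"
          by (rule nilp_plus_\<bb>_minus)
        have "\<rho> (bracket e b) v = \<rho> e (\<rho> b v) - \<rho> b (\<rho> e v)"
          using module unfolding lie_module_def by blast
        then have "\<rho> e (\<rho> b v) = \<rho> b (\<rho> e v) + (\<rho> e' v + \<rho> b' v)"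
          by (simp add: eb(3) clinear_add[OF clinear_\<rho>_left] algebra_simps)
        then show ?thesis using v b e eb A\<bb> by (auto intro!: cvec.subspace_add[OF subA])
      qed
      then show ?thesis using A\<bb>[OF b] v by blast
    qed
    have "\<rho> e u \<in> N v" if "e \<in> nilp \<tt> P" "u \<in> N v" for e u v
      using that unfolding N_def by (rule generated_closed)
    then show "(\<Union>v\<in>F. N v) \<subseteq> ?A'" using NA by blast
  qed
  have closed: "\<rho> y v \<in> A" if "v \<in> A" for y v
  proof -
    obtain e b where "e \<in> nilp \<tt> P" "b \<in> \<bb>_minus" "y = e + b" by (rule nilp_plus_\<bb>_minus)
    then show ?thesis using that \<open>A \<subseteq> ?A'\<close> A\<bb>
      by (auto simp: clinear_add[OF clinear_\<rho>_left] intro!: cvec.subspace_add[OF subA])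
  qed
  have "v \<in> A" if "v \<in> F" for v
    using NA[OF that] generated_superset[of "{v}" \<rho> "nilp \<tt> P"] by (auto simp: N_def)
  then have "generated_submodule \<rho> UNIV F \<subseteq> A" by (intro generated_least subA closed) auto
  then have "A = UNIV" using F(2) by auto
  moreover have "A \<subseteq> below K"
    unfolding A_def
  proof (rule generated_least[OF subspace_below \<bb>_minus_below])
    show "(\<Union>v\<in>F. N v) \<subseteq> below K"
    proof (rule UN_least)
      fix v assume "v \<in> F"
      then show "N v \<subseteq> below K"
        unfolding B(2)[symmetric] by (intro cvec.span_minimal subspace_below) (use K in blast)
    qed
  qed
  ultimately show ?thesis by auto
qed

text \<open>Any eigenvalue whose real part exceeds the supremum minus \<open>\<delta>\<close> will
  do, so no maximal real part has to be found.\<close>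

lemma near_top_weight:
  assumes "v0 \<noteq> (0::'m)" and "\<delta> > 0"
  obtains c v where "v \<noteq> 0" "v \<in> eigenspace (\<rho> x) c"
    "\<And>a w. w \<in> eigenspace (\<rho> x) a \<Longrightarrow> Re a \<ge> Re c + \<delta> \<Longrightarrow> w = 0"
proof -
  obtain K where K: "below K = UNIV" using weights_bounded by blast
  define R where "R = Re ` {c. \<exists>v. v \<noteq> 0 \<and> v \<in> eigenspace (\<rho> x) c}"
  have "r \<le> K" if "r \<in> R" for r
  proof (rule ccontr)
    assume r: "\<not> r \<le> K"
    from that obtain c v where cv: "v \<noteq> 0" "v \<in> eigenspace (\<rho> x) c" "r = Re c" by (auto simp: R_def)
    have "v \<in> below K" by (simp add: K)
    then have "v = 0"
      unfolding below_def by (rule eigenspace_Int_span[OF clinear_\<rho> cv(2), rotated]) (use r cv(3) in simp)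
    with cv(1) show False ..
  qed
  then have bdd: "bdd_above R" by (rule bdd_aboveI)
  have "R \<noteq> {}"
  proof
    assume "R = {}"
    then have "v = 0" if "v \<in> (\<Union>c. eigenspace (\<rho> x) c)" for v using that by (auto simp: R_def)
    then have "cvec.span (\<Union>c. eigenspace (\<rho> x) c) \<subseteq> {0}" by (intro cvec.span_minimal) auto
    with span_\<rho>_eigenspaces assms(1) show False by auto
  qed
  then obtain r where r: "r \<in> R" "Sup R - \<delta> < r"
    using less_cSup_iff[of R "Sup R - \<delta>"] bdd assms(2) by auto
  then obtain c v where cv: "v \<noteq> 0" "v \<in> eigenspace (\<rho> x) c" "r = Re c" by (auto simp: R_def)
  show thesis
  proof (rule that[OF cv(1,2)], rule ccontr)
    fix a w assume w: "w \<in> eigenspace (\<rho> x) a" "Re a \<ge> Re c + \<delta>" "w \<noteq> 0"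
    then have "Re a \<in> R" by (auto simp: R_def)
    then have "Re a \<le> Sup R" using bdd by (rule cSup_upper)
    then show False using w(2) r(2) cv(3) by simp
  qed
qed

end

section \<open>Operators on exterior algebras and tensor products\<close>

lemma exterior_ext:
  assumes F: "clinear F" and G: "clinear G" and eq: "\<And>ys. F (wedges ys) = G (wedges ys)"
  shows "F s = G s"
  by (induction s rule: exterior_induct)
    (simp_all add: clinear_zero[OF F] clinear_zero[OF G] clinear_add[OF F] clinear_add[OF G]
      clinear_scale[OF F] clinear_scale[OF G] eq)

lemma exterior_lift_wedges:
  assumes "\<And>r. r \<in> exterior_relations \<Longrightarrow> lin_ext f r = 0"
  shows "exterior_lift f (wedges ys) = f ys"
  using exterior_lift_abs[OF assms, of "free_gen ys"] by (simp add: wedges_def)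

lemmas wedge_zero = clinear_zero[OF clinear_wedge]
lemmas wedge_neg = clinear_neg[OF clinear_wedge]
lemmas wedge_lin = clinear_add[OF clinear_wedge] clinear_scale[OF clinear_wedge] clinear_diff[OF clinear_wedge]

section \<open>Parity on the exterior algebra\<close>

definition ext_parity :: "'a::complex_vector exterior \<Rightarrow> 'a exterior"
  where "ext_parity = exterior_lift (\<lambda>ys. (-1) ^ length ys *\<^sub>C wedges ys)"

lemma ext_parity_relations:
  assumes "r \<in> exterior_relations"
  shows "lin_ext (\<lambda>ys. (-1) ^ length ys *\<^sub>C wedges ys) r = 0"
  by (rule lin_ext_exterior_relations[OF _ _ _ assms])
    (simp_all add: wedges_relations scaleC_add_right scaleC_scaleC mult.commute)

lemma clinear_ext_parity: "clinear ext_parity"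
  unfolding ext_parity_def by (rule clinear_exterior_lift[OF ext_parity_relations])

lemma ext_parity_wedges: "ext_parity (wedges ys) = (-1) ^ length ys *\<^sub>C wedges ys"
  unfolding ext_parity_def by (rule exterior_lift_wedges[OF ext_parity_relations])

lemma ext_parity_wedge: "ext_parity (wedge y s) = - wedge y (ext_parity s)"
  by (rule exterior_ext[of "\<lambda>s. ext_parity (wedge y s)" "\<lambda>s. - wedge y (ext_parity s)"])
    (auto intro!: clinearI simp: clinear_add[OF clinear_ext_parity] clinear_scale[OF clinear_ext_parity]
      wedge_lin wedge_wedges ext_parity_wedges)

lemma ext_parity_contract:
  assumes f: "clinear f"
  shows "ext_parity (contract f s) = - contract f (ext_parity s)"
proof (rule exterior_ext[of "\<lambda>s. ext_parity (contract f s)" "\<lambda>s. - contract f (ext_parity s)"])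
  note lin = clinear_add[OF clinear_ext_parity] clinear_scale[OF clinear_ext_parity]
    clinear_diff[OF clinear_ext_parity] clinear_add[OF clinear_contract[OF f]]
    clinear_scale[OF clinear_contract[OF f]] clinear_neg[OF clinear_contract[OF f]]
  show "clinear (\<lambda>s. ext_parity (contract f s))" "clinear (\<lambda>s. - contract f (ext_parity s))"
    by (auto intro!: clinearI simp: lin)
  show "ext_parity (contract f (wedges ys)) = - contract f (ext_parity (wedges ys))" for ys
  proof (induction ys)
    case Nil
    show ?case by (simp add: ext_parity_wedges scaleC_one contract_one[OF f] clinear_zero[OF clinear_ext_parity])
  next
    case (Cons y ys)
    then show ?case
      unfolding wedge_wedges[symmetric]
      by (simp add: contract_wedge[OF f] lin ext_parity_wedge wedge_neg)
  qed
qed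

section \<open>Derivations of the exterior algebra induced by linear maps\<close>

fun derivation_word :: "('a::complex_vector \<Rightarrow> 'a) \<Rightarrow> 'a list \<Rightarrow> 'a exterior" where
  "derivation_word T [] = 0"
| "derivation_word T (y # ys) = wedges (T y # ys) + wedge y (derivation_word T ys)"

definition ext_derivation :: "('a::complex_vector \<Rightarrow> 'a) \<Rightarrow> 'a exterior \<Rightarrow> 'a exterior"
  where "ext_derivation T = exterior_lift (derivation_word T)"

lemma wedge_anticommute: "wedge x (wedge y s) = - wedge y (wedge x s)"
proof -
  have "wedge (x + y) (wedge (x + y) s) = wedge x (wedge y s) + wedge y (wedge x s)"
    by (simp add: wedge_linear_arg(1) wedge_lin wedge_linear_arg(3)[of x] wedge_linear_arg(3)[of y])
  then show ?thesis by (simp add: wedge_linear_arg(3) eq_neg_iff_add_eq_0)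
qed

lemma derivation_relations:
  assumes T: "clinear T" and "r \<in> exterior_relations"
  shows "lin_ext (derivation_word T) r = 0"
proof (rule lin_ext_exterior_relations[OF _ _ _ assms(2)])
  note Tl = clinear_add[OF T] clinear_scale[OF T]
  show "derivation_word T (u @ (x + y) # v) = derivation_word T (u @ x # v) + derivation_word T (u @ y # v)"
    for u x y v
    by (induction u)
      (simp_all add: Tl wedge_lin wedge_linear_arg wedges_relations(1)[of "_ # _", simplified]
        flip: wedge_wedges, simp_all add: wedge_wedges wedges_relations wedge_lin algebra_simps)
  show "derivation_word T (u @ (c *\<^sub>C x) # v) = c *\<^sub>C derivation_word T (u @ x # v)" for u c x v
    by (induction u)
      (simp_all add: Tl wedge_linear_arg scaleC_add_right wedges_relations wedge_lin flip: wedge_wedges)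
  show "derivation_word T (u @ x # x # v) = 0" for u x v
  proof (induction u)
    case Nil
    have "wedge x (wedge (T x) (wedges v)) = - wedge (T x) (wedge x (wedges v))"
      by (rule wedge_anticommute)
    then show ?case by (simp add: wedge_lin wedge_linear_arg(3) flip: wedge_wedges)
  next
    case (Cons y u)
    then show ?case using wedges_relations(3)[of "T y # u" x v] by (simp add: wedge_zero)
  qed
qed

context
  fixes T :: "'a::complex_vector \<Rightarrow> 'a"
  assumes T: "clinear T"
begin

lemma clinear_ext_derivation: "clinear (ext_derivation T)"
  unfolding ext_derivation_def by (rule clinear_exterior_lift[OF derivation_relations[OF T]])

lemma ext_derivation_wedges: "ext_derivation T (wedges ys) = derivation_word T ys"
  unfolding ext_derivation_def by (rule exterior_lift_wedges[OF derivation_relations[OF T]])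

lemma ext_derivation_one: "ext_derivation T (wedges []) = 0"
  by (simp add: ext_derivation_wedges)

lemma ext_derivation_wedge:
  "ext_derivation T (wedge y s) = wedge (T y) s + wedge y (ext_derivation T s)"
  by (rule exterior_ext[of "\<lambda>s. ext_derivation T (wedge y s)"
        "\<lambda>s. wedge (T y) s + wedge y (ext_derivation T s)"])
    (auto intro!: clinearI simp: clinear_add[OF clinear_ext_derivation] clinear_scale[OF clinear_ext_derivation]
      wedge_lin wedge_wedges ext_derivation_wedges scaleC_add_right)

text \<open>Contraction is natural, so commuting with the derivation only moves the functional,
  which transforms contragrediently: \<open>f\<close> becomes \<open>- f o T\<close>. For a Killing
  functional and \<open>T = bracket x\<close> this is again a Killing functional.\<close>

lemma ext_derivation_contract:
  assumes f: "clinear f"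
  shows "ext_derivation T (contract f s)
    = contract f (ext_derivation T s) + contract (\<lambda>y. - f (T y)) s"
proof (rule exterior_ext[of "\<lambda>s. ext_derivation T (contract f s)"
      "\<lambda>s. contract f (ext_derivation T s) + contract (\<lambda>y. - f (T y)) s"])
  have f': "clinear (\<lambda>y. - f (T y))"
    by (rule clinearI) (simp_all add: clinear_add[OF f] clinear_add[OF T] clinear_scale[OF f]
        clinear_scale[OF T] scaleC_complex_def)
  note lin = clinear_add[OF clinear_ext_derivation] clinear_scale[OF clinear_ext_derivation]
    clinear_diff[OF clinear_ext_derivation] clinear_add[OF clinear_contract[OF f]]
    clinear_scale[OF clinear_contract[OF f]] clinear_add[OF clinear_contract[OF f']]
    clinear_scale[OF clinear_contract[OF f']]
  show "clinear (\<lambda>s. ext_derivation T (contract f s))"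
    "clinear (\<lambda>s. contract f (ext_derivation T s) + contract (\<lambda>y. - f (T y)) s)"
    by (auto intro!: clinearI simp: lin scaleC_add_right)
  show "ext_derivation T (contract f (wedges ys))
      = contract f (ext_derivation T (wedges ys)) + contract (\<lambda>y. - f (T y)) (wedges ys)" for ys
  proof (induction ys)
    case Nil
    show ?case
      by (simp add: ext_derivation_one contract_one[OF f] contract_one[OF f']
          clinear_zero[OF clinear_ext_derivation] clinear_zero[OF clinear_contract[OF f]])
  next
    case (Cons y ys)
    then show ?case
      unfolding wedge_wedges[symmetric]
      by (simp add: contract_wedge[OF f] contract_wedge[OF f'] lin ext_derivation_wedge wedge_lin)
  qed
qed

end

lemma contract_add_functional:
  assumes f: "clinear f" and g: "clinear g"
  shows "contract (\<lambda>y. f y + g y) s = contract f s + contract g s"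
proof (rule exterior_ext[of "contract (\<lambda>y. f y + g y)" "\<lambda>s. contract f s + contract g s"])
  have fg: "clinear (\<lambda>y. f y + g y)"
    by (rule clinearI) (simp_all add: clinear_add[OF f] clinear_add[OF g] clinear_scale[OF f]
        clinear_scale[OF g] scaleC_complex_def distrib_left)
  show "clinear (contract (\<lambda>y. f y + g y))" by (rule clinear_contract[OF fg])
  show "clinear (\<lambda>s. contract f s + contract g s)"
    by (rule clinearI) (simp_all add: clinear_add[OF clinear_contract] clinear_scale[OF clinear_contract]
        f g scaleC_add_right)
  show "contract (\<lambda>y. f y + g y) (wedges ys) = contract f (wedges ys) + contract g (wedges ys)" for ys
    by (induction ys)
      (simp_all add: contract_one f g fg contract_wedge scaleC_add_left wedge_lin flip: wedge_wedges)
qed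

lemma contract_scale_functional:
  assumes f: "clinear f"
  shows "contract (\<lambda>y. c * f y) s = c *\<^sub>C contract f s"
proof (rule exterior_ext[of "contract (\<lambda>y. c * f y)" "\<lambda>s. c *\<^sub>C contract f s"])
  have cf: "clinear (\<lambda>y. c * f y)"
    by (rule clinearI) (simp_all add: clinear_add[OF f] clinear_scale[OF f] scaleC_complex_def distrib_left)
  show "clinear (contract (\<lambda>y. c * f y))" by (rule clinear_contract[OF cf])
  show "clinear (\<lambda>s. c *\<^sub>C contract f s)"
    by (rule clinearI) (simp_all add: clinear_add[OF clinear_contract[OF f]]
        clinear_scale[OF clinear_contract[OF f]] scaleC_add_right scaleC_scaleC mult.commute)
  show "contract (\<lambda>y. c * f y) (wedges ys) = c *\<^sub>C contract f (wedges ys)" for ys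
    by (induction ys)
      (simp_all add: contract_one f cf contract_wedge scaleC_scaleC wedge_lin
        cvec.scale_right_diff_distrib flip: wedge_wedges)
qed

text \<open>The projection onto degree \<open>0\<close>; pairing the second tensor factor with it
  recovers \<open>v\<close> from \<open>v \<otimes> wedges []\<close>.\<close>

definition ext_counit :: "'a::complex_vector exterior \<Rightarrow> complex"
  where "ext_counit = exterior_lift (\<lambda>ys. if ys = [] then 1 else 0)"

lemma ext_counit_relations:
  assumes "r \<in> exterior_relations"
  shows "lin_ext (\<lambda>ys. if ys = [] then 1 else 0 :: complex) r = 0"
  by (rule lin_ext_exterior_relations[OF _ _ _ assms]) simp_all

lemma clinear_ext_counit: "clinear ext_counit"
  unfolding ext_counit_def by (rule clinear_exterior_lift[OF ext_counit_relations])

lemma ext_counit_one: "ext_counit (wedges []) = 1"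
  unfolding ext_counit_def by (simp add: exterior_lift_wedges[OF ext_counit_relations])

lemma span_free_gen: "(p :: 'x \<Rightarrow>\<^sub>0 complex) \<in> cvec.span (range free_gen)"
proof -
  have "p = (\<Sum>k\<in>Poly_Mapping.keys p. Poly_Mapping.lookup p k *\<^sub>C free_gen k)"
    by (rule poly_mapping_eqI)
      (auto simp: lookup_sum scaleC_poly_mapping.rep_eq lookup_single when_def
        scaleC_complex_def if_distrib in_keys_iff cong: if_cong)
  then show ?thesis
    by (metis (no_types, lifting) cvec.span_base cvec.span_scale cvec.span_sum rangeI)
qed

lemma tensor_ext:
  assumes F: "clinear F" and G: "clinear G" and eq: "\<And>v s. F (v \<otimes> s) = G (v \<otimes> s)"
  shows "F u = G u"
proof -
  have "F (abs_tensor p) = G (abs_tensor p)" for p :: "'a \<times> 'b \<Rightarrow>\<^sub>0 complex"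
    using span_free_gen[of p]
  proof (induction rule: cvec.span_induct_alt)
    case base
    show ?case by (simp add: clinear_zero[OF F] clinear_zero[OF G] flip: zero_tensor_def)
  next
    case (step c q p)
    then obtain v s where "q = free_gen (v, s)" by (metis rangeE surj_pair)
    with step(2) eq[of v s] show ?case
      by (simp add: tensor_of_def clinear_add[OF F] clinear_add[OF G] clinear_scale[OF F]
          clinear_scale[OF G] flip: scaleC_tensor.abs_eq plus_tensor.abs_eq)
  qed
  then show ?thesis by (metis abs_rep_tensor)
qed

lemma clinear_tensor_of: "clinear (\<lambda>s. v \<otimes> s)" and clinear_tensor_of_left: "clinear (\<lambda>v. v \<otimes> s)"
  by (simp_all add: clinearI tensor_of_bilinear)

lemma tensor_of_one_nonzero:
  assumes "v \<otimes> wedges [] = (0 :: ('m::complex_vector, 'a::complex_vector exterior) tensor)"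
  shows "v = 0"
proof -
  let ?f = "\<lambda>(v :: 'm, s :: 'a exterior). ext_counit s *\<^sub>C v"
  have rel: "lin_ext ?f r = 0" if "r \<in> tensor_relations" for r
    using that unfolding tensor_relations_def
    by (auto simp: clinear_diff[OF clinear_lin_ext] clinear_scale[OF clinear_lin_ext]
        clinear_add[OF clinear_ext_counit] clinear_scale[OF clinear_ext_counit]
        scaleC_add_right scaleC_add_left scaleC_scaleC scaleC_complex_def mult.commute)
  have "tensor_lift ?f (v \<otimes> wedges []) = v"
    unfolding tensor_of_def by (simp add: tensor_lift_abs[OF rel] ext_counit_one scaleC_one)
  then show ?thesis using clinear_zero[OF clinear_tensor_lift[OF rel]] assms by simp
qed

section \<open>The Dirac operator\<close>

locale dirac_setting = category_O_module \<hh> \<tt> P x \<rho>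
  for \<hh> \<tt> :: "'g::complex_lie_algebra set" and P x and \<rho> :: "'g \<Rightarrow> 'm::complex_vector \<Rightarrow> 'm" +
  fixes Z :: "'g set"
  assumes Z: "orthonormal_basis (orth \<hh>) Z"
begin

abbreviation \<gamma> :: "'g \<Rightarrow> 'g exterior \<Rightarrow> 'g exterior"
  where "\<gamma> \<equiv> clifford_action \<hh> \<tt> P"

abbreviation S :: "'g exterior set"
  where "S \<equiv> spin_module \<hh> \<tt> P"

text \<open>On the spin module this differs from the spin action of \<open>x\<close> only by a
  constant, half the sum of the roots in \<open>roots_q_pos\<close> at \<open>x\<close>. The
  normalisation gives the unit the eigenvalue \<open>0\<close>.\<close>

abbreviation \<delta> :: "'g exterior \<Rightarrow> 'g exterior"
  where "\<delta> \<equiv> ext_derivation (bracket x)"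

abbreviation cubic :: "'g exterior \<Rightarrow> 'g exterior"
  where "cubic \<equiv> cubic_term \<gamma> Z"

abbreviation D :: "('m, 'g exterior) tensor \<Rightarrow> ('m, 'g exterior) tensor"
  where "D \<equiv> dirac_operator \<hh> \<tt> P Z \<rho>"

definition H :: "('m, 'g exterior) tensor \<Rightarrow> ('m, 'g exterior) tensor"
  where "H u = tensor_map (\<rho> x) (\<lambda>s. s) u + tensor_map (\<lambda>v. v) \<delta> u"

lemma finite_Z: "finite Z"
  using Z finite_independent[OF fd] unfolding orthonormal_basis_def by blast

lemma Z_orth: "z \<in> Z \<Longrightarrow> z \<in> orth \<hh>"
  using Z cvec.span_base unfolding orthonormal_basis_def by blast

lemma bracket_x_orth: "z \<in> orth \<hh> \<Longrightarrow> bracket x z \<in> orth \<hh>"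
  using bracket_orth x \<tt>\<hh> by blast

section \<open>Sums over the orthonormal basis\<close>

lemma orthonormal_expansion:
  assumes "u \<in> orth \<hh>"
  shows "u = (\<Sum>z\<in>Z. killing u z *\<^sub>C z)"
proof -
  have "u \<in> cvec.span Z" using Z assms by (simp add: orthonormal_basis_def)
  then show ?thesis
  proof (induction rule: cvec.span_induct_alt)
    case base
    show ?case by (simp add: clinear_zero[OF clinear_killing_left[OF fd]])
  next
    case (step c u v)
    have "(\<Sum>z\<in>Z. killing u z *\<^sub>C z) = (\<Sum>z\<in>Z. if z = u then z else 0)"
      using Z step(1) unfolding orthonormal_basis_def by (intro sum.cong) (auto simp: scaleC_one)
    also have "\<dots> = u" using step(1) finite_Z by simp
    finally have u: "(\<Sum>z\<in>Z. killing u z *\<^sub>C z) = u" .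
    have "(\<Sum>z\<in>Z. killing (c *\<^sub>C u + v) z *\<^sub>C z)
        = c *\<^sub>C (\<Sum>z\<in>Z. killing u z *\<^sub>C z) + (\<Sum>z\<in>Z. killing v z *\<^sub>C z)"
      by (simp add: clinear_add[OF clinear_killing_left[OF fd]] clinear_scale[OF clinear_killing_left[OF fd]]
          scaleC_add_left sum.distrib cvec.scale_sum_right scaleC_complex_def scaleC_scaleC)
    with u step(2) show ?case by simp
  qed
qed

text \<open>The operator \<open>ad x\<close> has a skew matrix in the basis \<open>Z\<close>;
  expanding [x, z] and swapping the sums moves it to the other slot with a sign. Linearity of
  \<open>F\<close> is required only on combinations of \<open>Z\<close>, because linearity of
  \<open>\<gamma>\<close> is available only on \<open>orth \<hh>\<close>.\<close>

lemma sum_skew: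
  fixes F :: "'g \<Rightarrow> 'g \<Rightarrow> 'v::complex_vector"
  assumes l: "\<And>c w. F (\<Sum>z\<in>Z. c z *\<^sub>C z) w = (\<Sum>z\<in>Z. c z *\<^sub>C F z w)"
    and r: "\<And>c w. F w (\<Sum>z\<in>Z. c z *\<^sub>C z) = (\<Sum>z\<in>Z. c z *\<^sub>C F w z)"
  shows "(\<Sum>z\<in>Z. F (bracket x z) z) = - (\<Sum>z\<in>Z. F z (bracket x z))"
proof -
  have T: "bracket x z = (\<Sum>w\<in>Z. killing (bracket x z) w *\<^sub>C w)" if "z \<in> Z" for z
    using that by (intro orthonormal_expansion bracket_x_orth Z_orth)
  have anti: "killing (bracket x z) w = - killing (bracket x w) z" for z w
    by (simp only: killing_skew[OF fd, of x z] killing_commute[OF fd, of z])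
  have "(\<Sum>z\<in>Z. F (bracket x z) z) = (\<Sum>z\<in>Z. \<Sum>w\<in>Z. killing (bracket x z) w *\<^sub>C F w z)"
    by (intro sum.cong refl) (subst T, simp_all add: l)
  also have "\<dots> = (\<Sum>w\<in>Z. \<Sum>z\<in>Z. - (killing (bracket x w) z *\<^sub>C F w z))"
    by (subst sum.swap) (intro sum.cong refl, subst anti, rule cvec.scale_minus_left)
  also have "\<dots> = - (\<Sum>w\<in>Z. \<Sum>z\<in>Z. killing (bracket x w) z *\<^sub>C F w z)"
    by (simp add: sum_negf)
  also have "(\<Sum>w\<in>Z. \<Sum>z\<in>Z. killing (bracket x w) z *\<^sub>C F w z) = (\<Sum>z\<in>Z. F z (bracket x z))"
    by (intro sum.cong refl) (subst (2) T, simp_all add: r)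
  finally show ?thesis .
qed

text \<open>By \<open>nq_Int\<close> the two definite descriptions in \<open>clifford_action\<close>
  have unique solutions, so they evaluate to the given components.\<close>

lemma clifford_action_eq:
  assumes "u \<in> nq_plus \<hh> \<tt> P" "v \<in> nq_minus \<hh> \<tt> P"
  shows "\<gamma> (u + v) s = contract (killing u) s + wedge v s"
proof -
  have sub: "cvec.subspace (nq_plus \<hh> \<tt> P)" "cvec.subspace (nq_minus \<hh> \<tt> P)"
    by (simp_all add: nq_plus_def nq_minus_def)
  have "(THE u'. u' \<in> nq_plus \<hh> \<tt> P \<and> u + v - u' \<in> nq_minus \<hh> \<tt> P) = u"
  proof (rule the_equality)
    fix u' assume u': "u' \<in> nq_plus \<hh> \<tt> P \<and> u + v - u' \<in> nq_minus \<hh> \<tt> P"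
    have "u - u' \<in> nq_plus \<hh> \<tt> P" using u' assms sub by (simp add: cvec.subspace_diff)
    moreover have "u + v - u' - v \<in> nq_minus \<hh> \<tt> P" using u' assms sub cvec.subspace_diff by blast
    then have "u - u' \<in> nq_minus \<hh> \<tt> P" by (simp add: algebra_simps)
    ultimately show "u' = u" using nq_Int by force
  qed (use assms in simp)
  moreover have "(THE v'. v' \<in> nq_minus \<hh> \<tt> P \<and> u + v - v' \<in> nq_plus \<hh> \<tt> P) = v"
  proof (rule the_equality)
    fix v' assume v': "v' \<in> nq_minus \<hh> \<tt> P \<and> u + v - v' \<in> nq_plus \<hh> \<tt> P"
    have "v - v' \<in> nq_minus \<hh> \<tt> P" using v' assms sub by (simp add: cvec.subspace_diff)
    moreover have "u + v - v' - u \<in> nq_plus \<hh> \<tt> P" using v' assms sub cvec.subspace_diff by blast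
    then have "v - v' \<in> nq_plus \<hh> \<tt> P" by (simp add: algebra_simps)
    ultimately show "v' = v" using nq_Int by force
  qed (use assms in simp)
  ultimately show ?thesis unfolding clifford_action_def by simp
qed

lemma clinear_\<gamma>: "clinear (\<gamma> z)"
  unfolding clifford_action_def
  by (rule clinearI)
    (simp_all add: clinear_add[OF clinear_contract[OF clinear_killing[OF fd]]]
      clinear_scale[OF clinear_contract[OF clinear_killing[OF fd]]] wedge_lin scaleC_add_right)

lemma \<gamma>_add:
  assumes "z \<in> orth \<hh>" "w \<in> orth \<hh>"
  shows "\<gamma> (z + w) s = \<gamma> z s + \<gamma> w s"
proof -
  obtain a b where z: "a \<in> nq_plus \<hh> \<tt> P" "b \<in> nq_minus \<hh> \<tt> P" "z = a + b"
    by (rule orth_decomposition[OF assms(1)])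
  obtain a' b' where w: "a' \<in> nq_plus \<hh> \<tt> P" "b' \<in> nq_minus \<hh> \<tt> P" "w = a' + b'"
    by (rule orth_decomposition[OF assms(2)])
  have "a + a' \<in> nq_plus \<hh> \<tt> P" "b + b' \<in> nq_minus \<hh> \<tt> P"
    using z w by (simp_all add: nq_plus_def nq_minus_def cvec.span_add)
  note clifford_action_eq[OF this, of s]
  moreover have "killing (a + a') = (\<lambda>y. killing a y + killing a' y)"
    by (rule ext) (rule clinear_add[OF clinear_killing_left[OF fd]])
  ultimately have "\<gamma> ((a + a') + (b + b')) s
      = (contract (killing a) s + wedge b s) + (contract (killing a') s + wedge b' s)"
    by (simp add: wedge_linear_arg contract_add_functional[OF clinear_killing[OF fd] clinear_killing[OF fd]])
  also have "(a + a') + (b + b') = z + w" by (simp add: z w)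
  finally show ?thesis by (simp add: z(3) w(3) clifford_action_eq z(1,2) w(1,2))
qed

lemma \<gamma>_scale:
  assumes "z \<in> orth \<hh>"
  shows "\<gamma> (c *\<^sub>C z) s = c *\<^sub>C \<gamma> z s"
proof -
  obtain a b where z: "a \<in> nq_plus \<hh> \<tt> P" "b \<in> nq_minus \<hh> \<tt> P" "z = a + b"
    by (rule orth_decomposition[OF assms(1)])
  have "c *\<^sub>C a \<in> nq_plus \<hh> \<tt> P" "c *\<^sub>C b \<in> nq_minus \<hh> \<tt> P"
    using z by (simp_all add: nq_plus_def nq_minus_def cvec.span_scale)
  note clifford_action_eq[OF this]
  moreover have "killing (c *\<^sub>C a) = (\<lambda>y. c * killing a y)"
    by (rule ext) (simp add: clinear_scale[OF clinear_killing_left[OF fd]] scaleC_complex_def)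
  ultimately show ?thesis
    by (simp add: z(3) scaleC_add_right clifford_action_eq z wedge_linear_arg
        contract_scale_functional[OF clinear_killing[OF fd]])
qed

lemma \<gamma>_sum: "\<gamma> (\<Sum>z\<in>Z. c z *\<^sub>C z) s = (\<Sum>z\<in>Z. c z *\<^sub>C \<gamma> z s)"
proof -
  have "\<gamma> (\<Sum>z\<in>Y. c z *\<^sub>C z) s = (\<Sum>z\<in>Y. c z *\<^sub>C \<gamma> z s)" if "finite Y" "Y \<subseteq> Z" for Y
    using that
  proof (induction Y)
    case empty
    have "0 \<in> orth \<hh>" by (rule cvec.subspace_0[OF subspace_orth[OF fd]])
    from \<gamma>_scale[OF this, of 0 s] show ?case by simp
  next
    case (insert z Y)
    then have "c z *\<^sub>C z \<in> orth \<hh>" "(\<Sum>z\<in>Y. c z *\<^sub>C z) \<in> orth \<hh>"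
      using Z_orth by (auto intro!: cvec.subspace_scale cvec.subspace_sum subspace_orth[OF fd])
    with insert Z_orth show ?case by (simp add: \<gamma>_add \<gamma>_scale)
  qed
  with finite_Z show ?thesis by blast
qed

text \<open>The wedge part follows from the Leibniz rule. For the contraction part the
  contragredient functional of \<open>killing a\<close> is \<open>killing [x, a]\<close> by
  skewness, and \<open>ad x\<close> respects the splitting into \<open>nq_plus\<close> and
  \<open>nq_minus\<close>.\<close>

lemma \<delta>_\<gamma>:
  assumes "z \<in> orth \<hh>"
  shows "\<delta> (\<gamma> z s) = \<gamma> z (\<delta> s) + \<gamma> (bracket x z) s"
proof -
  obtain a b where z: "a \<in> nq_plus \<hh> \<tt> P" "b \<in> nq_minus \<hh> \<tt> P" "z = a + b"
    by (rule orth_decomposition[OF assms(1)])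
  have "(\<lambda>y. - killing a (bracket x y)) = killing (bracket x a)"
    by (simp add: fun_eq_iff killing_skew[OF fd])
  then show ?thesis
    using bracket_nq[of a] bracket_nq[of b] z
    by (simp add: bracket_add_right clifford_action_eq clinear_add[OF clinear_ext_derivation[OF clinear_bracket]]
        ext_derivation_wedge[OF clinear_bracket] ext_derivation_contract[OF clinear_bracket clinear_killing[OF fd]])
qed

lemma ext_parity_\<gamma>: "ext_parity (\<gamma> z s) = - \<gamma> z (ext_parity s)"
  unfolding clifford_action_def
  by (simp add: clinear_add[OF clinear_ext_parity] ext_parity_wedge ext_parity_contract clinear_killing[OF fd])

section \<open>Stability of the spin module\<close>

lemma subspace_S: "cvec.subspace S"
  by (simp add: spin_module_def)

lemma wedge_S:
  assumes "v \<in> nq_minus \<hh> \<tt> P" "s \<in> S"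
  shows "wedge v s \<in> S"
  using assms(2) unfolding spin_module_def
proof (induction rule: cvec.span_induct_alt)
  case base
  show ?case by (simp add: wedge_zero cvec.span_zero)
next
  case (step c s s')
  then obtain ys where "s = wedges ys" "set ys \<subseteq> nq_minus \<hh> \<tt> P" by blast
  then have "wedge v s = wedges (v # ys)" "set (v # ys) \<subseteq> nq_minus \<hh> \<tt> P"
    using assms(1) by (simp_all add: wedge_wedges)
  then have "wedge v s \<in> cvec.span {wedges ys | ys. set ys \<subseteq> nq_minus \<hh> \<tt> P}"
    by (intro cvec.span_base) blast
  with step show ?case by (simp add: wedge_lin cvec.span_add cvec.span_scale)
qed

lemma contract_S:
  assumes f: "clinear f" and "s \<in> S"
  shows "contract f s \<in> S"
proof -
  \<comment> \<open>Membership of \<open>wedges ys\<close> is carried through the induction because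
    contracting \<open>wedge y s\<close> produces a multiple of \<open>s\<close> itself.\<close>
  have *: "contract f (wedges ys) \<in> S \<and> wedges ys \<in> S" if "set ys \<subseteq> nq_minus \<hh> \<tt> P" for ys
    using that
  proof (induction ys)
    case Nil
    have "wedges [] \<in> S" unfolding spin_module_def by (rule cvec.span_base) force
    then show ?case using cvec.subspace_0[OF subspace_S] by (simp add: contract_one[OF f])
  next
    case (Cons y ys)
    then show ?case
      unfolding wedge_wedges[symmetric]
      by (auto simp: contract_wedge[OF f] intro!: wedge_S cvec.subspace_diff[OF subspace_S] cvec.subspace_scale[OF subspace_S])
  qed
  from assms(2)[unfolded spin_module_def] show ?thesis
  proof (induction rule: cvec.span_induct_alt)
    case base
    show ?case using cvec.subspace_0[OF subspace_S] by (simp add: clinear_zero[OF clinear_contract[OF f]])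
  next
    case (step c s s')
    then have "contract f s \<in> S" using * by blast
    with step show ?case
      by (simp add: clinear_add[OF clinear_contract[OF f]] clinear_scale[OF clinear_contract[OF f]]
          cvec.subspace_add[OF subspace_S] cvec.subspace_scale[OF subspace_S])
  qed
qed

lemma \<gamma>_S:
  assumes "z \<in> orth \<hh>" "s \<in> S"
  shows "\<gamma> z s \<in> S"
proof -
  obtain a b where z: "a \<in> nq_plus \<hh> \<tt> P" "b \<in> nq_minus \<hh> \<tt> P" "z = a + b"
    by (rule orth_decomposition[OF assms(1)])
  show ?thesis
    unfolding z(3) clifford_action_eq[OF z(1,2)]
    by (intro cvec.subspace_add[OF subspace_S] wedge_S contract_S z clinear_killing[OF fd] assms)
qed

section \<open>The cubic term\<close>

lemma clinear_cubic: "clinear cubic"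
  unfolding cubic_term_def
  by (rule clinearI)
    (simp_all add: clinear_add[OF clinear_\<gamma>] clinear_scale[OF clinear_\<gamma>] scaleC_add_right sum.distrib
      cvec.scale_sum_right scaleC_scaleC mult.commute mult.left_commute)

lemma cubic_S: "s \<in> S \<Longrightarrow> cubic s \<in> S"
  unfolding cubic_term_def
  by (intro cvec.subspace_scale[OF subspace_S] cvec.subspace_sum[OF subspace_S] \<gamma>_S Z_orth)

lemma ext_parity_cubic: "ext_parity (cubic s) = - cubic (ext_parity s)"
proof -
  have "ext_parity (\<gamma> a (\<gamma> b (\<gamma> c s))) = - \<gamma> a (\<gamma> b (\<gamma> c (ext_parity s)))" for a b c
    by (simp add: ext_parity_\<gamma> clinear_neg[OF clinear_\<gamma>])
  then show ?thesis
    unfolding cubic_term_def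
    by (simp add: clinear_scale[OF clinear_ext_parity] clinear_sum[OF clinear_ext_parity] sum_negf)
qed

text \<open>The commutator of \<open>\<delta>\<close> with a product of three
  \<open>\<gamma>\<close> places \<open>ad x\<close> on each factor in turn. Facts \<open>1\<close>,
  \<open>2\<close> and \<open>3\<close> transfer it with a sign to the matching argument of the
  coefficient, where the three terms add up to zero by invariance of the trilinear form.\<close>

lemma \<delta>_cubic: "\<delta> (cubic s) = cubic (\<delta> s)"
proof -
  let ?k = "\<lambda>a b c. killing a (bracket b c)"
  let ?T = "bracket x"
  let ?g = "\<lambda>a b c. \<gamma> a (\<gamma> b (\<gamma> c s))"
  note k = clinear_sum[OF clinear_killing[OF fd]] clinear_sum[OF clinear_killing_left[OF fd]]
    clinear_scale[OF clinear_killing[OF fd]] clinear_scale[OF clinear_killing_left[OF fd]]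
    clinear_sum[OF clinear_bracket] clinear_sum[OF clinear_bracket_left]
    clinear_scale[OF clinear_bracket] clinear_scale[OF clinear_bracket_left]
  note g = \<gamma>_sum clinear_sum[OF clinear_\<gamma>] clinear_scale[OF clinear_\<gamma>]
  note s = cvec.scale_sum_right cvec.scale_sum_left sum_distrib_left sum_distrib_right scaleC_scaleC
    scaleC_complex_def mult.commute mult.left_commute
  have 1: "(\<Sum>a\<in>Z. \<Sum>b\<in>Z. \<Sum>c\<in>Z. ?k a b c *\<^sub>C ?g (?T a) b c)
      = - (\<Sum>a\<in>Z. \<Sum>b\<in>Z. \<Sum>c\<in>Z. ?k (?T a) b c *\<^sub>C ?g a b c)"
  proof (rule sum_skew[where F = "\<lambda>u w. \<Sum>b\<in>Z. \<Sum>c\<in>Z. ?k w b c *\<^sub>C ?g u b c"])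
    show "(\<Sum>b\<in>Z. \<Sum>c\<in>Z. ?k w b c *\<^sub>C ?g (\<Sum>z\<in>Z. d z *\<^sub>C z) b c)
        = (\<Sum>z\<in>Z. d z *\<^sub>C (\<Sum>b\<in>Z. \<Sum>c\<in>Z. ?k w b c *\<^sub>C ?g z b c))" for d w
      apply (simp add: g s)
      apply (subst (2) sum.swap, subst sum.swap, simp)
      done
    show "(\<Sum>b\<in>Z. \<Sum>c\<in>Z. ?k (\<Sum>z\<in>Z. d z *\<^sub>C z) b c *\<^sub>C ?g w b c)
        = (\<Sum>z\<in>Z. d z *\<^sub>C (\<Sum>b\<in>Z. \<Sum>c\<in>Z. ?k z b c *\<^sub>C ?g w b c))" for d w
      apply (simp add: k s)
      apply (subst (2) sum.swap, subst sum.swap, simp)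
      done
  qed
  have 2: "(\<Sum>b\<in>Z. \<Sum>c\<in>Z. ?k a b c *\<^sub>C ?g a (?T b) c)
      = - (\<Sum>b\<in>Z. \<Sum>c\<in>Z. ?k a (?T b) c *\<^sub>C ?g a b c)" for a
  proof (rule sum_skew[where F = "\<lambda>u w. \<Sum>c\<in>Z. ?k a w c *\<^sub>C ?g a u c"])
    show "(\<Sum>c\<in>Z. ?k a w c *\<^sub>C ?g a (\<Sum>z\<in>Z. d z *\<^sub>C z) c)
        = (\<Sum>z\<in>Z. d z *\<^sub>C (\<Sum>c\<in>Z. ?k a w c *\<^sub>C ?g a z c))" for d w
      by (simp add: g s) (subst sum.swap, simp)
    show "(\<Sum>c\<in>Z. ?k a (\<Sum>z\<in>Z. d z *\<^sub>C z) c *\<^sub>C ?g a w c)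
        = (\<Sum>z\<in>Z. d z *\<^sub>C (\<Sum>c\<in>Z. ?k a z c *\<^sub>C ?g a w c))" for d w
      by (simp add: k s) (subst sum.swap, simp)
  qed
  have 3: "(\<Sum>c\<in>Z. ?k a b c *\<^sub>C ?g a b (?T c))
      = - (\<Sum>c\<in>Z. ?k a b (?T c) *\<^sub>C ?g a b c)" for a b
  proof (rule sum_skew[where F = "\<lambda>u w. ?k a b w *\<^sub>C ?g a b u"])
    show "?k a b w *\<^sub>C ?g a b (\<Sum>z\<in>Z. d z *\<^sub>C z)
        = (\<Sum>z\<in>Z. d z *\<^sub>C (?k a b w *\<^sub>C ?g a b z))" for d w
      by (simp add: g s)
    show "?k a b (\<Sum>z\<in>Z. d z *\<^sub>C z) *\<^sub>C ?g a b w
        = (\<Sum>z\<in>Z. d z *\<^sub>C (?k a b z *\<^sub>C ?g a b w))" for d w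
      by (simp add: k s)
  qed
  have inv: "?k (?T a) b c + ?k a (?T b) c + ?k a b (?T c) = 0" for a b c
  proof -
    have "bracket (?T b) c + bracket b (?T c) = ?T (bracket b c)"
      by (simp add: bracket_bracket)
    then have "?k a (?T b) c + ?k a b (?T c) = killing a (?T (bracket b c))"
      by (simp flip: clinear_add[OF clinear_killing[OF fd]])
    then show ?thesis unfolding killing_skew[OF fd, of x a] by (metis add.assoc add.left_inverse)
  qed
  have "(\<Sum>a\<in>Z. \<Sum>b\<in>Z. \<Sum>c\<in>Z. ?k a b c *\<^sub>C (?g (?T a) b c + ?g a (?T b) c + ?g a b (?T c)))
      = - (\<Sum>a\<in>Z. \<Sum>b\<in>Z. \<Sum>c\<in>Z. (?k (?T a) b c + ?k a (?T b) c + ?k a b (?T c)) *\<^sub>C ?g a b c)"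
    by (simp add: scaleC_add_right scaleC_add_left sum.distrib 1 2 3 sum_negf sum_subtractf)
  also have "\<dots> = 0" by (simp add: inv)
  finally have 0: "(\<Sum>a\<in>Z. \<Sum>b\<in>Z. \<Sum>c\<in>Z. ?k a b c *\<^sub>C (?g (?T a) b c + ?g a (?T b) c + ?g a b (?T c))) = 0" .
  have \<delta>g: "\<delta> (?g a b c) = (?g (?T a) b c + ?g a (?T b) c + ?g a b (?T c)) + \<gamma> a (\<gamma> b (\<gamma> c (\<delta> s)))"
    if "a \<in> Z" "b \<in> Z" "c \<in> Z" for a b c
    using that by (simp add: \<delta>_\<gamma> Z_orth clinear_add[OF clinear_\<gamma>] algebra_simps)
  note d = clinear_ext_derivation[OF clinear_bracket]
  have "\<delta> (cubic s) = (1 / 6) *\<^sub>C (\<Sum>a\<in>Z. \<Sum>b\<in>Z. \<Sum>c\<in>Z. ?k a b c *\<^sub>C \<delta> (?g a b c))"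
    unfolding cubic_term_def by (simp add: clinear_scale[OF d] clinear_sum[OF d])
  also have "(\<Sum>a\<in>Z. \<Sum>b\<in>Z. \<Sum>c\<in>Z. ?k a b c *\<^sub>C \<delta> (?g a b c))
     = (\<Sum>a\<in>Z. \<Sum>b\<in>Z. \<Sum>c\<in>Z. ?k a b c *\<^sub>C (?g (?T a) b c + ?g a (?T b) c + ?g a b (?T c))
         + ?k a b c *\<^sub>C \<gamma> a (\<gamma> b (\<gamma> c (\<delta> s))))"
    by (intro sum.cong refl) (simp add: \<delta>g scaleC_add_right)
  also have "\<dots> = (\<Sum>a\<in>Z. \<Sum>b\<in>Z. \<Sum>c\<in>Z. ?k a b c *\<^sub>C \<gamma> a (\<gamma> b (\<gamma> c (\<delta> s))))"
    unfolding sum.distrib 0 by simp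
  finally show ?thesis unfolding cubic_term_def .
qed

section \<open>Dirac operator, grading operator and parity on the tensor product\<close>

lemma clinear_id: "clinear (\<lambda>v::'v::complex_vector. v)"
  by (rule clinearI) simp_all

lemmas clinear_\<delta> = clinear_ext_derivation[OF clinear_bracket, of x]

lemma D_of: "D (v \<otimes> s) = (\<Sum>z\<in>Z. \<rho> z v \<otimes> \<gamma> z s) - v \<otimes> cubic s"
  unfolding dirac_operator_def
  by (simp add: tensor_map_of[OF clinear_\<rho> clinear_\<gamma>] tensor_map_of[OF clinear_id clinear_cubic])

lemma clinear_D: "clinear D"
  unfolding dirac_operator_def
  by (rule clinearI)
    (simp_all add: clinear_add[OF clinear_tensor_map[OF clinear_\<rho> clinear_\<gamma>]]
      clinear_scale[OF clinear_tensor_map[OF clinear_\<rho> clinear_\<gamma>]]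
      clinear_add[OF clinear_tensor_map[OF clinear_id clinear_cubic]]
      clinear_scale[OF clinear_tensor_map[OF clinear_id clinear_cubic]]
      sum.distrib cvec.scale_sum_right cvec.scale_right_diff_distrib)

lemma H_of: "H (v \<otimes> s) = \<rho> x v \<otimes> s + v \<otimes> \<delta> s"
  unfolding H_def by (simp add: tensor_map_of[OF clinear_\<rho> clinear_id] tensor_map_of[OF clinear_id clinear_\<delta>])

lemma clinear_H: "clinear H"
  unfolding H_def
  by (rule clinearI)
    (simp_all add: clinear_add[OF clinear_tensor_map[OF clinear_\<rho> clinear_id]]
      clinear_scale[OF clinear_tensor_map[OF clinear_\<rho> clinear_id]]
      clinear_add[OF clinear_tensor_map[OF clinear_id clinear_\<delta>]]
      clinear_scale[OF clinear_tensor_map[OF clinear_id clinear_\<delta>]] scaleC_add_right)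

text \<open>Commuting \<open>x\<close> past \<open>\<rho> z\<close> and \<open>\<delta>\<close> past
  \<open>\<gamma> z\<close> leaves two sums, with [x, z] in one tensor slot each; they cancel by
  \<open>sum_skew\<close>.\<close>

lemma H_D: "H (D u) = D (H u)"
proof (rule tensor_ext[of "\<lambda>u. H (D u)" "\<lambda>u. D (H u)"])
  note lin = clinear_add[OF clinear_H] clinear_scale[OF clinear_H] clinear_add[OF clinear_D] clinear_scale[OF clinear_D]
  show "clinear (\<lambda>u. H (D u))" "clinear (\<lambda>u. D (H u))"
    by (auto intro!: clinearI simp: lin)
  fix v s
  have skew: "(\<Sum>z\<in>Z. \<rho> (bracket x z) v \<otimes> \<gamma> z s) = - (\<Sum>z\<in>Z. \<rho> z v \<otimes> \<gamma> (bracket x z) s)"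
    by (rule sum_skew[where F = "\<lambda>u w. \<rho> u v \<otimes> \<gamma> w s"])
      (simp_all add: clinear_sum[OF clinear_\<rho>_left] clinear_scale[OF clinear_\<rho>_left]
        clinear_sum[OF clinear_tensor_of] clinear_sum[OF clinear_tensor_of_left] \<gamma>_sum tensor_of_bilinear)
  have \<rho>: "\<rho> x (\<rho> z v) = \<rho> z (\<rho> x v) + \<rho> (bracket x z) v" for z
    using module unfolding lie_module_def by (metis diff_add_cancel add.commute)
  have "H (D (v \<otimes> s)) = (\<Sum>z\<in>Z. H (\<rho> z v \<otimes> \<gamma> z s)) - H (v \<otimes> cubic s)"
    by (simp add: D_of clinear_diff[OF clinear_H] clinear_sum[OF clinear_H])
  also have "(\<Sum>z\<in>Z. H (\<rho> z v \<otimes> \<gamma> z s))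
      = (\<Sum>z\<in>Z. (\<rho> z (\<rho> x v) \<otimes> \<gamma> z s + \<rho> z v \<otimes> \<gamma> z (\<delta> s))
          + (\<rho> (bracket x z) v \<otimes> \<gamma> z s + \<rho> z v \<otimes> \<gamma> (bracket x z) s))"
    by (intro sum.cong refl) (simp add: H_of \<rho> \<delta>_\<gamma> Z_orth tensor_of_bilinear algebra_simps)
  also have "\<dots> = (\<Sum>z\<in>Z. \<rho> z (\<rho> x v) \<otimes> \<gamma> z s) + (\<Sum>z\<in>Z. \<rho> z v \<otimes> \<gamma> z (\<delta> s))"
    unfolding sum.distrib skew by simp
  also have "\<dots> - H (v \<otimes> cubic s) = D (H (v \<otimes> s))"
    by (simp add: H_of D_of clinear_add[OF clinear_D] \<delta>_cubic)
  finally show "H (D (v \<otimes> s)) = D (H (v \<otimes> s))" .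
qed

text \<open>Each term of \<open>D\<close> contains one or three factors \<open>\<gamma>\<close>,
  hence an odd number.\<close>

lemma parity_D:
  "tensor_map (\<lambda>v. v) ext_parity (D u) = - D (tensor_map (\<lambda>v. v) ext_parity u)" (is "?\<Pi> (D u) = _")
proof (rule tensor_ext[of "\<lambda>u. ?\<Pi> (D u)" "\<lambda>u. - D (?\<Pi> u)"])
  note \<Pi> = tensor_map[OF clinear_id clinear_ext_parity]
  show "clinear (\<lambda>u. ?\<Pi> (D u))" "clinear (\<lambda>u. - D (?\<Pi> u))"
    by (auto intro!: clinearI simp: clinear_add[OF clinear_D] clinear_scale[OF clinear_D]
        clinear_add[OF \<Pi>(2)] clinear_scale[OF \<Pi>(2)])
  show "?\<Pi> (D (v \<otimes> s)) = - D (?\<Pi> (v \<otimes> s))" for v s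
    by (simp add: D_of \<Pi>(1) clinear_diff[OF \<Pi>(2)] clinear_sum[OF \<Pi>(2)] ext_parity_\<gamma> ext_parity_cubic
        clinear_neg[OF clinear_tensor_of] sum_negf)
qed

lemma D_spin_tensor:
  assumes "s \<in> S"
  shows "D (v \<otimes> s) \<in> spin_tensor \<hh> \<tt> P"
  unfolding D_of spin_tensor_def
  by (intro cvec.span_diff cvec.span_sum cvec.span_base) (use assms \<gamma>_S Z_orth cubic_S in blast)+

text \<open>Each wedge factor from a negative root space lowers the real part of the
  \<open>\<delta>\<close>-eigenvalue by at least the gap \<open>r\<close>, so every word except the
  empty one ends up at or below \<open>- r\<close>.\<close>

lemma S_decomposition:
  assumes gap: "\<And>\<alpha>. \<alpha> \<in> roots \<tt> \<Longrightarrow> Re (\<alpha> x) > 0 \<Longrightarrow> r \<le> Re (\<alpha> x)" and "r > 0"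
    and "s \<in> S"
  shows "s \<in> cvec.span (insert (wedges []) (\<Union>b\<in>{b. Re b \<le> - r}. eigenspace \<delta> b))"
proof -
  let ?N = "cvec.span (insert (wedges []) (\<Union>b\<in>{b. Re b \<le> - r}. eigenspace \<delta> b))"
  have root: "wedge y s \<in> ?N" if \<beta>: "\<beta> \<in> roots_q_pos \<hh> \<tt> P" "y \<in> root_space \<tt> (\<lambda>y. - \<beta> y)" and "s \<in> ?N" for \<beta> y s
    using that(3)
  proof (induction rule: cvec.span_induct_alt)
    case base
    show ?case by (simp add: wedge_zero cvec.span_zero)
  next
    case (step c s s')
    have r: "Re (- \<beta> x) \<le> - r" using gap[of \<beta>] roots_q_pos_D[OF \<beta>(1)] by simp
    \<comment> \<open>Only \<open>Re b \<le> 0\<close> is retained: the new factor alone contributes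
      at most \<open>- r\<close>, so the unit and the other generators can be treated alike.\<close>
    from step(1) obtain b where b: "s \<in> eigenspace \<delta> b" "Re b \<le> 0"
    proof (elim insertE UN_E)
      assume "s = wedges []"
      then have "s \<in> eigenspace \<delta> 0" by (simp add: eigenspace_def ext_derivation_one[OF clinear_bracket])
      with that show thesis by simp
    next
      fix b assume "b \<in> {b. Re b \<le> - r}" "s \<in> eigenspace \<delta> b"
      with that \<open>r > 0\<close> show thesis by force
    qed
    have "bracket x y = (- \<beta> x) *\<^sub>C y" using \<beta>(2) x by (simp add: weight_space_def)
    then have "\<delta> (wedge y s) = (- \<beta> x) *\<^sub>C wedge y s + b *\<^sub>C wedge y s"
      using b(1) by (simp only: ext_derivation_wedge[OF clinear_bracket] eigenspace_def mem_Collect_eq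
          wedge_linear_arg(2) wedge_lin)
    then have "\<delta> (wedge y s) = (- \<beta> x + b) *\<^sub>C wedge y s" by (simp only: scaleC_add_left)
    moreover have "Re (- \<beta> x + b) \<le> - r" using r b(2) by simp
    ultimately have "wedge y s \<in> ?N" by (intro cvec.span_base insertI2 UN_I[of "- \<beta> x + b"]) (simp_all add: eigenspace_def)
    with step(2) show ?case by (simp add: wedge_lin cvec.span_add cvec.span_scale)
  qed
  have wedge: "wedge y s \<in> ?N" if "y \<in> nq_minus \<hh> \<tt> P" and s: "s \<in> ?N" for y s
    using that(1) unfolding nq_minus_def
  proof (induction rule: cvec.span_induct_alt)
    case base
    show ?case using wedge_linear_arg(2)[of 0 0 s] by (simp add: cvec.span_zero)
  next
    case (step c y z)
    then have "wedge y s \<in> ?N" using root s by blast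
    with step(2) show ?case by (simp add: wedge_linear_arg(1,2) cvec.span_add cvec.span_scale)
  qed
  have "wedges ys \<in> ?N" if "set ys \<subseteq> nq_minus \<hh> \<tt> P" for ys
    using that
  proof (induction ys)
    case Nil
    show ?case by (rule cvec.span_base) simp
  next
    case (Cons y ys)
    then show ?case using wedge by (simp flip: wedge_wedges)
  qed
  then have "S \<subseteq> ?N" unfolding spin_module_def by (intro cvec.span_minimal) auto
  with assms(3) show ?thesis by blast
qed

lemma dirac_cohomology_nonzero:
  assumes "v0 \<noteq> (0::'m)"
  shows "dirac_cohomology \<hh> \<tt> P Z \<rho> \<noteq> {coset (dirac_boundaries \<hh> \<tt> P Z \<rho>) 0}"
proof
  obtain r where r: "r > 0" "\<And>\<alpha>. \<alpha> \<in> roots \<tt> \<Longrightarrow> Re (\<alpha> x) > 0 \<Longrightarrow> r \<le> Re (\<alpha> x)"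
    using root_gap by metis
  obtain c v where v: "v \<noteq> 0" "v \<in> eigenspace (\<rho> x) c"
    and top: "\<And>a w. w \<in> eigenspace (\<rho> x) a \<Longrightarrow> Re a \<ge> Re c + r \<Longrightarrow> w = 0"
    using near_top_weight[OF assms r(1)] by metis
  let ?one = "wedges [] :: 'g exterior"
  \<comment> \<open>The eigenspaces are taken in the whole ambient tensor product. Their span is
    stable under \<open>D\<close> and meets the \<open>c\<close>-eigenspace only in
    \<open>0\<close>; it acts as a complement to the vectors
    \<open>m \<otimes> ?one\<close>.\<close>
  let ?E = "cvec.span (\<Union>a\<in>- {c}. eigenspace H a)"
  let ?X = "{u + w | u w. u \<in> (\<lambda>m. m \<otimes> ?one) ` eigenspace (\<rho> x) c \<and> w \<in> ?E}"
  have H_one: "m \<otimes> ?one \<in> eigenspace H a" if "m \<in> eigenspace (\<rho> x) a" for m a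
    using that by (simp add: eigenspace_def H_of ext_derivation_one[OF clinear_bracket]
        clinear_zero[OF clinear_tensor_of] tensor_of_bilinear)
  have E_Int: "u = 0" if "u \<in> eigenspace H c" "u \<in> ?E" for u
    by (rule eigenspace_Int_span[OF clinear_H that(1) _ that(2)]) simp
  have "cvec.subspace ((\<lambda>m. m \<otimes> ?one) ` eigenspace (\<rho> x) c)"
  proof (rule cvec.subspaceI)
    note sub = subspace_eigenspace[OF clinear_\<rho>, of x c]
    show "0 \<in> (\<lambda>m. m \<otimes> ?one) ` eigenspace (\<rho> x) c"
      using cvec.subspace_0[OF sub] clinear_zero[OF clinear_tensor_of_left, of ?one] by (metis image_eqI)
    show "u + w \<in> (\<lambda>m. m \<otimes> ?one) ` eigenspace (\<rho> x) c"
      if "u \<in> (\<lambda>m. m \<otimes> ?one) ` eigenspace (\<rho> x) c" "w \<in> (\<lambda>m. m \<otimes> ?one) ` eigenspace (\<rho> x) c" for u w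
      using that cvec.subspace_add[OF sub] by (auto simp flip: tensor_of_bilinear(1))
    show "a *\<^sub>C u \<in> (\<lambda>m. m \<otimes> ?one) ` eigenspace (\<rho> x) c"
      if "u \<in> (\<lambda>m. m \<otimes> ?one) ` eigenspace (\<rho> x) c" for a u
      using that cvec.subspace_scale[OF sub] by (auto simp flip: tensor_of_bilinear(3))
  qed
  then have X: "cvec.subspace ?X" by (intro cvec.subspace_sums) simp_all
  have X_E: "u \<in> ?X" if "u \<in> ?E" for u
    using that cvec.subspace_0[OF subspace_eigenspace[OF clinear_\<rho>, of x c]]
      clinear_zero[OF clinear_tensor_of_left, of ?one] by force
  have X_one: "m \<otimes> ?one \<in> ?X" if "m \<in> eigenspace (\<rho> x) a" for m a
  proof (cases "a = c")
    case True
    then show ?thesis using that cvec.span_zero by force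
  next
    case False
    then have "m \<otimes> ?one \<in> ?E" using H_one[OF that] by (blast intro: cvec.span_base)
    then show ?thesis by (rule X_E)
  qed
  have X_eig: "m \<otimes> s \<in> ?X" if m: "m \<in> eigenspace (\<rho> x) a" and s: "s \<in> eigenspace \<delta> b" "Re b \<le> - r" for m a s b
  proof (cases "a + b = c")
    case True
    \<comment> \<open>Here \<open>Re a = Re c - Re b\<close>, so \<open>a\<close> lies in the range
      excluded by the choice of \<open>c\<close>.\<close>
    then have "Re a \<ge> Re c + r" using s(2) by auto
    then have "m = 0" using top m by blast
    then show ?thesis using cvec.subspace_0[OF X] by (simp add: clinear_zero[OF clinear_tensor_of_left])
  next
    case False
    have "m \<otimes> s \<in> eigenspace H (a + b)"
      using m s by (simp add: eigenspace_def H_of tensor_of_bilinear scaleC_add_left)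
    with False have "m \<otimes> s \<in> ?E" by (blast intro: cvec.span_base)
    then show ?thesis by (rule X_E)
  qed
  have S_dec: "s \<in> cvec.span (insert ?one (\<Union>b\<in>{b. Re b \<le> - r}. eigenspace \<delta> b))" if "s \<in> S" for s
    by (rule S_decomposition) (use r that in auto)
  have X_s: "m \<otimes> s \<in> ?X" if m: "m \<in> eigenspace (\<rho> x) a" and "s \<in> S" for m a s
    using S_dec[OF that(2)]
  proof (induction rule: cvec.span_induct_alt)
    case base
    show ?case using cvec.subspace_0[OF X] by (simp add: clinear_zero[OF clinear_tensor_of])
  next
    case (step d s s')
    then have "m \<otimes> s \<in> ?X" using X_one[OF m] X_eig[OF m] by blast
    with step(2) show ?case
      unfolding tensor_of_bilinear by (intro cvec.subspace_add[OF X] cvec.subspace_scale[OF X])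
  qed
  have "m \<otimes> s \<in> ?X" if "s \<in> S" for m s
  proof -
    have "m \<in> cvec.span (\<Union>a. eigenspace (\<rho> x) a)" by (simp add: span_\<rho>_eigenspaces)
    then show ?thesis
    proof (induction rule: cvec.span_induct_alt)
      case base
      show ?case using cvec.subspace_0[OF X] by (simp add: clinear_zero[OF clinear_tensor_of_left])
    next
      case (step d m m')
      then have "m \<otimes> s \<in> ?X" using X_s that by blast
      with step(2) show ?case
        unfolding tensor_of_bilinear by (intro cvec.subspace_add[OF X] cvec.subspace_scale[OF X])
    qed
  qed
  then have "spin_tensor \<hh> \<tt> P \<subseteq> ?X"
    unfolding spin_tensor_def by (intro cvec.span_minimal[OF _ X]) blast
  then have decomp: "\<exists>m w. m \<in> eigenspace (\<rho> x) c \<and> w \<in> ?E \<and> u = m \<otimes> ?one + w"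
    if "u \<in> spin_tensor \<hh> \<tt> P" for u
    using that by blast
  have one_S: "?one \<in> S" unfolding spin_module_def by (rule cvec.span_base) force
  have D_eig: "D u \<in> eigenspace H a" if "u \<in> eigenspace H a" for u a
    using that by (simp add: eigenspace_def H_D clinear_scale[OF clinear_D])
  have D_one: "D (m \<otimes> ?one) = 0" if m: "m \<in> eigenspace (\<rho> x) c" for m
  proof -
    obtain m' w where m': "m' \<in> eigenspace (\<rho> x) c" "w \<in> ?E" "D (m \<otimes> ?one) = m' \<otimes> ?one + w"
      using decomp[OF D_spin_tensor[OF one_S]] by blast
    \<comment> \<open>Both \<open>D (m \<otimes> ?one)\<close> and \<open>m' \<otimes> ?one\<close>
      have \<open>H\<close>-eigenvalue \<open>c\<close>, hence so does their difference
      \<open>w\<close>, which also lies in \<open>?E\<close> and therefore vanishes.\<close>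
    have "w \<in> eigenspace H c"
      using cvec.subspace_diff[OF subspace_eigenspace[OF clinear_H] D_eig[OF H_one[OF m]] H_one[OF m'(1)]] m'(3)
      by simp
    then have D1: "D (m \<otimes> ?one) = m' \<otimes> ?one" using E_Int m'(2,3) by simp
    have parity: "tensor_map (\<lambda>v. v) ext_parity (n \<otimes> ?one) = n \<otimes> ?one" for n :: 'm
      by (simp add: tensor_map_of[OF clinear_id clinear_ext_parity] ext_parity_wedges scaleC_one)
    \<comment> \<open>Parity fixes the argument and, by \<open>D1\<close>, also the value, yet it
      anticommutes with \<open>D\<close>.\<close>
    have "D (m \<otimes> ?one) = - D (m \<otimes> ?one)"
      using parity_D[of "m \<otimes> ?one"] by (simp add: parity D1)
    then have "(2::complex) *\<^sub>C D (m \<otimes> ?one) = 0"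
      using scaleC_add_left[of 1 1 "D (m \<otimes> ?one)"] by (simp add: scaleC_one eq_neg_iff_add_eq_0)
    then show ?thesis by simp
  qed
  have D_E: "D w \<in> ?E" if "w \<in> ?E" for w
    using that
  proof (induction rule: cvec.span_induct_alt)
    case base
    show ?case by (simp add: clinear_zero[OF clinear_D] cvec.span_zero)
  next
    case (step a u w)
    then have "D u \<in> ?E" using D_eig by (blast intro: cvec.span_base)
    with step(2) show ?case
      by (simp add: clinear_add[OF clinear_D] clinear_scale[OF clinear_D] cvec.span_add cvec.span_scale)
  qed
  have spin: "v \<otimes> ?one \<in> spin_tensor \<hh> \<tt> P"
    unfolding spin_tensor_def using one_S by (blast intro: cvec.span_base)
  have not_image: "v \<otimes> ?one \<notin> D ` spin_tensor \<hh> \<tt> P"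
  proof
    assume "v \<otimes> ?one \<in> D ` spin_tensor \<hh> \<tt> P"
    then obtain u where u: "u \<in> spin_tensor \<hh> \<tt> P" "v \<otimes> ?one = D u" by blast
    obtain m w where mw: "m \<in> eigenspace (\<rho> x) c" "w \<in> ?E" "u = m \<otimes> ?one + w"
      using decomp[OF u(1)] by blast
    \<comment> \<open>Only the \<open>?E\<close>-part of \<open>u\<close> survives \<open>D\<close>,
      so the image lies both in the \<open>c\<close>-eigenspace and in \<open>?E\<close>.\<close>
    have "v \<otimes> ?one = D w" using D_one[OF mw(1)] u(2) by (simp add: mw(3) clinear_add[OF clinear_D])
    then have "v \<otimes> ?one = 0" using E_Int[OF H_one[OF v(2)]] D_E[OF mw(2)] by simp
    then show False using tensor_of_one_nonzero v(1) by blast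
  qed
  let ?B = "dirac_boundaries \<hh> \<tt> P Z \<rho>"
  assume eq: "dirac_cohomology \<hh> \<tt> P Z \<rho> = {coset ?B 0}"
  have ker: "v \<otimes> ?one \<in> dirac_kernel \<hh> \<tt> P Z \<rho>"
    using spin D_one[OF v(2)] by (simp add: dirac_kernel_def)
  then have "coset ?B (v \<otimes> ?one) = coset ?B 0"
    using eq unfolding dirac_cohomology_def quotient_space_def by blast
  \<comment> \<open>As \<open>0\<close> is a boundary, a vector belongs to its own coset; equality
    with the zero coset then makes \<open>v \<otimes> ?one\<close> a boundary.\<close>
  moreover have "0 \<in> ?B"
  proof -
    have 0: "0 \<in> spin_tensor \<hh> \<tt> P" by (simp add: spin_tensor_def cvec.span_zero)
    with clinear_zero[OF clinear_D] show ?thesis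
      unfolding dirac_boundaries_def dirac_kernel_def by (auto intro: image_eqI[of _ _ 0])
  qed
  then have "v \<otimes> ?one \<in> coset ?B (v \<otimes> ?one)" by (force simp: coset_def)
  ultimately have "v \<otimes> ?one \<in> ?B" by (simp add: coset_def)
  with not_image show False by (simp add: dirac_boundaries_def)
qed

end

theorem theorem3p6:
  fixes \<theta> :: "'g::complex_lie_algebra \<Rightarrow> 'g"
    and \<hh> \<tt> Z :: "'g set"
    and P :: "('g \<Rightarrow> complex) set"
    and \<rho> :: "'g \<Rightarrow> 'm::complex_vector \<Rightarrow> 'm"
  assumes "finite_dim (UNIV :: 'g set)"
    and "semisimple (UNIV :: 'g set)"
    and "cartan_involution \<theta>"
    and "lie_subalgebra \<hh>"
    and "reductive \<hh>"
    and "\<theta> ` \<hh> \<subseteq> \<hh>"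
    and "nondegenerate_on killing \<hh>"
    and "cartan_subalgebra \<tt>"
    and "\<tt> \<subseteq> \<hh>"
    and "positive_system \<tt> P"
    and "orthonormal_basis (orth \<hh>) Z"
    and "category_O \<tt> P \<rho>"
    and "\<exists>v :: 'm. v \<noteq> 0"
  shows "dirac_cohomology \<hh> \<tt> P Z \<rho> \<noteq> {coset (dirac_boundaries \<hh> \<tt> P Z \<rho>) 0}"
proof -
  obtain x where x: "x \<in> \<tt>" "\<And>\<alpha>. \<alpha> \<in> roots \<tt> \<Longrightarrow> \<alpha> x \<in> \<real> \<and> \<alpha> x \<noteq> 0"
    "P = {\<alpha> \<in> roots \<tt>. Re (\<alpha> x) > 0}"
    using assms(10) unfolding positive_system_def by blast
  \<comment> \<open>A vector orthogonal to everything would in particular be orthogonal to its own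
    image under \<open>\<theta>\<close>, against definiteness.\<close>
  have nondeg: "u = 0" if "\<And>v. killing u v = 0" for u :: 'g
  proof (rule ccontr)
    assume "u \<noteq> 0"
    then have "- (2 * Re (killing u (\<theta> u))) > 0" using assms(3) unfolding cartan_involution_def by blast
    with that show False by simp
  qed
  interpret dirac_setting \<hh> \<tt> P x \<rho> Z
    by unfold_locales (use assms x nondeg in blast)+
  obtain v0 :: 'm where "v0 \<noteq> 0" using assms(13) by blast
  then show ?thesis by (rule dirac_cohomology_nonzero)
qed

end
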